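(* Let $1\le s<\infty$, $1\le p\le\infty$, let $r_1\ge r_2\ge 1$ be integers and let $\mu>2r_1+3/2-1/s$. The following holds for all sufficiently small $\delta\in(0,1)$. I) If $r_1=r_2$, then for $N\asymp\left(\delta/\ln^{\mu}\frac1\delta\right)^{-\frac{1}{\mu-1/p+1/s}}$ $$N^{-\mu+2r_1-1/s+3/2}\preceq R^{(r_1,r_1)}_{N,\delta}(L^\mu_{s,2},C,\ell_p)\preceq N^{-\mu+2r_1-1/s+3/2}\ln^{\mu-2r_1+1/2}N,$$ $$\left(\delta/\ln^{\mu}\tfrac1\delta\right)^{\frac{\mu-2r_1+1/s-3/2}{\mu-1/p+1/s}}\preceq R^{(r_1,r_1)}_{N,\delta}(L^\mu_{s,2},C,\ell_p)\preceq\left(\delta\ln^{1/s-1/p}\tfrac1\delta\right)^{\frac{\mu-2r_1+1/s-3/2}{\mu-1/p+1/s}}\ln^{2-1/s}\tfrac1\delta .$$ The upper bounds are implemented by the method $\mathcal D^{(r_1,r_1)}_{n,\gamma}$ with $n\asymp\left(\delta/\ln^{1/p-1/s}\frac1\delta\right)^{-\frac{1}{\mu-1/p+1/s}}$ and $\gamma=1$. II) If $r_1=r_2+1$, then for $N\asymp\delta^{-\frac{1}{\mu-1/p+1/s}}$ $$R^{(r_1,r_1-1)}_{N,\delta}(L^\mu_{s,2},C,\ell_p)\asymp N^{-\mu+2r_1-1/s+3/2}\asymp\delta^{\frac{\mu-2r_1+1/s-3/2}{\mu-1/p+1/s}} .$$ The order-optimal bounds are implemented by the method $\mathcal D^{(r_1,r_1-1)}_{n,\gamma}$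 with $n\asymp\delta^{-\frac{1}{\mu-1/p+1/s}}$ and any $$\gamma\in\left(1,\tfrac{\mu-2r_1+1/s+5/2}{\mu-2r_1+1/s+1/2}\right)\cup\left(\tfrac{\mu-2r_1+1/s+5/2}{\mu-2r_1+1/s+1/2},\tfrac{\mu-2r_1+1/s+1/2}{\mu-2r_1+1/s-3/2}\right).$$ III) If $r_1>r_2+1$, then for $N\asymp\delta^{-\frac{1}{\mu-1/p+1/s}}$ $$R^{(r_1,r_2)}_{N,\delta}(L^\mu_{s,2},C,\ell_p)\asymp N^{-\mu+2r_1-1/s+3/2}\asymp\delta^{\frac{\mu-2r_1+1/s-3/2}{\mu-1/p+1/s}} .$$ The order-optimal bounds are implemented by the method $\mathcal D^{(r_1,r_2)}_{n,\gamma}$ with $n\asymp\delta^{-\frac{1}{\mu-1/p+1/s}}$ and any $$\gamma\in\left(1,\tfrac{\mu-2r_2+1/s-3/2}{\mu-2r_1+1/s+1/2}\right)\cup\left(\tfrac{\mu-2r_2+1/s-3/2}{\mu-2r_1+1/s+1/2},\tfrac{\mu-2r_2+1/s+1/2}{\mu-2r_1+1/s+1/2}\right)\cup\left(\tfrac{\mu-2r_2+1/s+1/2}{\mu-2r_1+1/s+1/2},\tfrac{\mu-2r_2+1/s-3/2}{\mu-2r_1+1/s-3/2}\right).$$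
   Context: Convention: $1/\infty=0$. Let $\varphi_k(t)=\sqrt{k+1/2}\,(2^kk!)^{-1}\frac{d^k}{dt^k}[(t^2-1)^k]$, $k=0,1,2,\dots$, be the Legendre polynomials orthonormal on $[-1,1]$, let $Q=[-1,1]^2$, and for $f\in L_2(Q)$ let $\langle f,\varphi_{k,j}\rangle=\int_{-1}^1\int_{-1}^1 f(t,\tau)\varphi_k(t)\varphi_j(\tau)\,d\tau\,dt$. $C=C(Q)$ is the space of continuous functions on $Q$ with the sup norm. With $\underline{k}=\max\{1,k\}$, for $\mu>0$, $1\le s<\infty$, $$L^\mu_{s,2}=\Big\{f\in L_2(Q):\ \|f\|_{s,\mu}^s:=\sum_{k,j=0}^\infty(\underline{k}\cdot\underline{j})^{s\mu}|\langle f,\varphi_{k,j}\rangle|^s<\infty\Big\}.$$ The mixed derivative of $f=\sum_{k,j\ge0}\langle f,\varphi_{k,j}\rangle\varphi_k(t)\varphi_j(\tau)$ is the series $f^{(r_1,r_2)}(t,\tau)=\sum_{k=r_1}^\infty\sum_{j=r_2}^\infty\langle f,\varphi_{k,j}\rangle\varphi_k^{(r_1)}(t)\varphi_j^{(r_2)}(\tau)$. Perturbed data: $\overline{f^\delta}=\{\langle f_\delta,\varphi_{k,j}\rangle\}_{k,j\ge0}$ is any numerical sequence such that $\overline\xi=\{\langle f,\varphi_{k,j}\rangle-\langle f_\delta,\varphi_{k,j}\rangle\}_{k,j\ge0}$ satisfies $\|\overline\xi\|_{\ell_p}\le\delta$, $0<\delta<1$ ($\ell_p$ is the usual norm on double sequences).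 Minimal radius: for a bounded (finite) set $\Omega$ of integer points of $[r_1,\infty)\times[r_2,\infty)$, let $\mathrm{card}(\Omega)$ be the number of its points and let $G(\Omega,\overline f^\delta)=\{\langle f_\delta,\varphi_{k,j}\rangle\}_{(k,j)\in\Omega}\in\mathbb R^{\mathrm{card}(\Omega)}$. For $X=C(Q)$ or $X=L_2(Q)$, $\Psi(\Omega)$ is the set of all mappings $\psi^{(r_1,r_2)}=\psi^{(r_1,r_2)}(\Omega):\mathbb R^{\mathrm{card}(\Omega)}\to X$ (no linearity, continuity or stability required). The error is $$\varepsilon_\delta(L^\mu_{s,2},\psi^{(r_1,r_2)}(\Omega),X,\ell_p)=\sup_{\|f\|_{s,\mu}\le1}\ \sup_{\overline{f^\delta}:\,\|\overline\xi\|_{\ell_p}\le\delta}\|f^{(r_1,r_2)}-\psi^{(r_1,r_2)}(G(\Omega,\overline f^\delta))\|_X,$$ and $$R^{(r_1,r_2)}_{N,\delta}(L^\mu_{s,2},X,\ell_p)=\inf_{\Omega:\,\mathrm{card}(\Omega)\le N}\ \inf_{\psi^{(r_1,r_2)}\in\Psi(\Omega)}\varepsilon_\delta(L^\mu_{s,2},\psi^{(r_1,r_2)}(\Omega),X,\ell_p).$$ Truncation method: for $\gamma\ge1$ and $n>0$ let $\Gamma_{n,\gamma}=\{(k,j)\in\mathbb N^2:\ k\ge r_1,\ j\ge r_2,\ k\,j^\gamma\le n\}$ and $$\mathcal D^{(r_1,r_2)}_{n,\gamma}f_\delta(t,\tau)=\sum_{(k,j)\in\Gamma_{n,\gamma}}\langle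 f_\delta,\varphi_{k,j}\rangle\varphi_k^{(r_1)}(t)\varphi_j^{(r_2)}(\tau).$$ A bound is "implemented" by $\mathcal D^{(r_1,r_2)}_{n,\gamma}$ if this algorithm, with $\Omega=\Gamma_{n,\gamma}$ and $\mathrm{card}(\Gamma_{n,\gamma})\preceq N$, has error $\varepsilon_\delta$ satisfying that upper bound. $a\preceq b$ means $a\le cb$ with $c>0$ depending only on $\mu,s,p,r_1,r_2,\gamma$ and on the constants implied in the choices of $N$ and $n$ (not on $\delta$, $N$, $n$); $a\asymp b$ means $a\preceq b$ and $b\preceq a$. *)

theory Defs
  imports "HOL-Analysis.Analysis"
begin

text \<open>Orthonormal Legendre polynomials (Rodrigues formula).\<close>

definition legendre :: "nat \<Rightarrow> real \<Rightarrow> real" where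
  "legendre k t =
     sqrt (real k + 1 / 2) / (2 ^ k * fact k) * (deriv ^^ k) (\<lambda>u. (u\<^sup>2 - 1) ^ k) t"

definition square :: "(real \<times> real) set" where
  "square = {-1..1} \<times> {-1..1}"

text \<open>
  Elements of \<open>L\<^sub>2(Q)\<close> are represented by Borel functions on the plane, of which only the
  restriction to the square matters. Every Lebesgue class contains such a representative, and
  everything below depends on the class only.
\<close>

definition L2_square :: "(real \<times> real \<Rightarrow> real) set" where
  "L2_square = {f. set_borel_measurable lborel square f \<and>
                   set_integrable lborel square (\<lambda>x. (f x)\<^sup>2)}"

definition coef :: "(real \<times> real \<Rightarrow> real) \<Rightarrow> nat \<times> nat \<Rightarrow> real" where
  "coef f = (\<lambda>(k, j). LBINT t:{-1..1}. LBINT \<tau>:{-1..1}. f (t, \<tau>) * legendre k t * legendre j \<tau>)"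

text \<open>
  The classes \<open>L\<^sup>\<mu>\<^sub>s\<^sub>,\<^sub>2\<close>. Sums over double sequences are unordered sums; for nonnegative
  terms this is the usual double series.
\<close>

definition weighted_term :: "real \<Rightarrow> real \<Rightarrow> (real \<times> real \<Rightarrow> real) \<Rightarrow> nat \<times> nat \<Rightarrow> real" where
  "weighted_term s \<mu> f = (\<lambda>(k, j).
     (real (max 1 k) * real (max 1 j)) powr (s * \<mu>) * \<bar>coef f (k, j)\<bar> powr s)"

definition L_class :: "real \<Rightarrow> real \<Rightarrow> (real \<times> real \<Rightarrow> real) set" where
  "L_class s \<mu> = {f \<in> L2_square. weighted_term s \<mu> f summable_on UNIV}"

definition L_norm :: "real \<Rightarrow> real \<Rightarrow> (real \<times> real \<Rightarrow> real) \<Rightarrow> real" where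
  "L_norm s \<mu> f = (\<Sum>\<^sub>\<infinity>i\<in>UNIV. weighted_term s \<mu> f i) powr (1 / s)"

text \<open>
  The value at a point of the series defining the mixed derivative. When \<open>f \<in> L_class s \<mu>\<close>,
  \<open>r\<^sub>1 \<ge> r\<^sub>2\<close> and \<open>\<mu> > 2 r\<^sub>1 + 3/2 - 1/s\<close>, it converges absolutely and uniformly on the square,
  by Hoelder's inequality and the bound of order \<open>k powr (2 r + 1/2)\<close> for the \<open>r\<close>-th derivative
  of \<open>legendre k\<close> on \<open>[-1, 1]\<close>; so neither the order of summation nor the default value of
  a divergent sum plays a role.
\<close>

definition mixed_deriv ::
    "nat \<Rightarrow> nat \<Rightarrow> (real \<times> real \<Rightarrow> real) \<Rightarrow> real \<times> real \<Rightarrow> real" where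
  "mixed_deriv r1 r2 f = (\<lambda>(t, \<tau>). \<Sum>\<^sub>\<infinity>(k, j)\<in>{r1..} \<times> {r2..}.
     coef f (k, j) * (deriv ^^ r1) (legendre k) t * (deriv ^^ r2) (legendre j) \<tau>)"

text \<open>
  Exponents \<open>p \<in> [1, \<infinity>]\<close> are extended nonnegative reals; \<open>recip_exp \<infinity> = 0\<close>.
\<close>

abbreviation recip_exp :: "ennreal \<Rightarrow> real" where
  "recip_exp p \<equiv> enn2real (1 / p)"

definition lp_norm :: "ennreal \<Rightarrow> (nat \<times> nat \<Rightarrow> real) \<Rightarrow> ennreal" where
  "lp_norm p \<xi> =
     (if p = \<infinity> then (SUP i. ennreal \<bar>\<xi> i\<bar>)
      else if (\<lambda>i. \<bar>\<xi> i\<bar> powr enn2real p) summable_on UNIV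
        then ennreal ((\<Sum>\<^sub>\<infinity>i\<in>UNIV. \<bar>\<xi> i\<bar> powr enn2real p) powr (1 / enn2real p))
        else \<infinity>)"

definition perturbed_data ::
    "ennreal \<Rightarrow> real \<Rightarrow> (real \<times> real \<Rightarrow> real) \<Rightarrow> (nat \<times> nat \<Rightarrow> real) set" where
  "perturbed_data p \<delta> f = {a. lp_norm p (\<lambda>i. coef f i - a i) \<le> ennreal \<delta>}"

definition C_square :: "(real \<times> real \<Rightarrow> real) set" where
  "C_square = {g. continuous_on square g}"

definition C_norm :: "(real \<times> real \<Rightarrow> real) \<Rightarrow> ennreal" where
  "C_norm g = (SUP x\<in>square. ennreal \<bar>g x\<bar>)"

text \<open>
  The space of vectors indexed by the finite set \<open>\<Omega>\<close> is the extensional function space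
  \<open>\<Omega> \<rightarrow>\<^sub>E UNIV\<close>; the information operator is \<open>restrict\<close>.
\<close>

type_synonym recovery = "(nat \<times> nat \<Rightarrow> real) \<Rightarrow> real \<times> real \<Rightarrow> real"

definition recoveries :: "(nat \<times> nat) set \<Rightarrow> recovery set" where
  "recoveries \<Omega> = (\<Omega> \<rightarrow>\<^sub>E UNIV) \<rightarrow> C_square"

definition recovery_error ::
    "nat \<Rightarrow> nat \<Rightarrow> real \<Rightarrow> real \<Rightarrow> ennreal \<Rightarrow> real \<Rightarrow> (nat \<times> nat) set \<Rightarrow> recovery \<Rightarrow> ennreal" where
  "recovery_error r1 r2 s \<mu> p \<delta> \<Omega> \<psi> =
     (SUP f\<in>{f \<in> L_class s \<mu>. L_norm s \<mu> f \<le> 1}. SUP a\<in>perturbed_data p \<delta> f.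
        C_norm (\<lambda>x. mixed_deriv r1 r2 f x - \<psi> (restrict a \<Omega>) x))"

definition min_radius ::
    "nat \<Rightarrow> nat \<Rightarrow> real \<Rightarrow> real \<Rightarrow> ennreal \<Rightarrow> nat \<Rightarrow> real \<Rightarrow> ennreal" where
  "min_radius r1 r2 s \<mu> p N \<delta> =
     (INF \<Omega>\<in>{\<Omega>. \<Omega> \<subseteq> {r1..} \<times> {r2..} \<and> finite \<Omega> \<and> card \<Omega> \<le> N}.
        INF \<psi>\<in>recoveries \<Omega>. recovery_error r1 r2 s \<mu> p \<delta> \<Omega> \<psi>)"

definition Gam :: "nat \<Rightarrow> nat \<Rightarrow> real \<Rightarrow> real \<Rightarrow> (nat \<times> nat) set" where
  "Gam r1 r2 n \<gamma> = {(k, j). r1 \<le> k \<and> r2 \<le> j \<and> real k * real j powr \<gamma> \<le> n}"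

definition truncation :: "nat \<Rightarrow> nat \<Rightarrow> real \<Rightarrow> real \<Rightarrow> recovery" where
  "truncation r1 r2 n \<gamma> a = (\<lambda>(t, \<tau>). \<Sum>(k, j)\<in>Gam r1 r2 n \<gamma>.
     a (k, j) * (deriv ^^ r1) (legendre k) t * (deriv ^^ r2) (legendre j) \<tau>)"

text \<open>Two-sided comparison with explicit constants, for reals and for extended reals.\<close>

definition comparable :: "real \<Rightarrow> real \<Rightarrow> real \<Rightarrow> real \<Rightarrow> bool" where
  "comparable c C x y \<longleftrightarrow> c * y \<le> x \<and> x \<le> C * y"

definition ecomparable :: "real \<Rightarrow> real \<Rightarrow> ennreal \<Rightarrow> real \<Rightarrow> bool" where
  "ecomparable c C x y \<longleftrightarrow> ennreal (c * y) \<le> x \<and> x \<le> ennreal (C * y)"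

text \<open>
  The truncation method on \<open>Gam r1 r2 n \<gamma>\<close> implements the upper bounds \<open>B N \<delta>\<close>,
  \<open>B \<in> Bs\<close>, in the regime \<open>N \<asymp> g \<delta>\<close>, \<open>n \<asymp> h \<delta>\<close>: for all constants in the two
  order relations there is a constant \<open>C\<close> with the stated inequalities for all small \<open>\<delta>\<close> and
  all such \<open>N\<close> and \<open>n\<close>.
\<close>

definition truncation_implements ::
    "nat \<Rightarrow> nat \<Rightarrow> real \<Rightarrow> real \<Rightarrow> ennreal \<Rightarrow> real \<Rightarrow> (real \<Rightarrow> real) \<Rightarrow> (real \<Rightarrow> real) \<Rightarrow>
     (nat \<Rightarrow> real \<Rightarrow> real) set \<Rightarrow> bool" where
  "truncation_implements r1 r2 s \<mu> p \<gamma> g h Bs \<longleftrightarrow>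
     (\<forall>c1>0. \<forall>c2>0. \<forall>d1>0. \<forall>d2>0. \<exists>C>0. \<forall>\<^sub>F \<delta> in at_right 0.
        \<forall>(N::nat) (n::real). comparable c1 c2 (real N) (g \<delta>) \<longrightarrow> comparable d1 d2 n (h \<delta>) \<longrightarrow>
          finite (Gam r1 r2 n \<gamma>) \<and> real (card (Gam r1 r2 n \<gamma>)) \<le> C * real N \<and>
          (\<forall>B\<in>Bs. recovery_error r1 r2 s \<mu> p \<delta> (Gam r1 r2 n \<gamma>) (truncation r1 r2 n \<gamma>)
                     \<le> ennreal (C * B N \<delta>)))"

end

(*
  Upper bound. By Legendre's differential equation the r-th derivative of the k-th Legendre
  polynomial attains its maximum on [-1,1] at the endpoints, where it is of order k^(2r+1/2).
  Hoelder's inequality, with weights adapted to the hyperbolic cross k j^gamma <= n, bounds the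
  discarded part of the series by n^(-a), a = mu - 2 r1 + 1/s - 3/2, and the propagated noise by
  delta n^(2 r1 + 1/2) card(Gamma)^(1-1/p). The stated n balances the two terms; the logarithms
  for gamma = 1 come from the divergence of the harmonic series.

  Lower bound. Whatever N coefficients are observed, some sum of about N products
  phi_k(t) phi_m(tau) with k of order N and m fixed is invisible to them, and so is its negative;
  no recovery can be close to both mixed derivatives at the corner (1,1). Noise plays no role here.
*)
theory Submission
  imports Defs "HOL-Computational_Algebra.Polynomial"
begin

section \<open>Derivatives of Legendre polynomials\<close>

text \<open>The mixed derivative is an unordered infinite sum, so tails are estimated over arbitrary
  finite sets of discarded indices: one uniform bound gives both summability and size. Put a2 = mu -
  2 r2 + 1/s - 3/2. The tail fits the cross as long as gamma a <= a2. If gamma > 1 and gamma a < a2,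
  both the tail sum over j and the count of the cross converge without a logarithm; for r1 = r2 one
  has a2 = a, which leaves gamma = 1. A parameter l, equal to 1 or of order ln n, carries both cases
  through one error bound, n^(-a) l^(1 - 1/s) + delta n^(2 r1 + 3/2 - 1/p) l^(1 - 1/p). Equating the
  two terms produces the exponent D = mu - 1/p + 1/s and, with L = ln(1/delta), the factor L^(1/p -
  1/s) in the choice of n for equal orders. The cross then has at most of order n L points, and n L
  is exactly the stated scale of N: this is the origin of ln^mu. The minimal radius allows N
  observations with no constant in front, so for its upper bound the cross is taken at a small
  multiple of the critical n.\<close>

definition legendre_poly :: "nat \<Rightarrow> real poly" where
  "legendre_poly k =
     smult (sqrt (real k + 1 / 2) / (2 ^ k * fact k)) ((pderiv ^^ k) ([:-1, 0, 1:] ^ k))"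

lemma deriv_funpow_poly: "(deriv ^^ m) (poly p) = poly ((pderiv ^^ m) (p :: real poly))"
proof (induction m)
  case (Suc m)
  have "deriv (poly q) = poly (pderiv q)" for q :: "real poly"
    by (rule ext) (rule DERIV_imp_deriv, rule poly_DERIV)
  with Suc show ?case by simp
qed simp

text \<open>Replaces the analytic \<open>deriv\<close> by the algebraic \<open>pderiv\<close>, which
  iterates without differentiability conditions and gives access to coefficients and
  degrees.\<close>

lemma legendre_eq_poly: "legendre k = poly (legendre_poly k)"
proof -
  have "(\<lambda>u::real. (u\<^sup>2 - 1) ^ k) = poly ([:-1, 0, 1:] ^ k)"
    by (auto simp: poly_power power2_eq_square algebra_simps)
  then show ?thesis
    by (simp only: legendre_def legendre_poly_def deriv_funpow_poly fun_eq_iff poly_smult simp_thms)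
qed

lemma deriv_legendre_eq_poly:
  "(deriv ^^ r) (legendre k) = poly ((pderiv ^^ r) (legendre_poly k))"
  by (simp add: legendre_eq_poly deriv_funpow_poly)

section \<open>Legendre's differential equation and its derivatives\<close>

lemma rodrigues_ode:
  fixes k m :: nat
  defines "d \<equiv> \<lambda>m. (pderiv ^^ m) ([:-1, 0, 1:] ^ k) :: real poly"
  shows "[:-1, 0, 1:] * d (m + 2) + [:0, 2 * (real m + 1 - real k):] * d (m + 1)
           + smult ((real m + 1) * (real m - 2 * real k)) (d m) = 0"
proof (induction m)
  have d_Suc: "d (Suc m) = pderiv (d m)" for m by (simp add: d_def)
  \<comment> \<open>For Q = (x^2 - 1)^k this is (x^2 - 1) Q' = 2 k x Q. Differentiating it m + 1
    times gives the claim: once for the base case, and once more in each induction step.\<close>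
  have first: "[:-1, 0, 1:] * d 1 = [:0, 2 * real k:] * d 0"
  proof (cases k)
    case (Suc j)
    show ?thesis
      unfolding d_def Suc One_nat_def funpow.simps comp_apply id_apply pderiv_power_Suc
      by (intro poly_ext) (simp add: pderiv_pCons algebra_simps)
  qed (simp add: d_def)
  case 0
  show ?case
  proof (rule poly_ext)
    fix x
    have "poly (pderiv ([:-1, 0, 1:] * d 1)) x = poly (pderiv ([:0, 2 * real k:] * d 0)) x"
      using first by simp
    then show "poly ([:-1, 0, 1:] * d (0 + 2) + [:0, 2 * (real 0 + 1 - real k):] * d (0 + 1)
           + smult ((real 0 + 1) * (real 0 - 2 * real k)) (d 0)) x = poly 0 x"
      unfolding pderiv_mult
      by (simp add: pderiv_pCons numeral_2_eq_2 algebra_simps flip: d_Suc)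
  qed
next
  have d_Suc: "d (Suc m) = pderiv (d m)" for m by (simp add: d_def)
  case (Suc m)
  show ?case
  proof (rule poly_ext)
    fix x
    have "poly (pderiv ([:-1, 0, 1:] * d (m + 2) + [:0, 2 * (real m + 1 - real k):] * d (m + 1)
           + smult ((real m + 1) * (real m - 2 * real k)) (d m))) x = 0"
      using Suc by simp
    then show "poly ([:-1, 0, 1:] * d (Suc m + 2) + [:0, 2 * (real (Suc m) + 1 - real k):] * d (Suc m + 1)
           + smult ((real (Suc m) + 1) * (real (Suc m) - 2 * real k)) (d (Suc m))) x = poly 0 x"
      unfolding pderiv_add pderiv_mult pderiv_smult
      by (simp add: pderiv_pCons algebra_simps flip: d_Suc)
  qed
qed

text \<open>The case \<open>m = k + r\<close> of \<open>rodrigues_ode\<close>: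
  \<open>legendre_poly k\<close> is already a multiple of a \<open>k\<close>-th derivative, and
  \<open>r\<close> more are taken.\<close>

lemma legendre_deriv_ode:
  fixes k r :: nat
  defines "w \<equiv> \<lambda>r. poly ((pderiv ^^ r) (legendre_poly k))"
  shows "(1 - x\<^sup>2) * w (r + 2) x =
           2 * (real r + 1) * x * w (r + 1) x
           - ((real k + real r + 1) * (real k - real r)) * w r x"
proof -
  define c where "c = sqrt (real k + 1 / 2) / (2 ^ k * fact k)"
  define d where "d m = ((pderiv ^^ m) ([:-1, 0, 1:] ^ k) :: real poly)" for m
  have w: "w m x = c * poly (d (k + m)) x" for m x
    by (simp add: w_def legendre_poly_def higher_pderiv_smult c_def d_def add.commute[of k m] funpow_add)
  have "poly ([:-1, 0, 1:] * d ((k + r) + 2) + [:0, 2 * (real (k + r) + 1 - real k):] * d ((k + r) + 1)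
           + smult ((real (k + r) + 1) * (real (k + r) - 2 * real k)) (d (k + r))) x = 0"
    using rodrigues_ode[of "k + r" k] unfolding d_def by simp
  from arg_cong[OF this, of "\<lambda>z. c * z"] show ?thesis
    by (simp add: w power2_eq_square algebra_simps)
qed

section \<open>Behaviour at the endpoints\<close>

lemma higher_pderiv_root_power:
  fixes g :: "real poly"
  shows "poly ((pderiv ^^ k) ([:-a, 1:] ^ k * g)) a = fact k * poly g a"
proof (induction k arbitrary: g)
  case (Suc k)
  \<comment> \<open>One differentiation lowers the exponent of the root factor by one, and the new
    cofactor takes \<open>Suc k\<close> times the old value at \<open>a\<close>; hence the
    factorial, and hence the generalisation over \<open>g\<close>.\<close>
  have "pderiv ([:-a, 1:] ^ Suc k * g) =
     [:-a, 1:] ^ k * (smult (real (Suc k)) g + [:-a, 1:] * pderiv g)"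
    unfolding pderiv_mult pderiv_power_Suc
    by (intro poly_ext) (simp add: pderiv_pCons algebra_simps)
  then show ?case
    using Suc[of "smult (real (Suc k)) g + [:-a, 1:] * pderiv g"]
    by (simp only: funpow_Suc_right comp_apply) (simp add: algebra_simps)
qed simp

text \<open>Each derivative uses up only one of the \<open>k\<close> root factors, by the same
  computation as above.\<close>

lemma higher_pderiv_root_power_eq_0:
  fixes g :: "real poly"
  shows "m < k \<Longrightarrow> poly ((pderiv ^^ m) ([:-a, 1:] ^ k * g)) a = 0"
proof (induction k arbitrary: g m)
  case (Suc k)
  have "pderiv ([:-a, 1:] ^ Suc k * g) =
     [:-a, 1:] ^ k * (smult (real (Suc k)) g + [:-a, 1:] * pderiv g)"
    unfolding pderiv_mult pderiv_power_Suc
    by (intro poly_ext) (simp add: pderiv_pCons algebra_simps)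
  then show ?case
    using Suc.IH[of "m - 1" "smult (real (Suc k)) g + [:-a, 1:] * pderiv g"] Suc.prems
    by (cases m) (simp_all add: funpow_Suc_right del: funpow.simps)
qed simp

text \<open>Either root is put in front in the shape \<open>[:-a, 1:]\<close> of the root lemmas;
  hence the spelling \<open>-(- 1)\<close>.\<close>

lemma quad_factor:
  "([:-1, 0, 1:] :: real poly) ^ k = [:- 1, 1:] ^ k * [:1, 1:] ^ k"
  "([:-1, 0, 1:] :: real poly) ^ k = [:-(- 1), 1:] ^ k * [:-1, 1:] ^ k"
proof -
  have "([:-1, 0, 1:] :: real poly) = [:-1, 1:] * [:1, 1:]" by simp
  then show "([:-1, 0, 1:] :: real poly) ^ k = [:- 1, 1:] ^ k * [:1, 1:] ^ k"
    by (metis power_mult_distrib)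
  then show "([:-1, 0, 1:] :: real poly) ^ k = [:-(- 1), 1:] ^ k * [:-1, 1:] ^ k"
    by (simp add: mult.commute)
qed

text \<open>Makes the boundary terms vanish when orthogonality is proved by parts.\<close>

lemma rodrigues_endpoint:
  "m < k \<Longrightarrow> poly ((pderiv ^^ m) ([:-1, 0, 1:] ^ k)) (1::real) = 0"
  "m < k \<Longrightarrow> poly ((pderiv ^^ m) ([:-1, 0, 1:] ^ k)) (-1::real) = 0"
  using higher_pderiv_root_power_eq_0[of m k 1 "[:1, 1:] ^ k"]
    higher_pderiv_root_power_eq_0[of m k "-1" "[:-1, 1:] ^ k"]
  by (simp_all only: quad_factor(1)[symmetric] quad_factor(2)[symmetric])

text \<open>The cofactor (x + 1)^k equals 2^k at 1, so k! 2^k cancels the Rodrigues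
  normalisation.\<close>

lemma legendre_at_1: "legendre k 1 = sqrt (real k + 1 / 2)"
  using higher_pderiv_root_power[of k 1 "[:1, 1:] ^ k"]
  by (simp add: legendre_eq_poly legendre_poly_def quad_factor(1) poly_power)

lemma legendre_at_minus_1: "legendre k (-1) = (-1) ^ k * sqrt (real k + 1 / 2)"
proof -
  have "poly ((pderiv ^^ k) ([:-1, 0, 1:] ^ k)) (-1) = fact k * (-2 :: real) ^ k"
    using higher_pderiv_root_power[of k "-1" "[:-1, 1:] ^ k"]
    unfolding quad_factor(2)[symmetric] by (simp add: poly_power)
  moreover have "(-2 :: real) ^ k = (-1) ^ k * 2 ^ k"
    by (simp flip: power_mult_distrib)
  ultimately show ?thesis
    by (simp add: legendre_eq_poly legendre_poly_def)
qed

text \<open>At both endpoints the leading coefficient 1 - x^2 of the differential equation vanishes,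
  which leaves a first-order recursion in \<open>r\<close>.\<close>

lemma legendre_deriv_endpoint_Suc:
  fixes k r :: nat
  defines "w \<equiv> \<lambda>r. poly ((pderiv ^^ r) (legendre_poly k))"
  shows "w (Suc r) 1 = (real k + real r + 1) * (real k - real r) / (2 * (real r + 1)) * w r 1"
    and "w (Suc r) (-1) = - ((real k + real r + 1) * (real k - real r) / (2 * (real r + 1)) * w r (-1))"
  using legendre_deriv_ode[of 1 r k] legendre_deriv_ode[of "-1" r k]
  by (simp_all add: w_def field_simps)

text \<open>A trace of parity: the two endpoint recursions have the same factor up to sign, and so
  do their starting values.\<close>

lemma legendre_deriv_endpoint_abs:
  "\<bar>(deriv ^^ r) (legendre k) (-1)\<bar> = \<bar>(deriv ^^ r) (legendre k) 1\<bar>"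
  unfolding deriv_legendre_eq_poly
proof (induction r)
  case 0
  show ?case
    by (simp add: legendre_at_1 legendre_at_minus_1 abs_mult power_abs flip: legendre_eq_poly)
next
  case (Suc r)
  then show ?case
    by (simp only: legendre_deriv_endpoint_Suc abs_mult abs_minus_cancel)
qed

text \<open>On either half of the interval \<open>w\<^sup>2 + (1 - x\<^sup>2) w'\<^sup>2 / \<Lambda>\<close> is monotone towards the endpoint,
  by the differential equation.\<close>
lemma legendre_deriv_le_endpoint:
  assumes "x \<in> {-1..1}"
  shows "\<bar>(deriv ^^ r) (legendre k) x\<bar> \<le> \<bar>(deriv ^^ r) (legendre k) 1\<bar>"
proof (cases "r < k")
  \<comment> \<open>Here the derivative is a constant. The monotonicity argument is kept for
    \<open>r < k\<close>, where \<open>\<Lambda>\<close> is positive.\<close>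
  case False
  have "Polynomial.degree (legendre_poly k) \<le> k"
    by (simp add: legendre_poly_def degree_higher_pderiv degree_power_eq)
  then have "Polynomial.degree ((pderiv ^^ r) (legendre_poly k)) = 0"
    using False by (simp add: degree_higher_pderiv)
  then obtain c where "(pderiv ^^ r) (legendre_poly k) = [:c:]"
    using degree_eq_zeroE by blast
  then show ?thesis by (simp add: deriv_legendre_eq_poly)
next
  case True
  define w where "w j = poly ((pderiv ^^ (r + j)) (legendre_poly k))" for j
  define \<Lambda> where "\<Lambda> = (real k + real r + 1) * (real k - real r)"
  have \<Lambda>: "\<Lambda> > 0" using True by (simp add: \<Lambda>_def)
  define V where "V x = (w 0 x)\<^sup>2 + (1 - x\<^sup>2) * (w 1 x)\<^sup>2 / \<Lambda>" for x
  have dw: "(w j has_real_derivative w (Suc j) x) (at x)" for j x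
    by (simp add: w_def poly_DERIV)
  have ode: "(1 - x\<^sup>2) * w 2 x = 2 * (real r + 1) * x * w 1 x - \<Lambda> * w 0 x" for x
    using legendre_deriv_ode[of x r k] by (simp add: w_def \<Lambda>_def)
  \<comment> \<open>The terms in \<open>w 0 x * w 1 x\<close> cancel by the differential equation,
    and what remains has the sign of \<open>x\<close>.\<close>
  have dV: "(V has_real_derivative (4 * real r + 2) * x * (w 1 x)\<^sup>2 / \<Lambda>) (at x)" for x
  proof -
    have "(V has_real_derivative
        2 * w 0 x * w 1 x + (- (2 * x) * (w 1 x)\<^sup>2 + (1 - x\<^sup>2) * (2 * w 1 x * w 2 x)) / \<Lambda>) (at x)"
      unfolding V_def using \<Lambda> dw[of 0 x] dw[of 1 x]
      by (auto intro!: derivative_eq_intros simp: numeral_2_eq_2)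
    also have "(1 - x\<^sup>2) * (2 * w 1 x * w 2 x) = 2 * w 1 x * (2 * (real r + 1) * x * w 1 x - \<Lambda> * w 0 x)"
      unfolding ode[symmetric] by (simp add: algebra_simps)
    also have "2 * w 0 x * w 1 x + (- (2 * x) * (w 1 x)\<^sup>2
        + 2 * w 1 x * (2 * (real r + 1) * x * w 1 x - \<Lambda> * w 0 x)) / \<Lambda> =
        (4 * real r + 2) * x * (w 1 x)\<^sup>2 / \<Lambda>"
      using \<Lambda> by (simp add: field_simps power2_eq_square)
    finally show ?thesis .
  qed
  have "(w 0 x)\<^sup>2 \<le> V x"
    using \<Lambda> assms by (simp add: V_def abs_square_le_1 abs_le_iff)
  \<comment> \<open>At both endpoints the second summand of \<open>V\<close> vanishes, so
    \<open>V\<close> is there the square to be compared with.\<close>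
  also have "V x \<le> (w 0 1)\<^sup>2"
  proof (cases "0 \<le> x")
    case True
    have "V x \<le> V 1"
    proof (rule DERIV_nonneg_imp_nondecreasing[where f = V])
      fix y assume "x \<le> y" "y \<le> 1"
      then have "(4 * real r + 2) * y * (w 1 y)\<^sup>2 / \<Lambda> \<ge> 0"
        using \<Lambda> True by (intro divide_nonneg_pos mult_nonneg_nonneg) auto
      then show "\<exists>z. DERIV V y :> z \<and> 0 \<le> z" using dV by blast
    qed (use assms in auto)
    then show ?thesis by (simp add: V_def)
  next
    case False
    have "V x \<le> V (-1)"
    proof (rule DERIV_nonpos_imp_nonincreasing[where f = V])
      fix y assume "-1 \<le> y" "y \<le> x"
      then have "(4 * real r + 2) * y * (w 1 y)\<^sup>2 / \<Lambda> \<le> 0"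
        using \<Lambda> False
        by (intro divide_nonpos_pos mult_nonpos_nonneg mult_nonneg_nonpos) auto
      then show "\<exists>z. DERIV V y :> z \<and> z \<le> 0" using dV by blast
    qed (use assms in auto)
    also have "\<dots> = (w 0 1)\<^sup>2"
    proof -
      have "\<bar>w 0 (-1)\<bar> = \<bar>w 0 1\<bar>"
        using legendre_deriv_endpoint_abs[of r k] by (simp add: w_def deriv_legendre_eq_poly)
      then have "(w 0 (-1))\<^sup>2 = (w 0 1)\<^sup>2" by (metis power2_abs)
      then show ?thesis by (simp add: V_def)
    qed
    finally show ?thesis .
  qed
  finally show ?thesis
    unfolding w_def by (simp only: deriv_legendre_eq_poly abs_le_square_iff add_0_right)
qed

section \<open>Growth of the derivatives in the degree\<close>

lemma powr_Suc_step:
  "x powr (2 * real (Suc r) + 1 / 2) = x powr 2 * x powr (2 * real r + 1 / 2)"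
proof -
  have "2 * real (Suc r) + 1 / 2 = 2 + (2 * real r + 1 / 2)" by simp
  then show ?thesis by (simp only: powr_add)
qed

text \<open>Only the value at 1 needs an estimate. Each step of the endpoint recursion multiplies it
  by at most (r + 2)^2 k^2 and so raises the exponent of k by 2.\<close>

lemma legendre_deriv_upper:
  "\<exists>K>0. \<forall>k\<ge>1. \<forall>x\<in>{-1..1}. \<bar>(deriv ^^ r) (legendre k) x\<bar> \<le> K * real k powr (2 * real r + 1 / 2)"
proof -
  have "\<exists>K>0. \<forall>k\<ge>1. \<bar>(deriv ^^ r) (legendre k) 1\<bar> \<le> K * real k powr (2 * real r + 1 / 2)"
  proof (induction r)
    case 0
    have "sqrt (real k + 1 / 2) \<le> 2 * real k powr (1 / 2)" if "k \<ge> 1" for k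
    proof -
      have "sqrt (real k + 1 / 2) \<le> sqrt (4 * real k)" using that by simp
      then show ?thesis by (simp add: real_sqrt_mult powr_half_sqrt)
    qed
    then show ?case
      by (intro exI[of _ 2]) (auto simp: legendre_at_1)
  next
    case (Suc r)
    then obtain K where K: "K > 0"
      "\<And>k. k \<ge> 1 \<Longrightarrow> \<bar>(deriv ^^ r) (legendre k) 1\<bar> \<le> K * real k powr (2 * real r + 1 / 2)"
      by auto
    have "\<bar>(deriv ^^ Suc r) (legendre k) 1\<bar> \<le> K * (real r + 2) ^ 2 * real k powr (2 * real (Suc r) + 1 / 2)"
      if k: "k \<ge> 1" for k
    proof -
      have "\<bar>(real k + real r + 1) * (real k - real r) / (2 * (real r + 1))\<bar>
          = (real k + real r + 1) * \<bar>real k - real r\<bar> / (2 * (real r + 1))"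
        by (simp add: abs_mult)
      also have "\<dots> \<le> (real k + real r + 1) * (real k + real r + 1) / 1"
        by (intro frac_le mult_mono) auto
      also have "\<dots> \<le> ((real r + 2) * real k) * ((real r + 2) * real k)"
      proof -
        have "real r * real 1 \<le> real r * real k" using k by (intro mult_left_mono) auto
        then have "real k + real r + 1 \<le> (real r + 2) * real k" using k by (simp add: algebra_simps)
        then show ?thesis by (simp add: mult_mono)
      qed
      finally have 1: "\<bar>(real k + real r + 1) * (real k - real r) / (2 * (real r + 1))\<bar>
          \<le> (real r + 2) ^ 2 * real k ^ 2"
        by (simp add: power2_eq_square algebra_simps)
      have "\<bar>(deriv ^^ Suc r) (legendre k) 1\<bar> =
        \<bar>(real k + real r + 1) * (real k - real r) / (2 * (real r + 1))\<bar> * \<bar>(deriv ^^ r) (legendre k) 1\<bar>"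
        unfolding deriv_legendre_eq_poly legendre_deriv_endpoint_Suc abs_mult ..
      also have "\<dots> \<le> ((real r + 2) ^ 2 * real k ^ 2) * (K * real k powr (2 * real r + 1 / 2))"
        by (intro mult_mono 1 K k) auto
      also have "\<dots> = K * (real r + 2) ^ 2 * (real k powr 2 * real k powr (2 * real r + 1 / 2))"
        using k by (simp add: algebra_simps)
      also have "real k powr 2 * real k powr (2 * real r + 1 / 2) = real k powr (2 * real (Suc r) + 1 / 2)"
        by (simp only: powr_Suc_step)
      finally show ?thesis .
    qed
    then show ?case
      using K by (intro exI[of _ "K * (real r + 2) ^ 2"]) auto
  qed
  then obtain K where K: "K > 0"
    "\<And>k. k \<ge> 1 \<Longrightarrow> \<bar>(deriv ^^ r) (legendre k) 1\<bar> \<le> K * real k powr (2 * real r + 1 / 2)"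
    by auto
  have "\<bar>(deriv ^^ r) (legendre k) x\<bar> \<le> K * real k powr (2 * real r + 1 / 2)"
    if "k \<ge> 1" "x \<in> {-1..1}" for k x
    using legendre_deriv_le_endpoint[OF that(2), of r k] K(2)[OF that(1)] by (rule order_trans)
  with K(1) show ?thesis by blast
qed

text \<open>The condition on \<open>k\<close> keeps k - r at least k / 2 in the recursion, so that
  every factor is positive and of order k^2.\<close>

lemma legendre_deriv_lower:
  "\<exists>c>0. \<forall>k. k \<ge> 2 * r \<longrightarrow> (deriv ^^ r) (legendre k) 1 \<ge> c * real k powr (2 * real r + 1 / 2)"
proof (induction r)
  case 0
  have "sqrt (real k + 1 / 2) \<ge> 1 * real k powr (1 / 2)" for k
    by (simp add: powr_half_sqrt)
  then show ?case
    by (intro exI[of _ 1]) (auto simp: legendre_at_1)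
next
  case (Suc r)
  then obtain c where c: "c > 0"
    "\<And>k. k \<ge> 2 * r \<Longrightarrow> (deriv ^^ r) (legendre k) 1 \<ge> c * real k powr (2 * real r + 1 / 2)"
    by auto
  \<comment> \<open>The factor of the recursion is at least k^2 / (4 (r + 1)).\<close>
  define e where "e = c / (4 * (real r + 1))"
  have "e > 0" using c by (simp add: e_def)
  moreover have "(deriv ^^ Suc r) (legendre k) 1 \<ge> e * real k powr (2 * real (Suc r) + 1 / 2)"
    if k: "k \<ge> 2 * Suc r" for k
  proof -
    have 1: "real k ^ 2 / (4 * (real r + 1)) \<le> (real k + real r + 1) * (real k - real r) / (2 * (real r + 1))"
    proof -
      have "real k * (real k / 2) \<le> (real k + real r + 1) * (real k - real r)"
        using k by (intro mult_mono) auto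
      then have "real k * (real k / 2) / (2 * (real r + 1)) \<le> (real k + real r + 1) * (real k - real r) / (2 * (real r + 1))"
        by (intro divide_right_mono) auto
      then show ?thesis by (simp add: power2_eq_square)
    qed
    have "e * real k powr (2 * real (Suc r) + 1 / 2) = e * (real k powr 2 * real k powr (2 * real r + 1 / 2))"
      by (simp only: powr_Suc_step)
    also have "\<dots> = (real k ^ 2 / (4 * (real r + 1))) * (c * real k powr (2 * real r + 1 / 2))"
      using k by (simp add: e_def)
    also have "\<dots> \<le> (real k + real r + 1) * (real k - real r) / (2 * (real r + 1)) * (deriv ^^ r) (legendre k) 1"
      using k c by (intro mult_mono 1 c(2)) auto
    also have "\<dots> = (deriv ^^ Suc r) (legendre k) 1"
      unfolding deriv_legendre_eq_poly legendre_deriv_endpoint_Suc ..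
    finally show ?thesis .
  qed
  ultimately show ?case by blast
qed

section \<open>Orthonormality and fooling functions\<close>

lemma set_integrable_poly: "set_integrable lborel {a..b} (poly (p :: real poly))"
  by (intro borel_integrable_atLeastAtMost' continuous_intros)

lemma LBINT_poly_add:
  "(LBINT t:{a..b}. poly (p + q) t) = (LBINT t:{a..b}. poly p t) + (LBINT t:{a..b}. poly (q :: real poly) t)"
  by (simp add: set_integral_add set_integrable_poly)

lemma LBINT_poly_smult: "(LBINT t:{a..b}. poly (smult c p) t) = c * (LBINT t:{a..b}. poly (p :: real poly) t)"
  by simp

lemma LBINT_poly_pderiv:
  "a \<le> b \<Longrightarrow> (LBINT t:{a..b}. poly (pderiv p) t) = poly p b - poly (p :: real poly) a"
  unfolding set_lebesgue_integral_def
  by (intro integral_FTC_atLeastAtMost continuous_intros)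
     (auto intro: has_field_derivative_at_within poly_DERIV
           simp flip: has_real_derivative_iff_has_vector_derivative)

lemma LBINT_poly_by_parts:
  assumes "a \<le> b"
  shows "(LBINT t:{a..b}. poly (pderiv p * q) t) =
     poly (p * q) b - poly (p * q) a - (LBINT t:{a..b}. poly (p * pderiv (q :: real poly)) t)"
  using LBINT_poly_pderiv[OF assms, of "p * q"] LBINT_poly_add[of a b "pderiv p * q" "p * pderiv q"]
  by (simp add: pderiv_mult mult.commute add.commute)

lemma higher_pderiv_eq_0:
  fixes g :: "real poly"
  assumes "\<And>i. i \<ge> k \<Longrightarrow> coeff g i = 0"
  shows "(pderiv ^^ k) g = 0"
  by (rule poly_eqI) (simp add: coeff_higher_pderiv assms)

text \<open>Integrating by parts \<open>k\<close> times moves all derivatives from (x^2 - 1)^k onto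
  \<open>g\<close>, which they annihilate. Bounding the degree of \<open>g\<close> through its
  coefficients lets \<open>k = 0\<close> mean \<open>g = 0\<close>.\<close>

lemma legendre_orthogonal:
  assumes "\<And>i. i \<ge> k \<Longrightarrow> coeff g i = 0"
  shows "(LBINT t:{-1..1}. poly (legendre_poly k * g) t) = 0"
proof -
  define Q where "Q m = ((pderiv ^^ m) ([:-1, 0, 1:] ^ k) :: real poly)" for m
  have Q: "poly (Q m) 1 = 0" "poly (Q m) (-1) = 0" if "m < k" for m
    using rodrigues_endpoint[OF that] by (simp_all add: Q_def)
  have "(LBINT t:{-1..1}. poly (Q k * g) t) =
      (-1) ^ j * (LBINT t:{-1..1}. poly (Q (k - j) * (pderiv ^^ j) g) t)" if "j \<le> k" for j
    using that
  proof (induction j)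
    case (Suc j)
    \<comment> \<open>The order \<open>k - Suc j\<close> is below \<open>k\<close>, so the boundary
      terms at 1 and -1 vanish.\<close>
    then have "Q (k - j) = pderiv (Q (k - Suc j))"
      by (simp add: Q_def flip: funpow_Suc_right comp_apply[of pderiv] funpow.simps(2) Suc_diff_Suc)
    then show ?case
      using Suc LBINT_poly_by_parts[of "-1" 1 "Q (k - Suc j)" "(pderiv ^^ j) g"] Q[of "k - Suc j"]
      by simp
  qed simp
  from this[of k] have "(LBINT t:{-1..1}. poly (Q k * g) t) = 0"
    by (simp add: higher_pderiv_eq_0[OF assms])
  then show ?thesis
    using LBINT_poly_smult[of "-1" 1 _ "Q k * g"] by (simp add: legendre_poly_def Q_def)
qed

lemma coeff_legendre_poly_eq_0: "i > k \<Longrightarrow> coeff (legendre_poly k) i = 0"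
  by (rule coeff_eq_0) (simp add: legendre_poly_def degree_higher_pderiv degree_power_eq)

text \<open>The norm comes from \<open>(x y\<^sup>2)' = y\<^sup>2 + 2 x y y'\<close>, where \<open>x y' - k y\<close> has degree below \<open>k\<close>.\<close>
lemma legendre_norm: "(LBINT t:{-1..1}. poly (legendre_poly k * legendre_poly k) t) = 1"
proof -
  define y where "y = legendre_poly k"
  define I where "I p = (LBINT t:{-1..1}. poly p t)" for p :: "real poly"
  define g where "g = [:0, 1:] * pderiv y - smult (real k) y"
  have "coeff g i = 0" if "i \<ge> k" for i
    using coeff_legendre_poly_eq_0[of k i] that
    by (cases "i = k"; cases i) (auto simp: g_def y_def coeff_pderiv)
  then have "I (y * g) = 0"
    unfolding I_def y_def by (rule legendre_orthogonal)
  have "pderiv ([:0, 1:] * (y * y)) = smult (2 * real k + 1) (y * y) + smult 2 (y * g)"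
    unfolding pderiv_mult g_def
    by (intro poly_ext) (simp add: pderiv_pCons algebra_simps)
  then have "I (pderiv ([:0, 1:] * (y * y))) = (2 * real k + 1) * I (y * y) + 2 * I (y * g)"
    unfolding I_def by (simp only: LBINT_poly_add LBINT_poly_smult)
  \<comment> \<open>The square y^2 equals k + 1/2 at both endpoints, and the factor x turns the
    difference of boundary values into a sum.\<close>
  moreover have "I (pderiv ([:0, 1:] * (y * y))) = 2 * real k + 1"
  proof -
    have "I (pderiv ([:0, 1:] * (y * y))) = poly y 1 * poly y 1 + poly y (-1) * poly y (-1)"
      unfolding I_def by (subst LBINT_poly_pderiv) auto
    also have "\<dots> = 2 * real k + 1"
      using legendre_at_1[of k] legendre_at_minus_1[of k]
      by (simp add: y_def legendre_eq_poly flip: power2_eq_square)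
         (simp add: power_mult_distrib power_even_eq[symmetric] flip: power_mult)
    finally show ?thesis .
  qed
  ultimately show ?thesis
    using \<open>I (y * g) = 0\<close> by (simp add: I_def y_def)
qed

lemma legendre_orthonormal:
  "(LBINT t:{-1..1}. legendre j t * legendre k t) = (if j = k then 1 else 0)"
proof -
  have "(LBINT t:{-1..1}. poly (legendre_poly j * legendre_poly k) t) = 0" if "j \<noteq> k" for j k
  proof (cases "j < k")
    case True
    then have "(LBINT t:{-1..1}. poly (legendre_poly k * legendre_poly j) t) = 0"
      by (intro legendre_orthogonal coeff_legendre_poly_eq_0) auto
    then show ?thesis by (simp add: mult.commute)
  next
    case False
    then show ?thesis
      using that by (intro legendre_orthogonal coeff_legendre_poly_eq_0) auto
  qed
  then show ?thesis
    using legendre_norm[of k] by (auto simp: legendre_eq_poly)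
qed

text \<open>The fooling function: its nonzero coefficients all equal \<open>c\<close> and lie on the
  line j = m. Replacing \<open>c\<close> by \<open>- c\<close> gives its negative, with the same
  norm.\<close>

definition ridge :: "nat set \<Rightarrow> nat \<Rightarrow> real \<Rightarrow> real \<times> real \<Rightarrow> real" where
  "ridge K m c = (\<lambda>(t, \<tau>). c * (\<Sum>k\<in>K. legendre k t) * legendre m \<tau>)"

lemma set_integrable_legendre_sum:
  "set_integrable lborel {-1..1} (\<lambda>t. (\<Sum>k\<in>K. legendre k t) * legendre i t)"
  unfolding legendre_eq_poly
  by (intro borel_integrable_atLeastAtMost' continuous_intros)

text \<open>The iterated integral factors into one integral per variable, and orthonormality
  evaluates both.\<close>

lemma coef_ridge:
  assumes "finite K"
  shows "coef (ridge K m c) (i, j) = (if i \<in> K \<and> j = m then c else 0)"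
proof -
  have "(LBINT t:{-1..1}. (\<Sum>k\<in>K. legendre k t) * legendre i t) = (if i \<in> K then 1 else 0)"
  proof -
    have "(LBINT t:{-1..1}. (\<Sum>k\<in>K. legendre k t) * legendre i t)
        = (LBINT t:{-1..1}. (\<Sum>k\<in>K. legendre k t * legendre i t))"
      by (simp add: sum_distrib_right)
    also have "\<dots> = (\<Sum>k\<in>K. LBINT t:{-1..1}. legendre k t * legendre i t)"
      unfolding set_lebesgue_integral_def scaleR_sum_right
    proof (rule Bochner_Integration.integral_sum)
      fix k
      show "integrable lborel (\<lambda>t. indicat_real {- 1..1} t *\<^sub>R (legendre k t * legendre i t))"
        using set_integrable_legendre_sum[of "{k}" i] by (simp add: set_integrable_def)
    qed
    also have "\<dots> = (if i \<in> K then 1 else 0)"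
      using assms by (simp add: legendre_orthonormal sum.delta)
    finally show ?thesis .
  qed
  moreover have "coef (ridge K m c) (i, j) =
      c * (LBINT t:{-1..1}. (\<Sum>k\<in>K. legendre k t) * legendre i t)
        * (LBINT \<tau>:{-1..1}. legendre m \<tau> * legendre j \<tau>)"
  proof -
    have "(LBINT \<tau>:{-1..1}. ridge K m c (t, \<tau>) * legendre i t * legendre j \<tau>) =
        ((\<Sum>k\<in>K. legendre k t) * legendre i t) * (c * (LBINT \<tau>:{-1..1}. legendre m \<tau> * legendre j \<tau>))" for t
    proof -
      have "(LBINT \<tau>:{-1..1}. ridge K m c (t, \<tau>) * legendre i t * legendre j \<tau>) =
        (LBINT \<tau>:{-1..1}. ((\<Sum>k\<in>K. legendre k t) * legendre i t * c) * (legendre m \<tau> * legendre j \<tau>))"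
        by (simp add: ridge_def mult_ac)
      then show ?thesis by (simp only: set_integral_mult_right mult.assoc)
    qed
    then have "coef (ridge K m c) (i, j) = (LBINT t:{-1..1}.
        ((\<Sum>k\<in>K. legendre k t) * legendre i t) * (c * (LBINT \<tau>:{-1..1}. legendre m \<tau> * legendre j \<tau>)))"
      by (simp only: coef_def split_conv)
    then show ?thesis unfolding set_integral_mult_left by (simp only: mult_ac)
  qed
  ultimately show ?thesis by (simp add: legendre_orthonormal)
qed

lemma ridge_in_L2_square: "ridge K m c \<in> L2_square"
proof -
  have cont: "continuous_on A (ridge K m c)" for A
    unfolding ridge_def legendre_eq_poly split_def by (intro continuous_intros)
  have [measurable]: "ridge K m c \<in> borel_measurable borel"
    by (intro borel_measurable_continuous_onI cont)
  have [measurable]: "square \<in> sets borel"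
    by (simp add: square_def borel_closed closed_Times)
  have "set_borel_measurable lborel square (ridge K m c)"
    unfolding set_borel_measurable_def by measurable
  moreover have "set_integrable lborel square (\<lambda>x. (ridge K m c x)\<^sup>2)"
    unfolding set_integrable_def
    by (intro borel_integrable_compact continuous_intros cont) (simp add: square_def compact_Times)
  ultimately show ?thesis by (simp add: L2_square_def)
qed

lemma weighted_term_ridge:
  assumes "finite K" "s > 0"
  shows "(\<lambda>i. weighted_term s \<mu> (ridge K m c) i) = (\<lambda>i. if i \<in> K \<times> {m} then
     (real (max 1 (fst i)) * real (max 1 m)) powr (s * \<mu>) * \<bar>c\<bar> powr s else 0)"
  using assms by (auto simp: weighted_term_def coef_ridge fun_eq_iff)

lemma infsum_finite_support:
  assumes "finite A" "\<And>x. x \<in> S - A \<Longrightarrow> f x = 0" "A \<subseteq> S"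
  shows "infsum f S = sum f A" and "f summable_on S"
proof -
  show "infsum f S = sum f A"
  proof -
    have "infsum f S = infsum f A"
      by (rule infsum_cong_neutral) (use assms in auto)
    then show ?thesis using assms(1) by simp
  qed
  show "f summable_on S"
  proof -
    have "f summable_on S \<longleftrightarrow> f summable_on A"
      by (rule summable_on_cong_neutral) (use assms in auto)
    then show ?thesis using assms(1) by simp
  qed
qed

lemma sum_Times_singleton: "sum f (K \<times> {m}) = (\<Sum>k\<in>K. f (k, m))"
proof -
  have "K \<times> {m} = (\<lambda>k. (k, m)) ` K" by auto
  then show ?thesis by (simp add: sum.reindex inj_on_def)
qed

lemma ridge_in_L_class:
  assumes "finite K" "s > 0"
  shows "ridge K m c \<in> L_class s \<mu>"
proof -
  have "weighted_term s \<mu> (ridge K m c) summable_on UNIV"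
    by (rule infsum_finite_support(2)[of "K \<times> {m}"])
       (use assms in \<open>auto simp: weighted_term_ridge\<close>)
  then show ?thesis by (simp add: L_class_def ridge_in_L2_square)
qed

lemma L_norm_ridge:
  assumes "finite K" "s > 0"
  shows "L_norm s \<mu> (ridge K m c) =
     (\<Sum>k\<in>K. (real (max 1 k) * real (max 1 m)) powr (s * \<mu>) * \<bar>c\<bar> powr s) powr (1 / s)"
proof -
  have "infsum (weighted_term s \<mu> (ridge K m c)) UNIV = sum (weighted_term s \<mu> (ridge K m c)) (K \<times> {m})"
    by (rule infsum_finite_support(1)) (use assms in \<open>auto simp: weighted_term_ridge\<close>)
  also have "\<dots> = (\<Sum>k\<in>K. (real (max 1 k) * real (max 1 m)) powr (s * \<mu>) * \<bar>c\<bar> powr s)"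
    using assms by (simp add: weighted_term_ridge sum_Times_singleton)
  finally show ?thesis by (simp add: L_norm_def)
qed

lemma mixed_deriv_ridge:
  assumes "finite K" "K \<subseteq> {r1..}" "r2 \<le> m"
  shows "mixed_deriv r1 r2 (ridge K m c) (t, \<tau>) =
     c * (\<Sum>k\<in>K. (deriv ^^ r1) (legendre k) t) * (deriv ^^ r2) (legendre m) \<tau>"
proof -
  have "mixed_deriv r1 r2 (ridge K m c) (t, \<tau>) = (\<Sum>(k, j)\<in>K \<times> {m}.
     coef (ridge K m c) (k, j) * (deriv ^^ r1) (legendre k) t * (deriv ^^ r2) (legendre j) \<tau>)"
    unfolding mixed_deriv_def split_conv
    by (rule infsum_finite_support(1)) (use assms in \<open>auto simp: coef_ridge split: if_splits\<close>)
  also have "\<dots> = c * (\<Sum>k\<in>K. (deriv ^^ r1) (legendre k) t) * (deriv ^^ r2) (legendre m) \<tau>"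
    using assms(1) by (simp add: coef_ridge sum_distrib_left sum_distrib_right sum_Times_singleton)
  finally show ?thesis .
qed

section \<open>Sums over hyperbolic crosses\<close>

text \<open>Hoelder's inequality with the conjugate exponent hidden in the weight \<open>u\<close>, so that \<open>s = 1\<close>
  needs no supremum.\<close>
lemma holder_weighted_sum:
  fixes b u v :: "'a \<Rightarrow> real"
  assumes "finite F" "s \<ge> 1" "\<beta> > 0" "U > 0" "m \<ge> 0"
    and b: "\<And>i. i \<in> F \<Longrightarrow> 0 \<le> b i" "(\<Sum>i\<in>F. b i powr s) \<le> \<beta> powr s"
    and u: "\<And>i. i \<in> F \<Longrightarrow> 0 < u i" "(\<Sum>i\<in>F. u i) \<le> U"
    and v: "\<And>i. i \<in> F \<Longrightarrow> v i \<le> m * u i powr (1 - 1 / s)"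
  shows "(\<Sum>i\<in>F. b i * v i) \<le> m * \<beta> * U powr (1 - 1 / s)"
proof -
  let ?\<theta> = "1 - 1 / s"
  \<comment> \<open>Weighted Young inequality with weights 1/s and 1 - 1/s, after both families are
    normalised to total mass at most 1. It is applied to positive numbers, so \<open>b i = 0\<close>
    is settled apart.\<close>
  have "b i / \<beta> * (u i / U) powr ?\<theta> \<le> 1 / s * (b i powr s / \<beta> powr s) + ?\<theta> * (u i / U)" if "i \<in> F" for i
  proof (cases "b i = 0")
    case True
    then show ?thesis using assms(2,4) u(1)[OF that] by simp
  next
    case False
    then have "b i > 0" using b(1)[OF that] by simp
    then show ?thesis
      using Youngs_inequality_0[of "1 / s" ?\<theta> "(b i / \<beta>) powr s" "u i / U"] assms(2-4) u(1)[OF that]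
      by (simp add: powr_powr powr_divide)
  qed
  then have "(\<Sum>i\<in>F. b i / \<beta> * (u i / U) powr ?\<theta>)
      \<le> (\<Sum>i\<in>F. 1 / s * (b i powr s / \<beta> powr s) + ?\<theta> * (u i / U))"
    by (rule sum_mono)
  also have "\<dots> = 1 / s * ((\<Sum>i\<in>F. b i powr s) / \<beta> powr s) + ?\<theta> * ((\<Sum>i\<in>F. u i) / U)"
    by (simp add: sum.distrib sum_distrib_left sum_divide_distrib)
  also have "\<dots> \<le> 1 / s * 1 + ?\<theta> * 1"
    using assms(2-4) b(2) u(2) by (intro add_mono mult_left_mono) auto
  finally have *: "(\<Sum>i\<in>F. b i / \<beta> * (u i / U) powr ?\<theta>) \<le> 1" by simp
  have "(\<Sum>i\<in>F. b i * v i) \<le> (\<Sum>i\<in>F. (m * \<beta> * U powr ?\<theta>) * (b i / \<beta> * (u i / U) powr ?\<theta>))"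
  proof (rule sum_mono)
    fix i assume i: "i \<in> F"
    have "b i * v i \<le> b i * (m * u i powr ?\<theta>)"
      using b(1) v i by (intro mult_left_mono) auto
    also have "\<dots> = (m * \<beta> * U powr ?\<theta>) * (b i / \<beta> * (u i / U) powr ?\<theta>)"
      using assms(3,4) u(1)[OF i] by (simp add: powr_divide)
    finally show "b i * v i \<le> (m * \<beta> * U powr ?\<theta>) * (b i / \<beta> * (u i / U) powr ?\<theta>)" .
  qed
  also have "\<dots> \<le> (m * \<beta> * U powr ?\<theta>) * 1"
    unfolding sum_distrib_left[symmetric] using * assms(3-5) by (intro mult_left_mono) auto
  finally show ?thesis by simp
qed

text \<open>Names the constant in the bound of the sum of k^(-1-\<epsilon>) over k > x by C
  x^(-\<epsilon>), uniformly in \<open>x\<close> and in finite sets of indices. With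
  \<open>x = 1 / 2\<close> it bounds sums over any positive integers.\<close>

definition tail_const :: "real \<Rightarrow> real \<Rightarrow> bool" where
  "tail_const \<epsilon> C \<longleftrightarrow> C > 0 \<and> (\<forall>x F. x > 0 \<longrightarrow> finite F \<longrightarrow> (\<forall>k\<in>F. k \<ge> 1 \<and> real k > x) \<longrightarrow>
     (\<Sum>k\<in>F. real k powr (- 1 - \<epsilon>)) \<le> C * x powr (- \<epsilon>))"

lemma tail_constD:
  assumes "tail_const \<epsilon> C"
  shows "C > 0"
    and "x > 0 \<Longrightarrow> finite F \<Longrightarrow> (\<And>k. k \<in> F \<Longrightarrow> k \<ge> 1 \<and> real k > x) \<Longrightarrow>
       (\<Sum>k\<in>F. real k powr (- 1 - \<epsilon>)) \<le> C * x powr (- \<epsilon>)"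
  using assms by (auto simp: tail_const_def)

text \<open>Telescoping of k^(-\<epsilon>): by the mean value theorem a consecutive difference is
  \<epsilon> z^(-\<epsilon>-1) with z < k + 1 \<le> 2 k, which explains the constant
  2^(1+\<epsilon>) / \<epsilon>.\<close>

lemma ex_tail_const:
  assumes "\<epsilon> > 0"
  shows "\<exists>C. tail_const \<epsilon> C"
proof -
  define C where "C = 2 powr (1 + \<epsilon>) / \<epsilon>"
  have "C > 0" using assms by (simp add: C_def)
  have step: "real k powr (- 1 - \<epsilon>) \<le> C * real k powr (- \<epsilon>) - C * real (Suc k) powr (- \<epsilon>)"
    if "k \<ge> 1" for k
  proof -
    have "\<exists>z. z > real k \<and> z < real k + 1 \<and>
        (real k + 1) powr (- \<epsilon>) - real k powr (- \<epsilon>) = (real k + 1 - real k) * (- \<epsilon> * z powr (- \<epsilon> - 1))"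
      using that by (intro MVT2) (auto intro!: derivative_eq_intros)
    then obtain z where z: "z > real k" "z < real k + 1"
      "(real k + 1) powr (- \<epsilon>) - real k powr (- \<epsilon>) = - \<epsilon> * z powr (- \<epsilon> - 1)"
      by auto
    have "(2 * real k) powr (- \<epsilon> - 1) \<le> z powr (- \<epsilon> - 1)"
      using that z assms by (intro powr_mono2') auto
    then have "C * (\<epsilon> * (2 * real k) powr (- \<epsilon> - 1)) \<le> C * (\<epsilon> * z powr (- \<epsilon> - 1))"
      using assms \<open>C > 0\<close> by (intro mult_left_mono) auto
    also have "C * (\<epsilon> * z powr (- \<epsilon> - 1)) = C * real k powr (- \<epsilon>) - C * real (Suc k) powr (- \<epsilon>)"
    proof -
      have "\<epsilon> * z powr (- \<epsilon> - 1) = real k powr (- \<epsilon>) - real (Suc k) powr (- \<epsilon>)"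
        using z(3) by (simp add: add.commute)
      then show ?thesis by (simp only: right_diff_distrib)
    qed
    also have "C * (\<epsilon> * (2 * real k) powr (- \<epsilon> - 1)) =
        (2 powr (1 + \<epsilon>) * 2 powr (- \<epsilon> - 1)) * real k powr (- \<epsilon> - 1)"
      using assms by (simp add: C_def powr_mult)
    also have "2 powr (1 + \<epsilon>) * 2 powr (- \<epsilon> - 1) = (1 :: real)"
      by (simp flip: powr_add)
    also have "- \<epsilon> - 1 = - 1 - \<epsilon>" by simp
    finally show ?thesis by simp
  qed
  have "(\<Sum>k\<in>F. real k powr (- 1 - \<epsilon>)) \<le> C * x powr (- \<epsilon>)"
    if "x > 0" "finite F" and F: "\<forall>k\<in>F. k \<ge> 1 \<and> real k > x" for x F
  proof (cases "F = {}")
    case True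
    then show ?thesis using \<open>C > 0\<close> by simp
  next
    case False
    \<comment> \<open>Filling \<open>F\<close> up to an interval makes the sum telescope; its left
      end is an element of \<open>F\<close> and so still exceeds \<open>x\<close>.\<close>
    define m where "m = Min F"
    define M where "M = Suc (Max F)"
    have m: "m \<in> F" "m \<le> M" using False \<open>finite F\<close> by (auto simp: m_def M_def le_SucI)
    have sub: "F \<subseteq> {m..<M}" using \<open>finite F\<close> by (auto simp: m_def M_def less_Suc_eq_le)
    have "(\<Sum>k\<in>F. real k powr (- 1 - \<epsilon>)) \<le> (\<Sum>k\<in>{m..<M}. real k powr (- 1 - \<epsilon>))"
      using sub by (intro sum_mono2) auto
    also have "\<dots> \<le> (\<Sum>k\<in>{m..<M}. C * real k powr (- \<epsilon>) - C * real (Suc k) powr (- \<epsilon>))"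
      using m(1) F by (intro sum_mono step) fastforce
    also have "\<dots> = C * real m powr (- \<epsilon>) - C * real M powr (- \<epsilon>)"
      using sum_Suc_diff'[OF m(2), of "\<lambda>k. - (C * real k powr (- \<epsilon>))"] by simp
    also have "\<dots> \<le> C * real m powr (- \<epsilon>)" using \<open>C > 0\<close> by simp
    also have "\<dots> \<le> C * x powr (- \<epsilon>)"
      using \<open>C > 0\<close> m(1) F assms \<open>x > 0\<close> by (intro mult_left_mono powr_mono2') (auto intro: less_imp_le)
    finally show ?thesis .
  qed
  with \<open>C > 0\<close> show ?thesis by (auto simp: tail_const_def)
qed

text \<open>Slicing at fixed \<open>j\<close> turns sums outside a cross into one-dimensional tails
  in \<open>k\<close>.\<close>

lemma sum_by_second:
  assumes "finite F"
  shows "sum f F = (\<Sum>j\<in>snd ` F. \<Sum>k\<in>{k. (k, j) \<in> F}. f (k, j))"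
proof -
  have "sum f F = (\<Sum>j\<in>snd ` F. sum f {x \<in> F. snd x = j})"
    by (rule sum.image_gen[OF assms])
  also have "\<dots> = (\<Sum>j\<in>snd ` F. \<Sum>k\<in>{k. (k, j) \<in> F}. f (k, j))"
  proof (rule sum.cong[OF refl])
    fix j
    have "{x \<in> F. snd x = j} = (\<lambda>k. (k, j)) ` {k. (k, j) \<in> F}" by auto
    then show "sum f {x \<in> F. snd x = j} = (\<Sum>k\<in>{k. (k, j) \<in> F}. f (k, j))"
      by (simp add: sum.reindex inj_on_def)
  qed
  finally show ?thesis .
qed

lemma finite_slice: "finite F \<Longrightarrow> finite {k. (k, j) \<in> F}"
  by (rule finite_subset[of _ "fst ` F"]) force+

text \<open>The exterior of the cross among all positive indices. As r1, r2 \<ge> 1, it contains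
  every index that the truncation discards.\<close>

definition hyp_out :: "real \<Rightarrow> real \<Rightarrow> (nat \<times> nat) set" where
  "hyp_out n \<gamma> = {(k, j). 1 \<le> k \<and> 1 \<le> j \<and> n < real k * real j powr \<gamma>}"

lemma powr_divide_powr_minus:
  fixes x y g a :: real
  assumes "x > 0" "y > 0"
  shows "(x / y powr g) powr (- a) = x powr (- a) * y powr (g * a)"
proof -
  have "(x / y powr g) powr (- a) = x powr (- a) / y powr (- (g * a))"
    using assms by (simp add: powr_divide powr_powr)
  then show ?thesis by (simp add: powr_minus field_simps)
qed

text \<open>For fixed j the tail over k > n / j^\<gamma> is of order n^(-a) j^(\<gamma> a). This
  leaves j^(-1-\<eta>) with \<eta> = a2 - \<gamma> a > 0, which is summable.\<close>

lemma hyp_out_sum_gt: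
  assumes "a > 0" "\<gamma> * a < a2"
  shows "\<exists>C>0. \<forall>n\<ge>1. \<forall>F. finite F \<longrightarrow> F \<subseteq> hyp_out n \<gamma> \<longrightarrow>
    (\<Sum>(k, j)\<in>F. real k powr (- 1 - a) * real j powr (- 1 - a2)) \<le> C * n powr (- a)"
proof -
  obtain C where "tail_const a C" using ex_tail_const[OF assms(1)] ..
  note C = tail_constD[OF this]
  define \<eta> where "\<eta> = a2 - \<gamma> * a"
  have \<eta>: "\<eta> > 0" using assms by (simp add: \<eta>_def)
  obtain C' where "tail_const \<eta> C'" using ex_tail_const[OF \<eta>] ..
  note C' = tail_constD[OF this]
  define D where "D = C * (C' * (1 / 2) powr (- \<eta>))"
  have "(\<Sum>(k, j)\<in>F. real k powr (- 1 - a) * real j powr (- 1 - a2)) \<le> D * n powr (- a)"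
    if n: "n \<ge> 1" and F: "finite F" "F \<subseteq> hyp_out n \<gamma>" for n F
  proof -
    have "(\<Sum>(k, j)\<in>F. real k powr (- 1 - a) * real j powr (- 1 - a2)) =
        (\<Sum>j\<in>snd ` F. (\<Sum>k\<in>{k. (k, j) \<in> F}. real k powr (- 1 - a)) * real j powr (- 1 - a2))"
      by (subst sum_by_second[OF F(1)]) (simp add: sum_distrib_right)
    also have "\<dots> \<le> (\<Sum>j\<in>snd ` F. C * n powr (- a) * real j powr (- 1 - \<eta>))"
    proof (rule sum_mono)
      fix j assume "j \<in> snd ` F"
      then have j: "j \<ge> 1" using F(2) by (auto simp: hyp_out_def)
      have "(\<Sum>k\<in>{k. (k, j) \<in> F}. real k powr (- 1 - a)) \<le> C * (n / real j powr \<gamma>) powr (- a)"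
        using n j F(2) by (intro C finite_slice F(1)) (auto simp: hyp_out_def divide_less_eq)
      also have "(n / real j powr \<gamma>) powr (- a) = n powr (- a) * real j powr (\<gamma> * a)"
        using n j by (intro powr_divide_powr_minus) auto
      finally have "(\<Sum>k\<in>{k. (k, j) \<in> F}. real k powr (- 1 - a)) * real j powr (- 1 - a2)
         \<le> C * (n powr (- a) * real j powr (\<gamma> * a)) * real j powr (- 1 - a2)"
        by (intro mult_right_mono) auto
      also have "\<dots> = C * n powr (- a) * (real j powr (\<gamma> * a) * real j powr (- 1 - a2))"
        by simp
      also have "real j powr (\<gamma> * a) * real j powr (- 1 - a2) = real j powr (- 1 - \<eta>)"
        by (simp add: \<eta>_def algebra_simps flip: powr_add)
      finally show "(\<Sum>k\<in>{k. (k, j) \<in> F}. real k powr (- 1 - a)) * real j powr (- 1 - a2)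
         \<le> C * n powr (- a) * real j powr (- 1 - \<eta>)" .
    qed
    also have "\<dots> = C * n powr (- a) * (\<Sum>j\<in>snd ` F. real j powr (- 1 - \<eta>))"
      by (simp add: sum_distrib_left)
    also have "\<dots> \<le> C * n powr (- a) * (C' * (1 / 2) powr (- \<eta>))"
      using C(1) F by (intro mult_left_mono C'(2)) (auto simp: hyp_out_def)
    also have "\<dots> = D * n powr (- a)" by (simp add: D_def)
    finally show ?thesis .
  qed
  moreover have "D > 0" using C C' by (simp add: D_def)
  ultimately show ?thesis by blast
qed

lemma sum_inverse_le_ln:
  assumes "n \<ge> 1" "finite F" "\<And>j. j \<in> F \<Longrightarrow> 1 \<le> j \<and> real j \<le> n"
  shows "(\<Sum>j\<in>F. 1 / real j) \<le> 1 + ln n"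
proof -
  define N where "N = nat \<lfloor>n\<rfloor>"
  have N: "N \<ge> 1" "real N \<le> n" using assms(1) by (auto simp: N_def le_nat_iff le_floor_iff)
  have "F \<subseteq> {1..N}" using assms(3) by (fastforce simp: N_def intro!: le_nat_floor)
  then have "(\<Sum>j\<in>F. 1 / real j) \<le> (\<Sum>j\<in>{1..N}. 1 / real j)"
    by (intro sum_mono2) auto
  also have "\<dots> = harm N" by (simp add: harm_def divide_inverse)
  \<comment> \<open>The difference harm m - ln m decreases in m and equals 1 at m = 1.\<close>
  also have "\<dots> \<le> 1 + ln (real N)"
    using decseqD[OF decseq_harm_diff_ln, of 0 "N - 1"] N(1) by (simp add: harm_expand)
  also have "\<dots> \<le> 1 + ln n" using N by simp
  finally show ?thesis .
qed

text \<open>Now the tail over k leaves exactly 1/j, which is used for j \<le> n only and gives the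
  logarithm. For j > n the sum over k is bounded by the constant \<open>c\<close>, and the tail over
  j already supplies n^(-a).\<close>

lemma hyp_out_sum_eq:
  assumes "a > 0"
  shows "\<exists>C>0. \<forall>n\<ge>1. \<forall>F. finite F \<longrightarrow> F \<subseteq> hyp_out n 1 \<longrightarrow>
    (\<Sum>(k, j)\<in>F. real k powr (- 1 - a) * real j powr (- 1 - a)) \<le> C * n powr (- a) * (1 + ln n)"
proof -
  obtain C where "tail_const a C" using ex_tail_const[OF assms(1)] ..
  note C = tail_constD[OF this]
  define c where "c = C * (1 / 2) powr (- a)"
  have c: "c > 0" using C by (simp add: c_def)
  define D where "D = C + c * C"
  have "(\<Sum>(k, j)\<in>F. real k powr (- 1 - a) * real j powr (- 1 - a)) \<le> D * n powr (- a) * (1 + ln n)"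
    if n: "n \<ge> 1" and F: "finite F" "F \<subseteq> hyp_out n 1" for n F
  proof -
    define S where "S j = (\<Sum>k\<in>{k. (k, j) \<in> F}. real k powr (- 1 - a))" for j
    have S1: "S j * real j powr (- 1 - a) \<le> C * n powr (- a) * (1 / real j)" if "j \<in> snd ` F" for j
    proof -
      have j: "j \<ge> 1" using that F(2) by (auto simp: hyp_out_def)
      have "S j \<le> C * (n / real j) powr (- a)"
        unfolding S_def
        using n j F(2) by (intro C finite_slice F(1)) (auto simp: hyp_out_def divide_less_eq)
      also have "(n / real j) powr (- a) = n powr (- a) * real j powr a"
        using n j powr_divide_powr_minus[of n "real j" 1 a] by simp
      finally have "S j * real j powr (- 1 - a) \<le> C * (n powr (- a) * real j powr a) * real j powr (- 1 - a)"
        by (intro mult_right_mono) auto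
      also have "\<dots> = C * n powr (- a) * (real j powr a * real j powr (- 1 - a))"
        by simp
      also have "real j powr a * real j powr (- 1 - a) = 1 / real j"
        using j by (simp add: powr_minus_divide flip: powr_add)
      finally show ?thesis .
    qed
    have S2: "S j \<le> c" for j
      unfolding S_def c_def using F(2) by (intro C finite_slice F(1)) (auto simp: hyp_out_def)
    let ?J = "snd ` F"
    have "(\<Sum>(k, j)\<in>F. real k powr (- 1 - a) * real j powr (- 1 - a)) =
        (\<Sum>j\<in>?J. S j * real j powr (- 1 - a))"
      unfolding S_def by (subst sum_by_second[OF F(1)]) (simp add: sum_distrib_right)
    also have "\<dots> = (\<Sum>j\<in>?J \<inter> {j. real j \<le> n}. S j * real j powr (- 1 - a)) +
        (\<Sum>j\<in>?J - {j. real j \<le> n}. S j * real j powr (- 1 - a))"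
      using F(1) by (intro sum.Int_Diff) auto
    also have "(\<Sum>j\<in>?J \<inter> {j. real j \<le> n}. S j * real j powr (- 1 - a))
        \<le> (\<Sum>j\<in>?J \<inter> {j. real j \<le> n}. C * n powr (- a) * (1 / real j))"
      by (intro sum_mono S1) auto
    also have "\<dots> = C * n powr (- a) * (\<Sum>j\<in>?J \<inter> {j. real j \<le> n}. 1 / real j)"
      by (simp add: sum_distrib_left)
    also have "\<dots> \<le> C * n powr (- a) * (1 + ln n)"
      using C n F by (intro mult_left_mono sum_inverse_le_ln) (auto simp: hyp_out_def)
    also have "(\<Sum>j\<in>?J - {j. real j \<le> n}. S j * real j powr (- 1 - a))
        \<le> (\<Sum>j\<in>?J - {j. real j \<le> n}. c * real j powr (- 1 - a))"
      by (intro sum_mono mult_right_mono S2) auto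
    also have "\<dots> = c * (\<Sum>j\<in>?J - {j. real j \<le> n}. real j powr (- 1 - a))"
      by (simp add: sum_distrib_left)
    also have "\<dots> \<le> c * (C * n powr (- a))"
      using c n F by (intro mult_left_mono C(2)) (auto simp: hyp_out_def)
    also have "\<dots> \<le> c * C * n powr (- a) * (1 + ln n)"
      using c C n by (simp add: mult_le_cancel_left1)
    finally show ?thesis by (simp add: D_def algebra_simps)
  qed
  moreover have "D > 0" using C c by (simp add: D_def add_pos_pos)
  ultimately show ?thesis by blast
qed

section \<open>Cardinality of hyperbolic crosses\<close>

lemma Gam_card:
  assumes "1 \<le> r1" "1 \<le> r2" "\<gamma> \<ge> 1" "n \<ge> 1"
  shows "finite (Gam r1 r2 n \<gamma>)"
    and "real (card (Gam r1 r2 n \<gamma>)) \<le> n * (\<Sum>j\<in>{1..nat \<lfloor>n\<rfloor>}. real j powr (- \<gamma>))"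
proof -
  define S where "S = (SIGMA j:{1..nat \<lfloor>n\<rfloor>}. {1..nat \<lfloor>n * real j powr (- \<gamma>)\<rfloor>})"
  have sub: "Gam r1 r2 n \<gamma> \<subseteq> prod.swap ` S"
  proof
    fix x assume x: "x \<in> Gam r1 r2 n \<gamma>"
    obtain k j where kj: "x = (k, j)" by fastforce
    with x assms have k: "k \<ge> 1" "j \<ge> 1" "real k * real j powr \<gamma> \<le> n" by (auto simp: Gam_def)
    \<comment> \<open>The condition \<open>\<gamma> \<ge> 1\<close> confines \<open>j\<close> to
      [1, n]; this fixes the range of the outer index in \<open>S\<close>.\<close>
    have "real j = 1 * real j powr 1" using k by simp
    also have "\<dots> \<le> real k * real j powr \<gamma>" using k assms by (intro mult_mono powr_mono) auto
    finally have "real j \<le> n" using k(3) by simp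
    moreover have "real k \<le> n * real j powr (- \<gamma>)"
      using k by (simp add: powr_minus field_simps)
    ultimately have "(j, k) \<in> S"
      using k by (auto simp: S_def le_nat_iff le_floor_iff)
    then show "x \<in> prod.swap ` S" using kj by force
  qed
  have fin: "finite S" by (simp add: S_def)
  then show "finite (Gam r1 r2 n \<gamma>)" using sub finite_subset by blast
  have "card (Gam r1 r2 n \<gamma>) \<le> card (prod.swap ` S)"
    using sub fin by (intro card_mono) auto
  also have "\<dots> \<le> card S" by (rule card_image_le[OF fin])
  also have "\<dots> = (\<Sum>j\<in>{1..nat \<lfloor>n\<rfloor>}. nat \<lfloor>n * real j powr (- \<gamma>)\<rfloor>)"
    by (simp add: S_def)
  finally have "real (card (Gam r1 r2 n \<gamma>)) \<le> (\<Sum>j\<in>{1..nat \<lfloor>n\<rfloor>}. real (nat \<lfloor>n * real j powr (- \<gamma>)\<rfloor>))"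
    by (metis of_nat_le_iff of_nat_sum)
  also have "\<dots> \<le> (\<Sum>j\<in>{1..nat \<lfloor>n\<rfloor>}. n * real j powr (- \<gamma>))"
    using assms(4) by (intro sum_mono) simp
  finally show "real (card (Gam r1 r2 n \<gamma>)) \<le> n * (\<Sum>j\<in>{1..nat \<lfloor>n\<rfloor>}. real j powr (- \<gamma>))"
    by (simp add: sum_distrib_left)
qed

text \<open>The sum of j^(-\<gamma>) converges, so the cross has at most of order n points; for
  \<gamma> = 1 the harmonic sum costs a logarithm.\<close>

lemma Gam_card_gt:
  assumes "\<gamma> > 1"
  shows "\<exists>C>0. \<forall>r1\<ge>1. \<forall>r2\<ge>1. \<forall>n\<ge>1. real (card (Gam r1 r2 n \<gamma>)) \<le> C * n"
proof -
  obtain C where "tail_const (\<gamma> - 1) C" using ex_tail_const[of "\<gamma> - 1"] assms by auto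
  note C = tail_constD[OF this]
  define D where "D = C * (1 / 2) powr (- (\<gamma> - 1))"
  have "real (card (Gam r1 r2 n \<gamma>)) \<le> D * n" if "r1 \<ge> 1" "r2 \<ge> 1" "n \<ge> 1" for r1 r2 n
  proof -
    have "real (card (Gam r1 r2 n \<gamma>)) \<le> n * (\<Sum>j\<in>{1..nat \<lfloor>n\<rfloor>}. real j powr (- \<gamma>))"
      using that assms by (intro Gam_card) auto
    also have "(\<Sum>j\<in>{1..nat \<lfloor>n\<rfloor>}. real j powr (- \<gamma>)) \<le> D"
      using C(2)[of "1/2" "{1..nat \<lfloor>n\<rfloor>}"] by (simp add: D_def)
    finally show ?thesis using that by (simp add: mult.commute)
  qed
  moreover have "D > 0" using C by (simp add: D_def)
  ultimately show ?thesis by blast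
qed

lemma Gam_card_eq:
  assumes "1 \<le> r1" "1 \<le> r2" "n \<ge> 1"
  shows "real (card (Gam r1 r2 n 1)) \<le> n * (1 + ln n)"
proof -
  have "real (card (Gam r1 r2 n 1)) \<le> n * (\<Sum>j\<in>{1..nat \<lfloor>n\<rfloor>}. real j powr (- 1))"
    using assms by (intro Gam_card) auto
  also have "(\<Sum>j\<in>{1..nat \<lfloor>n\<rfloor>}. real j powr (- 1)) = (\<Sum>j\<in>{1..nat \<lfloor>n\<rfloor>}. 1 / real j)"
    by (simp add: powr_minus_divide)
  also have "\<dots> \<le> 1 + ln n"
    using assms(3) by (intro sum_inverse_le_ln) (auto simp: le_nat_iff le_floor_iff)
  finally show ?thesis using assms by simp
qed

section \<open>Error of the truncation method\<close>

text \<open>Up to a constant, the bound for the sup norm over the square of the differentiated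
  product of two Legendre polynomials.\<close>

definition dweight :: "nat \<Rightarrow> nat \<Rightarrow> nat \<times> nat \<Rightarrow> real" where
  "dweight r1 r2 = (\<lambda>(k, j). real k powr (2 * real r1 + 1 / 2) * real j powr (2 * real r2 + 1 / 2))"

text \<open>Bounds on finite sums are what the tail estimates deliver. Convergence comes with them,
  so \<open>infsum\<close> never falls back on its default value 0.\<close>

lemma summable_of_bounded_sums:
  fixes g :: "'a \<Rightarrow> real"
  assumes "\<And>F. finite F \<Longrightarrow> F \<subseteq> A \<Longrightarrow> (\<Sum>i\<in>F. \<bar>g i\<bar>) \<le> T"
  shows "g summable_on A" and "\<bar>infsum g A\<bar> \<le> T"
proof -
  have abs: "(\<lambda>i. \<bar>g i\<bar>) summable_on A"
    by (rule nonneg_bdd_above_summable_on) (use assms in \<open>auto simp: bdd_above_def\<close>)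
  then have n: "(\<lambda>i. norm (g i)) summable_on A" by simp
  then show "g summable_on A" by (rule abs_summable_summable)
  have "\<bar>infsum g A\<bar> \<le> infsum (\<lambda>i. \<bar>g i\<bar>) A"
    using norm_infsum_bound[OF n] by simp
  also have "\<dots> \<le> T"
    by (rule infsum_le_finite_sums[OF abs]) (use assms in auto)
  finally show "\<bar>infsum g A\<bar> \<le> T" .
qed

lemma enn2real_ge_1:
  assumes "1 \<le> p" "p \<noteq> \<infinity>"
  shows "1 \<le> enn2real p" and "recip_exp p = 1 / enn2real p"
proof -
  obtain q where q: "p = ennreal q" "q \<ge> 0"
    using assms(2) by (cases p) auto
  then have "q \<ge> 1" using assms(1) by (simp flip: ennreal_1)
  with q show "1 \<le> enn2real p" "recip_exp p = 1 / enn2real p"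
    by (simp_all add: divide_ennreal flip: ennreal_1)
qed

lemma recip_exp_bounds:
  assumes "1 \<le> p"
  shows "0 \<le> recip_exp p" "recip_exp p \<le> 1"
  using enn2real_ge_1[OF assms] by (cases "p = \<infinity>"; simp)+

text \<open>Hoelder's inequality with constant weight 1, whence the power 1 - 1/p of the
  cardinality; p = \<infinity> is a termwise bound. A positive majorant \<open>U\<close> of the
  cardinality also covers an empty set.\<close>

lemma lp_noise_sum:
  assumes "1 \<le> p" "\<delta> > 0" "lp_norm p \<xi> \<le> ennreal \<delta>" "finite \<Gamma>"
    and v: "\<And>i. i \<in> \<Gamma> \<Longrightarrow> v i \<le> m" and "m \<ge> 0"
    and card: "real (card \<Gamma>) \<le> U" "U > 0"
  shows "(\<Sum>i\<in>\<Gamma>. \<bar>\<xi> i\<bar> * v i) \<le> m * \<delta> * U powr (1 - recip_exp p)"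
proof (cases "p = \<infinity>")
  case True
  have "\<bar>\<xi> i\<bar> \<le> \<delta>" for i
  proof -
    have "ennreal \<bar>\<xi> i\<bar> \<le> (SUP i. ennreal \<bar>\<xi> i\<bar>)" by (rule SUP_upper) simp
    also have "\<dots> \<le> ennreal \<delta>" using assms(3) True by (simp add: lp_norm_def)
    finally show ?thesis using assms(2) by (simp add: ennreal_le_iff)
  qed
  then have "(\<Sum>i\<in>\<Gamma>. \<bar>\<xi> i\<bar> * v i) \<le> (\<Sum>i\<in>\<Gamma>. \<delta> * m)"
    using v assms(6,2) by (intro sum_mono order_trans[OF mult_left_mono mult_right_mono]) auto
  also have "\<dots> = m * \<delta> * real (card \<Gamma>)" by simp
  also have "\<dots> \<le> m * \<delta> * U" using card assms(2,6) by (intro mult_left_mono) auto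
  also have "\<dots> = m * \<delta> * U powr (1 - recip_exp p)" using card True by simp
  finally show ?thesis .
next
  case False
  define q where "q = enn2real p"
  have q: "q \<ge> 1" "recip_exp p = 1 / q" using enn2real_ge_1[OF assms(1) False] by (auto simp: q_def)
  \<comment> \<open>A norm bounded by the finite number \<open>\<delta>\<close> excludes the
    infinite branch of \<open>lp_norm\<close>.\<close>
  have summ: "(\<lambda>i. \<bar>\<xi> i\<bar> powr q) summable_on UNIV"
    and le: "ennreal ((\<Sum>\<^sub>\<infinity>i\<in>UNIV. \<bar>\<xi> i\<bar> powr q) powr (1 / q)) \<le> ennreal \<delta>"
    using assms(3) False by (auto simp: lp_norm_def q_def top_unique split: if_splits)
  have "(\<Sum>i\<in>\<Gamma>. \<bar>\<xi> i\<bar> powr q) \<le> (\<Sum>\<^sub>\<infinity>i\<in>UNIV. \<bar>\<xi> i\<bar> powr q)"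
    using assms(4) by (intro finite_sum_le_infsum summ) auto
  also have "\<dots> = ((\<Sum>\<^sub>\<infinity>i\<in>UNIV. \<bar>\<xi> i\<bar> powr q) powr (1 / q)) powr q"
    using q(1) by (simp add: powr_powr infsum_nonneg)
  also have "\<dots> \<le> \<delta> powr q"
    using le assms(2) q(1) by (intro powr_mono2) (auto simp: ennreal_le_iff)
  finally have "(\<Sum>i\<in>\<Gamma>. \<bar>\<xi> i\<bar> powr q) \<le> \<delta> powr q" .
  then have "(\<Sum>i\<in>\<Gamma>. \<bar>\<xi> i\<bar> * v i) \<le> m * \<delta> * U powr (1 - 1 / q)"
    using assms q by (intro holder_weighted_sum[where u = "\<lambda>_. 1"]) auto
  then show ?thesis using q by simp
qed

text \<open>On the cross the error is the propagated noise, off the cross it is the discarded tail.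
  Both are entered as abstract bounds \<open>E\<close> and \<open>T\<close>, so that the two regimes
  of \<gamma> can share the splitting.\<close>

lemma recovery_error_le:
  assumes r: "1 \<le> r1" "1 \<le> r2" and fin: "finite (Gam r1 r2 n \<gamma>)"
    and K: "K1 > 0" "\<And>k x. k \<ge> 1 \<Longrightarrow> x \<in> {-1..1} \<Longrightarrow>
          \<bar>(deriv ^^ r1) (legendre k) x\<bar> \<le> K1 * real k powr (2 * real r1 + 1 / 2)"
      "K2 > 0" "\<And>k x. k \<ge> 1 \<Longrightarrow> x \<in> {-1..1} \<Longrightarrow>
          \<bar>(deriv ^^ r2) (legendre k) x\<bar> \<le> K2 * real k powr (2 * real r2 + 1 / 2)"
    and tail: "\<And>f F. f \<in> L_class s \<mu> \<Longrightarrow> L_norm s \<mu> f \<le> 1 \<Longrightarrow> finite F \<Longrightarrow>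
        F \<subseteq> hyp_out n \<gamma> \<Longrightarrow> (\<Sum>i\<in>F. \<bar>coef f i\<bar> * dweight r1 r2 i) \<le> T"
    and noise: "\<And>\<xi>. lp_norm p \<xi> \<le> ennreal \<delta> \<Longrightarrow>
        (\<Sum>i\<in>Gam r1 r2 n \<gamma>. \<bar>\<xi> i\<bar> * dweight r1 r2 i) \<le> E"
  shows "recovery_error r1 r2 s \<mu> p \<delta> (Gam r1 r2 n \<gamma>) (truncation r1 r2 n \<gamma>)
           \<le> ennreal (K1 * K2 * (T + E))"
proof -
  let ?\<Gamma> = "Gam r1 r2 n \<gamma>"
  have "\<bar>mixed_deriv r1 r2 f x - truncation r1 r2 n \<gamma> (restrict a ?\<Gamma>) x\<bar> \<le> K1 * K2 * (T + E)"
    if f: "f \<in> L_class s \<mu>" "L_norm s \<mu> f \<le> 1" and a: "lp_norm p (\<lambda>i. coef f i - a i) \<le> ennreal \<delta>"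
      and x: "x \<in> square" for f a x
  proof -
    obtain t \<tau> where [simp]: "x = (t, \<tau>)" by fastforce
    have t: "t \<in> {-1..1}" "\<tau> \<in> {-1..1}" using x by (auto simp: square_def)
    define S where "S = {r1..} \<times> {r2..}"
    define h where "h = (\<lambda>(k, j). (deriv ^^ r1) (legendre k) t * (deriv ^^ r2) (legendre j) \<tau>)"
    have h: "\<bar>h i\<bar> \<le> K1 * K2 * dweight r1 r2 i" if "i \<in> S" for i
    proof -
      obtain k j where i: "i = (k, j)" by fastforce
      with that r have kj: "k \<ge> 1" "j \<ge> 1" by (auto simp: S_def)
      have "\<bar>h i\<bar> \<le> (K1 * real k powr (2 * real r1 + 1 / 2)) * (K2 * real j powr (2 * real r2 + 1 / 2))"
        unfolding h_def i split_conv abs_mult using K kj t by (intro mult_mono) auto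
      then show ?thesis by (simp add: i dweight_def mult_ac)
    qed
    have sub: "?\<Gamma> \<subseteq> S" by (auto simp: Gam_def S_def)
    have out: "S - ?\<Gamma> \<subseteq> hyp_out n \<gamma>" using r by (auto simp: Gam_def S_def hyp_out_def)
    have tl: "(\<Sum>i\<in>F. \<bar>coef f i * h i\<bar>) \<le> K1 * K2 * T" if "finite F" "F \<subseteq> S - ?\<Gamma>" for F
    proof -
      have "(\<Sum>i\<in>F. \<bar>coef f i * h i\<bar>) \<le> (\<Sum>i\<in>F. (K1 * K2) * (\<bar>coef f i\<bar> * dweight r1 r2 i))"
      proof (rule sum_mono)
        fix i assume "i \<in> F"
        then have "\<bar>coef f i\<bar> * \<bar>h i\<bar> \<le> \<bar>coef f i\<bar> * (K1 * K2 * dweight r1 r2 i)"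
          using that by (intro mult_left_mono h) auto
        then show "\<bar>coef f i * h i\<bar> \<le> (K1 * K2) * (\<bar>coef f i\<bar> * dweight r1 r2 i)"
          by (simp add: abs_mult mult_ac)
      qed
      also have "\<dots> = (K1 * K2) * (\<Sum>i\<in>F. \<bar>coef f i\<bar> * dweight r1 r2 i)"
        by (simp add: sum_distrib_left)
      also have "\<dots> \<le> (K1 * K2) * T"
        using that out K by (intro mult_left_mono tail f) auto
      finally show ?thesis .
    qed
    have nz: "(\<Sum>i\<in>?\<Gamma>. \<bar>(coef f i - a i) * h i\<bar>) \<le> K1 * K2 * E"
    proof -
      have "(\<Sum>i\<in>?\<Gamma>. \<bar>(coef f i - a i) * h i\<bar>)
          \<le> (\<Sum>i\<in>?\<Gamma>. (K1 * K2) * (\<bar>coef f i - a i\<bar> * dweight r1 r2 i))"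
      proof (rule sum_mono)
        fix i assume "i \<in> ?\<Gamma>"
        then have "\<bar>coef f i - a i\<bar> * \<bar>h i\<bar> \<le> \<bar>coef f i - a i\<bar> * (K1 * K2 * dweight r1 r2 i)"
          using sub by (intro mult_left_mono h) auto
        then show "\<bar>(coef f i - a i) * h i\<bar> \<le> (K1 * K2) * (\<bar>coef f i - a i\<bar> * dweight r1 r2 i)"
          by (simp add: abs_mult mult_ac)
      qed
      also have "\<dots> = (K1 * K2) * (\<Sum>i\<in>?\<Gamma>. \<bar>coef f i - a i\<bar> * dweight r1 r2 i)"
        by (simp add: sum_distrib_left)
      also have "\<dots> \<le> (K1 * K2) * E"
        using K by (intro mult_left_mono noise a) auto
      finally show ?thesis .
    qed
    have "mixed_deriv r1 r2 f x = infsum (\<lambda>i. coef f i * h i) S"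
      by (simp add: mixed_deriv_def S_def h_def split_def mult.assoc)
    \<comment> \<open>Additivity of \<open>infsum\<close> requires summability of the discarded
      part, which \<open>tl\<close> supplies.\<close>
    also have "S = ?\<Gamma> \<union> (S - ?\<Gamma>)" using sub by auto
    also have "infsum (\<lambda>i. coef f i * h i) (?\<Gamma> \<union> (S - ?\<Gamma>)) =
        infsum (\<lambda>i. coef f i * h i) ?\<Gamma> + infsum (\<lambda>i. coef f i * h i) (S - ?\<Gamma>)"
      by (intro infsum_Un_disjoint summable_on_finite fin summable_of_bounded_sums(1)[OF tl]) auto
    finally have md: "mixed_deriv r1 r2 f x =
        (\<Sum>i\<in>?\<Gamma>. coef f i * h i) + infsum (\<lambda>i. coef f i * h i) (S - ?\<Gamma>)"
      using fin by simp
    \<comment> \<open>The method reads only indices in the cross, where the restricted data agree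
      with \<open>a\<close>.\<close>
    have "truncation r1 r2 n \<gamma> (restrict a ?\<Gamma>) x = (\<Sum>i\<in>?\<Gamma>. a i * h i)"
      by (auto simp: truncation_def h_def split_def mult.assoc intro!: sum.cong)
    then have "mixed_deriv r1 r2 f x - truncation r1 r2 n \<gamma> (restrict a ?\<Gamma>) x =
        (\<Sum>i\<in>?\<Gamma>. (coef f i - a i) * h i) + infsum (\<lambda>i. coef f i * h i) (S - ?\<Gamma>)"
      using md by (simp add: left_diff_distrib sum_subtractf)
    also have "\<bar>\<dots>\<bar> \<le> (\<Sum>i\<in>?\<Gamma>. \<bar>(coef f i - a i) * h i\<bar>) + K1 * K2 * T"
      using summable_of_bounded_sums(2)[OF tl] sum_abs[of "\<lambda>i. (coef f i - a i) * h i" ?\<Gamma>]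
      by (intro order_trans[OF abs_triangle_ineq] add_mono) auto
    finally show ?thesis using nz by (simp add: algebra_simps)
  qed
  then show ?thesis
    unfolding recovery_error_def C_norm_def perturbed_data_def
    by (intro SUP_least ennreal_leI) auto
qed

lemma truncation_in_recoveries: "truncation r1 r2 n \<gamma> \<in> recoveries (Gam r1 r2 n \<gamma>)"
  unfolding recoveries_def C_square_def truncation_def deriv_legendre_eq_poly split_def
  by (intro funcsetI CollectI continuous_intros)

lemma min_radius_le:
  assumes "finite (Gam r1 r2 n \<gamma>)" "card (Gam r1 r2 n \<gamma>) \<le> N"
  shows "min_radius r1 r2 s \<mu> p N \<delta> \<le>
     recovery_error r1 r2 s \<mu> p \<delta> (Gam r1 r2 n \<gamma>) (truncation r1 r2 n \<gamma>)"
  unfolding min_radius_def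
  by (rule INF_lower2[of "Gam r1 r2 n \<gamma>"], use assms in \<open>force simp: Gam_def\<close>)
     (rule INF_lower[OF truncation_in_recoveries])

text \<open>The unit ball in the form that Hoelder's inequality takes as input, with the weight
  inside the s-th power; for positive indices the maxima with 1 disappear.\<close>

lemma L_class_sum_le:
  assumes "f \<in> L_class s \<mu>" "L_norm s \<mu> f \<le> 1" "finite F" "s \<ge> 1"
    and "\<And>k j. (k, j) \<in> F \<Longrightarrow> 1 \<le> k \<and> 1 \<le> j"
  shows "(\<Sum>(k, j)\<in>F. ((real k * real j) powr \<mu> * \<bar>coef f (k, j)\<bar>) powr s) \<le> 1"
proof -
  let ?W = "weighted_term s \<mu> f"
  have W: "?W i \<ge> 0" for i by (simp add: weighted_term_def split_def)
  have summ: "?W summable_on UNIV" using assms(1) by (simp add: L_class_def)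
  have "(\<Sum>(k, j)\<in>F. ((real k * real j) powr \<mu> * \<bar>coef f (k, j)\<bar>) powr s) = sum ?W F"
  proof (rule sum.cong[OF refl])
    fix i assume "i \<in> F"
    moreover obtain k j where i: "i = (k, j)" by fastforce
    ultimately have "1 \<le> k" "1 \<le> j" using assms(5) by blast+
    then show "(case i of (k, j) \<Rightarrow> ((real k * real j) powr \<mu> * \<bar>coef f (k, j)\<bar>) powr s) = ?W i"
      by (simp add: i weighted_term_def powr_mult powr_powr max_absorb2 mult.commute[of \<mu>])
  qed
  also have "\<dots> \<le> infsum ?W UNIV"
    using assms(3) W by (intro finite_sum_le_infsum summ) auto
  also have "\<dots> = (infsum ?W UNIV powr (1 / s)) powr s"
    using assms(4) W by (simp add: powr_powr infsum_nonneg)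
  also have "\<dots> \<le> 1 powr s"
    using assms(2,4) by (intro powr_mono2) (auto simp: L_norm_def)
  finally show ?thesis by simp
qed

text \<open>The Hoelder weight \<open>u = k powr (- 1 - a) * j powr (- 1 - a2)\<close> is chosen so that the weighted
  derivative bound equals \<open>(k powr a * j powr a2) powr (- 1 / s) * u powr (1 - 1 / s)\<close>, whose first
  factor is controlled by \<open>n\<close> alone outside the hyperbolic cross when \<open>\<gamma> a \<le> a2\<close>.\<close>
lemma truncation_tail:
  fixes r1 r2 :: nat and s \<mu> \<gamma> U :: real
  defines "a \<equiv> \<mu> - 2 * real r1 + 1 / s - 3 / 2" and "a2 \<equiv> \<mu> - 2 * real r2 + 1 / s - 3 / 2"
  assumes "s \<ge> 1" "a > 0" "\<gamma> * a \<le> a2" "n \<ge> 1" "U > 0"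
    and f: "f \<in> L_class s \<mu>" "L_norm s \<mu> f \<le> 1" and F: "finite F" "F \<subseteq> hyp_out n \<gamma>"
    and U: "(\<Sum>(k, j)\<in>F. real k powr (- 1 - a) * real j powr (- 1 - a2)) \<le> U"
  shows "(\<Sum>i\<in>F. \<bar>coef f i\<bar> * dweight r1 r2 i) \<le> n powr (- a * (1 / s)) * U powr (1 - 1 / s)"
proof -
  define \<theta> where "\<theta> = 1 - 1 / s"
  have \<theta>: "0 \<le> \<theta>" "\<theta> \<le> 1" using assms(3) by (auto simp: \<theta>_def)
  define b where "b = (\<lambda>(k, j). (real k * real j) powr \<mu> * \<bar>coef f (k, j)\<bar>)"
  define u where "u = (\<lambda>(k, j). real k powr (- 1 - a) * real j powr (- 1 - a2))"
  \<comment> \<open>This is \<open>dweight\<close> divided by (k j)^\<mu>: the exponent - a -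
    \<theta> equals 2 r1 + 1/2 - \<mu>, and likewise for a2 and r2.\<close>
  define v where "v = (\<lambda>(k, j). real k powr (- a - \<theta>) * real j powr (- a2 - \<theta>))"
  have F1: "1 \<le> k \<and> 1 \<le> j \<and> n < real k * real j powr \<gamma>" if "(k, j) \<in> F" for k j
    using that F(2) by (auto simp: hyp_out_def)
  have eq: "\<bar>coef f i\<bar> * dweight r1 r2 i = b i * v i" if "i \<in> F" for i
  proof -
    obtain k j where i: "i = (k, j)" by fastforce
    then have kj: "1 \<le> k" "1 \<le> j" using F1[of k j] that by auto
    have "real k powr (2 * real r1 + 1 / 2) = real k powr \<mu> * real k powr (- a - \<theta>)"
      unfolding powr_add[symmetric] by (rule arg_cong) (simp add: a_def \<theta>_def)
    moreover have "real j powr (2 * real r2 + 1 / 2) = real j powr \<mu> * real j powr (- a2 - \<theta>)"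
      unfolding powr_add[symmetric] by (rule arg_cong) (simp add: a2_def \<theta>_def)
    ultimately show ?thesis
      by (simp add: i b_def v_def dweight_def powr_mult)
  qed
  have "(\<Sum>i\<in>F. \<bar>coef f i\<bar> * dweight r1 r2 i) = (\<Sum>i\<in>F. b i * v i)"
    using eq by (rule sum.cong[OF refl])
  also have "\<dots> \<le> n powr (- a * (1 / s)) * 1 * U powr (1 - 1 / s)"
  proof (rule holder_weighted_sum[where u = u, OF F(1) assms(3)])
    show "(\<Sum>i\<in>F. b i powr s) \<le> 1 powr s"
      using L_class_sum_le[OF f F(1) assms(3)] F1 by (simp add: b_def split_def)
    show "(\<Sum>i\<in>F. u i) \<le> U" using U by (simp add: u_def)
    fix i assume "i \<in> F"
    moreover obtain k j where i: "i = (k, j)" by fastforce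
    ultimately have kj: "1 \<le> k" "1 \<le> j" "n < real k * real j powr \<gamma>" using F1[of k j] by auto
    show "0 \<le> b i" by (simp add: b_def split_def)
    show "0 < u i" using kj by (simp add: u_def i)
    have "v i = (real k powr (- a * (1 / s)) * real j powr (- a2 * (1 / s))) * u i powr (1 - 1 / s)"
    proof -
      have "real k powr (- a - \<theta>) = real k powr (- a * (1 / s)) * real k powr ((- 1 - a) * \<theta>)"
        unfolding powr_add[symmetric] by (rule arg_cong) (simp add: \<theta>_def algebra_simps)
      moreover have "real j powr (- a2 - \<theta>) = real j powr (- a2 * (1 / s)) * real j powr ((- 1 - a2) * \<theta>)"
        unfolding powr_add[symmetric] by (rule arg_cong) (simp add: \<theta>_def algebra_simps)
      ultimately show ?thesis
        using kj by (simp add: v_def u_def i powr_mult powr_powr flip: \<theta>_def)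
    qed
    also have "\<dots> \<le> n powr (- a * (1 / s)) * u i powr (1 - 1 / s)"
    proof (rule mult_right_mono)
      \<comment> \<open>Replacing a2 by the smaller \<gamma> a makes the product a power of k
        j^\<gamma>, which exceeds n.\<close>
      have "real j powr (- a2 * (1 / s)) \<le> real j powr (- (\<gamma> * a) * (1 / s))"
        using kj assms(3,5) by (intro powr_mono mult_right_mono) auto
      then have "real k powr (- a * (1 / s)) * real j powr (- a2 * (1 / s))
          \<le> real k powr (- a * (1 / s)) * real j powr (- (\<gamma> * a) * (1 / s))"
        by (rule mult_left_mono) simp
      also have "\<dots> = (real k * real j powr \<gamma>) powr (- a * (1 / s))"
        using kj by (simp add: powr_mult powr_powr)
      also have "\<dots> \<le> n powr (- a * (1 / s))"
        using kj assms(3,4,6) by (intro powr_mono2') (auto simp: divide_nonneg_pos)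
      finally show "real k powr (- a * (1 / s)) * real j powr (- a2 * (1 / s)) \<le> n powr (- a * (1 / s))" .
    qed simp
    finally show "v i \<le> n powr (- a * (1 / s)) * u i powr (1 - 1 / s)" .
  qed (use assms(6,7) in auto)
  finally show ?thesis by simp
qed

text \<open>By r2 \<le> r1 and \<gamma> \<ge> 1 the exponent of j is at most \<gamma> (2 r1 + 1/2),
  so the weight is dominated by a power of k j^\<gamma> \<le> n.\<close>

lemma dweight_Gam_le:
  assumes "1 \<le> r2" "r2 \<le> r1" "1 \<le> \<gamma>" "i \<in> Gam r1 r2 n \<gamma>"
  shows "dweight r1 r2 i \<le> n powr (2 * real r1 + 1 / 2)"
proof -
  obtain k j where i: "i = (k, j)" by fastforce
  with assms have kj: "k \<ge> 1" "j \<ge> 1" "real k * real j powr \<gamma> \<le> n" by (auto simp: Gam_def)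
  have "2 * real r2 + 1 / 2 \<le> \<gamma> * (2 * real r1 + 1 / 2)"
  proof -
    have "2 * real r2 + 1 / 2 \<le> 1 * (2 * real r1 + 1 / 2)" using assms by simp
    also have "\<dots> \<le> \<gamma> * (2 * real r1 + 1 / 2)" using assms by (intro mult_right_mono) auto
    finally show ?thesis .
  qed
  then have "dweight r1 r2 i \<le> real k powr (2 * real r1 + 1 / 2) * real j powr (\<gamma> * (2 * real r1 + 1 / 2))"
    unfolding dweight_def i split_conv using kj by (intro mult_left_mono powr_mono) auto
  also have "\<dots> = (real k * real j powr \<gamma>) powr (2 * real r1 + 1 / 2)"
    using kj by (simp add: powr_mult powr_powr)
  also have "\<dots> \<le> n powr (2 * real r1 + 1 / 2)"
    using kj by (intro powr_mono2) auto
  finally show ?thesis .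
qed

section \<open>The lower bound\<close>

text \<open>Exact data are admissible, and both functions give zero data on \<open>\<Omega>\<close>.
  The method therefore returns one value for both; according to its sign, it misses \<open>f\<close>
  or \<open>g\<close> at \<open>x\<close> by at least the stated amount.\<close>

lemma recovery_error_ge:
  assumes f: "f \<in> L_class s \<mu>" "L_norm s \<mu> f \<le> 1" and g: "g \<in> L_class s \<mu>" "L_norm s \<mu> g \<le> 1"
    and vanish: "\<And>i. i \<in> \<Omega> \<Longrightarrow> coef f i = 0" "\<And>i. i \<in> \<Omega> \<Longrightarrow> coef g i = 0"
    and x: "x \<in> square" and neg: "mixed_deriv r1 r2 g x = - mixed_deriv r1 r2 f x"
    and p: "1 \<le> p"
  shows "ennreal (mixed_deriv r1 r2 f x) \<le> recovery_error r1 r2 s \<mu> p \<delta> \<Omega> \<psi>"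
proof -
  let ?E = "recovery_error r1 r2 s \<mu> p \<delta> \<Omega> \<psi>"
  define y where "y = \<psi> (\<lambda>i\<in>\<Omega>. 0) x"
  have *: "ennreal \<bar>mixed_deriv r1 r2 h x - y\<bar> \<le> ?E"
    if h: "h \<in> L_class s \<mu>" "L_norm s \<mu> h \<le> 1" "\<And>i. i \<in> \<Omega> \<Longrightarrow> coef h i = 0" for h
  proof -
    have zero: "lp_norm p (\<lambda>i. 0) = 0"
      by (simp add: lp_norm_def)
    have a: "coef h \<in> perturbed_data p \<delta> h"
      by (simp add: perturbed_data_def zero)
    have "restrict (coef h) \<Omega> = (\<lambda>i\<in>\<Omega>. 0)" using h(3) by (auto simp: restrict_def fun_eq_iff)
    then have "ennreal \<bar>mixed_deriv r1 r2 h x - y\<bar> \<le>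
        C_norm (\<lambda>x. mixed_deriv r1 r2 h x - \<psi> (restrict (coef h) \<Omega>) x)"
      unfolding C_norm_def y_def by (intro SUP_upper2[OF x]) simp
    also have "\<dots> \<le> ?E"
      unfolding recovery_error_def using h a by (intro SUP_upper2[of h] SUP_upper2[OF a]) auto
    finally show ?thesis .
  qed
  show ?thesis
  proof (cases "y \<le> 0")
    case True
    then have "ennreal (mixed_deriv r1 r2 f x) \<le> ennreal \<bar>mixed_deriv r1 r2 f x - y\<bar>"
      by (intro ennreal_leI) simp
    then show ?thesis using *[OF f vanish(1)] by (rule order_trans)
  next
    case False
    then have "ennreal (mixed_deriv r1 r2 f x) \<le> ennreal \<bar>mixed_deriv r1 r2 g x - y\<bar>"
      by (intro ennreal_leI) (simp add: neg)
    then show ?thesis using *[OF g vanish(2)] by (rule order_trans)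
  qed
qed

text \<open>Among the \<open>2 N\<close> frequencies \<open>k\<close> in an interval at scale \<open>N\<close>, at least \<open>N\<close> of the pairs
  \<open>(k, 2 r\<^sub>2)\<close> are invisible to the information on \<open>\<Omega>\<close>; the fooling function spreads its mass evenly
  over them.\<close>
lemma min_radius_ge:
  assumes "1 \<le> s" "1 \<le> p" "1 \<le> r1" "1 \<le> r2" "\<mu> > 0"
  shows "\<exists>c>0. \<forall>N\<ge>1. \<forall>\<delta>.
    ennreal (c * real N powr (- \<mu> + 2 * real r1 - 1 / s + 3 / 2)) \<le> min_radius r1 r2 s \<mu> p N \<delta>"
proof -
  obtain e where e: "e > 0" "\<And>k. k \<ge> 2 * r1 \<Longrightarrow> (deriv ^^ r1) (legendre k) 1 \<ge> e * real k powr (2 * real r1 + 1 / 2)"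
    using legendre_deriv_lower[of r1] by blast
  \<comment> \<open>The fixed second frequency lies in the range of
    \<open>legendre_deriv_lower\<close>, so its derivative at 1 is positive.\<close>
  define m where "m = 2 * r2"
  have m: "m \<ge> 1" "r2 \<le> m" using assms by (auto simp: m_def)
  define d where "d = (deriv ^^ r2) (legendre m) 1"
  have d: "d > 0"
  proof -
    obtain e' where e': "e' > 0" "\<And>k. k \<ge> 2 * r2 \<Longrightarrow> (deriv ^^ r2) (legendre k) 1 \<ge> e' * real k powr (2 * real r2 + 1 / 2)"
      using legendre_deriv_lower[of r2] by blast
    have "0 < e' * real m powr (2 * real r2 + 1 / 2)" using e' m by simp
    also have "\<dots> \<le> d" using e'(2)[of m] by (simp add: d_def m_def)
    finally show ?thesis .
  qed
  \<comment> \<open>All frequencies in \<open>K\<close> are at most A N, since M + 2 N = (2 r1 + 2)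
    N.\<close>
  define A where "A = real (2 * r1 + 2)"
  have A: "A > 0" by (simp add: A_def)
  \<comment> \<open>Normalises the ridge: at most 2 N terms, each with weight at most (A N m)^(s
    \<mu>), then sum to at most 1.\<close>
  define \<kappa> where "\<kappa> = (2 * (A * real m) powr (s * \<mu>)) powr (- (1 / s))"
  have \<kappa>: "\<kappa> > 0" using A m by (simp add: \<kappa>_def)
  have \<kappa>s: "2 * (A * real m) powr (s * \<mu>) * \<kappa> powr s = 1"
  proof -
    have "\<kappa> powr s = (2 * (A * real m) powr (s * \<mu>)) powr (- 1)"
      unfolding \<kappa>_def powr_powr using assms(1) by simp
    then show ?thesis using A m by (simp add: powr_minus_divide)
  qed
  define c where "c = \<kappa> * e * d"
  have "ennreal (c * real N powr (- \<mu> + 2 * real r1 - 1 / s + 3 / 2))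
      \<le> recovery_error r1 r2 s \<mu> p \<delta> \<Omega> \<psi>"
    if N: "N \<ge> 1" and \<Omega>: "finite \<Omega>" "card \<Omega> \<le> N" for N \<delta> \<Omega> \<psi>
  proof -
    \<comment> \<open>Every k \<ge> M satisfies both k \<ge> 2 r1, as the derivative bound requires,
      and k \<ge> N.\<close>
    define M where "M = 2 * r1 * N"
    have M: "M \<ge> N" "M \<ge> 2 * r1" "M \<ge> 1" "r1 \<le> M" using N assms(3) by (auto simp: M_def)
    define K where "K = {k \<in> {M..<M + 2 * N}. (k, m) \<notin> \<Omega>}"
    have K: "finite K" "\<And>k. k \<in> K \<Longrightarrow> M \<le> k \<and> k < M + 2 * N" by (auto simp: K_def)
    have cardK: "N \<le> card K" "card K \<le> 2 * N"
    proof -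
      have "card {k \<in> {M..<M + 2 * N}. (k, m) \<in> \<Omega>} \<le> card (fst ` \<Omega>)"
        using \<Omega>(1) by (intro card_mono) force+
      also have "\<dots> \<le> N" using card_image_le[OF \<Omega>(1)] \<Omega>(2) by (rule order_trans)
      finally have 1: "card {k \<in> {M..<M + 2 * N}. (k, m) \<in> \<Omega>} \<le> N" .
      have "{M..<M + 2 * N} = K \<union> {k \<in> {M..<M + 2 * N}. (k, m) \<in> \<Omega>}" by (auto simp: K_def)
      then have "card {M..<M + 2 * N} \<le> card K + card {k \<in> {M..<M + 2 * N}. (k, m) \<in> \<Omega>}"
        by (metis card_Un_le)
      then show "N \<le> card K" using 1 by simp
      have "card K \<le> card {M..<M + 2 * N}" by (intro card_mono) (auto simp: K_def)
      then show "card K \<le> 2 * N" by simp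
    qed
    define b where "b = \<kappa> * real N powr (- \<mu> - 1 / s)"
    have b: "b > 0" using \<kappa> N by (simp add: b_def)
    have norm: "L_norm s \<mu> (ridge K m c') \<le> 1" if "\<bar>c'\<bar> = b" for c'
    proof -
      have "(\<Sum>k\<in>K. (real (max 1 k) * real (max 1 m)) powr (s * \<mu>) * \<bar>c'\<bar> powr s)
          \<le> (\<Sum>k\<in>K. (A * real N * real m) powr (s * \<mu>) * b powr s)"
      proof (rule sum_mono)
        fix k assume "k \<in> K"
        have "(2 * r1 + 2) * N = M + 2 * N" by (simp add: M_def algebra_simps)
        then have "k \<ge> 1" "k \<le> (2 * r1 + 2) * N" using K(2)[OF \<open>k \<in> K\<close>] M by linarith+
        then have "real (max 1 k) * real (max 1 m) \<le> A * real N * real m"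
          using m unfolding A_def of_nat_mult[symmetric] of_nat_le_iff
          by (intro mult_mono) auto
        then show "(real (max 1 k) * real (max 1 m)) powr (s * \<mu>) * \<bar>c'\<bar> powr s
            \<le> (A * real N * real m) powr (s * \<mu>) * b powr s"
          unfolding that using assms by (intro mult_right_mono powr_mono2) auto
      qed
      also have "\<dots> = real (card K) * ((A * real N * real m) powr (s * \<mu>) * b powr s)" by simp
      also have "\<dots> \<le> real (2 * N) * ((A * real N * real m) powr (s * \<mu>) * b powr s)"
        using cardK(2) by (intro mult_right_mono) (auto simp del: of_nat_mult)
      also have "\<dots> = (2 * (A * real m) powr (s * \<mu>) * \<kappa> powr s) *
          (real N powr 1 * real N powr (s * \<mu>) * real N powr ((- \<mu> - 1 / s) * s))"
        using A m N \<kappa> by (simp add: b_def powr_mult powr_powr)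
      also have "real N powr 1 * real N powr (s * \<mu>) * real N powr ((- \<mu> - 1 / s) * s) = 1"
      proof -
        have "1 + s * \<mu> + (- \<mu> - 1 / s) * s = 0" using assms(1) by (simp add: field_simps)
        then show ?thesis using N unfolding powr_add[symmetric] by simp
      qed
      finally have "(\<Sum>k\<in>K. (real (max 1 k) * real (max 1 m)) powr (s * \<mu>) * \<bar>c'\<bar> powr s) \<le> 1"
        using \<kappa>s by simp
      then have "(\<Sum>k\<in>K. (real (max 1 k) * real (max 1 m)) powr (s * \<mu>) * \<bar>c'\<bar> powr s) powr (1 / s) \<le> 1 powr (1 / s)"
        using assms(1) by (intro powr_mono2) (auto intro!: sum_nonneg)
      then show ?thesis using assms(1) K(1) by (simp add: L_norm_ridge)
    qed
    have md: "mixed_deriv r1 r2 (ridge K m c') (1, 1) = c' * (\<Sum>k\<in>K. (deriv ^^ r1) (legendre k) 1) * d" for c'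
      using K M m unfolding d_def by (intro mixed_deriv_ridge) force+
    have "c * real N powr (- \<mu> + 2 * real r1 - 1 / s + 3 / 2) =
        b * (real N * (e * real N powr (2 * real r1 + 1 / 2))) * d"
    proof -
      have "real N powr (- \<mu> + 2 * real r1 - 1 / s + 3 / 2) =
          real N powr ((- \<mu> - 1 / s) + 1 + (2 * real r1 + 1 / 2))" by (rule arg_cong) simp
      also have "\<dots> = real N powr (- \<mu> - 1 / s) * real N * real N powr (2 * real r1 + 1 / 2)"
        unfolding powr_add by simp
      finally show ?thesis by (simp add: b_def c_def)
    qed
    also have "\<dots> \<le> b * (\<Sum>k\<in>K. (deriv ^^ r1) (legendre k) 1) * d"
    proof (intro mult_right_mono mult_left_mono)
      have "real N * (e * real N powr (2 * real r1 + 1 / 2)) \<le> real (card K) * (e * real N powr (2 * real r1 + 1 / 2))"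
        using cardK e by (intro mult_right_mono) auto
      also have "\<dots> = (\<Sum>k\<in>K. e * real N powr (2 * real r1 + 1 / 2))" by simp
      also have "\<dots> \<le> (\<Sum>k\<in>K. (deriv ^^ r1) (legendre k) 1)"
      proof (rule sum_mono)
        fix k assume "k \<in> K"
        then have k: "N \<le> k" "2 * r1 \<le> k" using K(2)[of k] M by linarith+
        have "e * real N powr (2 * real r1 + 1 / 2) \<le> e * real k powr (2 * real r1 + 1 / 2)"
          using k e by (intro mult_left_mono powr_mono2) auto
        also have "\<dots> \<le> (deriv ^^ r1) (legendre k) 1" using e k by blast
        finally show "e * real N powr (2 * real r1 + 1 / 2) \<le> (deriv ^^ r1) (legendre k) 1" .
      qed
      finally show "real N * (e * real N powr (2 * real r1 + 1 / 2)) \<le> (\<Sum>k\<in>K. (deriv ^^ r1) (legendre k) 1)" .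
    qed (use b d in auto)
    also have "\<dots> = mixed_deriv r1 r2 (ridge K m b) (1, 1)" by (simp add: md)
    finally have "ennreal (c * real N powr (- \<mu> + 2 * real r1 - 1 / s + 3 / 2))
        \<le> ennreal (mixed_deriv r1 r2 (ridge K m b) (1, 1))" by (rule ennreal_leI)
    also have "\<dots> \<le> recovery_error r1 r2 s \<mu> p \<delta> \<Omega> \<psi>"
    proof (rule recovery_error_ge[where g = "ridge K m (- b)"])
      show "coef (ridge K m b) i = 0" "coef (ridge K m (- b)) i = 0" if "i \<in> \<Omega>" for i
        using that K(1) by (cases i; auto simp: coef_ridge K_def)+
    qed (use assms b K norm in \<open>auto simp: md square_def intro!: ridge_in_L_class\<close>)
    finally show ?thesis .
  qed
  then have "ennreal (c * real N powr (- \<mu> + 2 * real r1 - 1 / s + 3 / 2)) \<le> min_radius r1 r2 s \<mu> p N \<delta>"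
    if "N \<ge> 1" for N \<delta>
    unfolding min_radius_def using that by (intro INF_greatest) auto
  moreover have "c > 0" using \<kappa> e d by (simp add: c_def)
  ultimately show ?thesis by blast
qed

section \<open>Convergence rates\<close>

text \<open>The parameter \<open>\<l>\<close> stands for the logarithmic loss, which enters the tail
  sum and the cardinality alike, so one estimate serves \<gamma> > 1 and \<gamma> = 1.\<close>

lemma recovery_error_truncation:
  fixes r1 r2 :: nat and s \<mu> \<gamma> C1 C2 :: real and p :: ennreal
  defines "a \<equiv> \<mu> - 2 * real r1 + 1 / s - 3 / 2" and "a2 \<equiv> \<mu> - 2 * real r2 + 1 / s - 3 / 2"
  assumes "1 \<le> s" "1 \<le> p" "1 \<le> r2" "r2 \<le> r1" "a > 0" "1 \<le> \<gamma>" "\<gamma> * a \<le> a2" "C1 > 0" "C2 > 0"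
  shows "\<exists>C>0. \<forall>n \<l> \<delta>. 1 \<le> n \<longrightarrow> 1 \<le> \<l> \<longrightarrow> 0 < \<delta> \<longrightarrow>
     (\<forall>F. finite F \<longrightarrow> F \<subseteq> hyp_out n \<gamma> \<longrightarrow>
        (\<Sum>(k, j)\<in>F. real k powr (- 1 - a) * real j powr (- 1 - a2)) \<le> C1 * n powr (- a) * \<l>) \<longrightarrow>
     real (card (Gam r1 r2 n \<gamma>)) \<le> C2 * n * \<l> \<longrightarrow>
     recovery_error r1 r2 s \<mu> p \<delta> (Gam r1 r2 n \<gamma>) (truncation r1 r2 n \<gamma>)
       \<le> ennreal (C * (n powr (- a) * \<l> powr (1 - 1 / s) +
            \<delta> * n powr (2 * real r1 + 3 / 2 - recip_exp p) * \<l> powr (1 - recip_exp p)))"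
proof -
  obtain K1 where K1: "K1 > 0" "\<And>k x. k \<ge> 1 \<Longrightarrow> x \<in> {-1..1} \<Longrightarrow>
      \<bar>(deriv ^^ r1) (legendre k) x\<bar> \<le> K1 * real k powr (2 * real r1 + 1 / 2)"
    using legendre_deriv_upper[of r1] by blast
  obtain K2 where K2: "K2 > 0" "\<And>k x. k \<ge> 1 \<Longrightarrow> x \<in> {-1..1} \<Longrightarrow>
      \<bar>(deriv ^^ r2) (legendre k) x\<bar> \<le> K2 * real k powr (2 * real r2 + 1 / 2)"
    using legendre_deriv_upper[of r2] by blast
  define C where "C = K1 * K2 * (C1 powr (1 - 1 / s) + C2 powr (1 - recip_exp p))"
  have "recovery_error r1 r2 s \<mu> p \<delta> (Gam r1 r2 n \<gamma>) (truncation r1 r2 n \<gamma>)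
       \<le> ennreal (C * (n powr (- a) * \<l> powr (1 - 1 / s) +
            \<delta> * n powr (2 * real r1 + 3 / 2 - recip_exp p) * \<l> powr (1 - recip_exp p)))"
    if n: "1 \<le> n" and \<l>: "1 \<le> \<l>" and \<delta>: "0 < \<delta>"
      and tail: "\<And>F. finite F \<Longrightarrow> F \<subseteq> hyp_out n \<gamma> \<Longrightarrow>
        (\<Sum>(k, j)\<in>F. real k powr (- 1 - a) * real j powr (- 1 - a2)) \<le> C1 * n powr (- a) * \<l>"
      and card: "real (card (Gam r1 r2 n \<gamma>)) \<le> C2 * n * \<l>" for n \<l> \<delta>
  proof -
    define x where "x = n powr (- a) * \<l> powr (1 - 1 / s)"
    define y where "y = \<delta> * n powr (2 * real r1 + 3 / 2 - recip_exp p) * \<l> powr (1 - recip_exp p)"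
    have pos: "x \<ge> 0" "y \<ge> 0" using \<delta> by (auto simp: x_def y_def)
    have r: "1 \<le> r1" "1 \<le> r2" using assms(5,6) by auto
    have fin: "finite (Gam r1 r2 n \<gamma>)" using r assms(8) n by (rule Gam_card)
    \<comment> \<open>The factor n^(-a/s) of \<open>truncation_tail\<close> and the power 1 - 1/s of
      the tail sum recombine to n^(-a).\<close>
    have T: "n powr (- a * (1 / s)) * (C1 * n powr (- a) * \<l>) powr (1 - 1 / s) = C1 powr (1 - 1 / s) * x"
    proof -
      have "n powr (- a) = n powr (- a * (1 / s) + (- a) * (1 - 1 / s))"
        by (rule arg_cong) (simp add: algebra_simps)
      also have "\<dots> = n powr (- a * (1 / s)) * (n powr (- a)) powr (1 - 1 / s)"
        unfolding powr_add powr_powr ..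
      finally show ?thesis using assms(10) n \<l> by (simp add: x_def powr_mult)
    qed
    have E: "n powr (2 * real r1 + 1 / 2) * \<delta> * (C2 * n * \<l>) powr (1 - recip_exp p)
        = C2 powr (1 - recip_exp p) * y"
    proof -
      have "n powr (2 * real r1 + 3 / 2 - recip_exp p) = n powr ((2 * real r1 + 1 / 2) + (1 - recip_exp p))"
        by (rule arg_cong) simp
      also have "\<dots> = n powr (2 * real r1 + 1 / 2) * n powr (1 - recip_exp p)"
        by (rule powr_add)
      finally show ?thesis using assms(11) n \<l> by (simp add: y_def powr_mult)
    qed
    have "recovery_error r1 r2 s \<mu> p \<delta> (Gam r1 r2 n \<gamma>) (truncation r1 r2 n \<gamma>)
        \<le> ennreal (K1 * K2 * (C1 powr (1 - 1 / s) * x + C2 powr (1 - recip_exp p) * y))"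
    proof (rule recovery_error_le[OF r fin K1 K2])
      fix f F assume f: "f \<in> L_class s \<mu>" "L_norm s \<mu> f \<le> 1" and F: "finite F" "F \<subseteq> hyp_out n \<gamma>"
      show "(\<Sum>i\<in>F. \<bar>coef f i\<bar> * dweight r1 r2 i) \<le> C1 powr (1 - 1 / s) * x"
        unfolding T[symmetric] a_def
        by (rule truncation_tail[where ?r2.0 = r2 and \<gamma> = \<gamma>])
           (use assms n \<l> f F tail in \<open>auto simp: a_def a2_def\<close>)
    next
      fix \<xi> assume "lp_norm p \<xi> \<le> ennreal \<delta>"
      then show "(\<Sum>i\<in>Gam r1 r2 n \<gamma>. \<bar>\<xi> i\<bar> * dweight r1 r2 i) \<le> C2 powr (1 - recip_exp p) * y"
        unfolding E[symmetric] using assms n \<l> \<delta> fin card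
        by (intro lp_noise_sum dweight_Gam_le) auto
    qed
    also have "\<dots> \<le> ennreal (C * (x + y))"
    proof (rule ennreal_leI)
      have "C1 powr (1 - 1 / s) * x + C2 powr (1 - recip_exp p) * y
         \<le> (C1 powr (1 - 1 / s) + C2 powr (1 - recip_exp p)) * (x + y)"
        using pos by (simp add: algebra_simps)
      then show "K1 * K2 * (C1 powr (1 - 1 / s) * x + C2 powr (1 - recip_exp p) * y) \<le> C * (x + y)"
        unfolding C_def mult.assoc using K1 K2 by (intro mult_left_mono) auto
    qed
    finally show ?thesis by (simp only: x_def y_def)
  qed
  moreover have "C > 0" using K1 K2 assms(10,11) by (simp add: C_def add_pos_pos)
  ultimately show ?thesis by blast
qed

lemma eventually_ln_inverse_ge:
  "\<forall>\<^sub>F \<delta> in at_right (0::real). 0 < \<delta> \<and> X \<le> ln (1 / \<delta>)"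
proof -
  have "\<forall>\<^sub>F \<delta> in at_right (0::real). \<delta> \<in> {0<..<exp (- X)}"
    by (rule eventually_at_right_real) simp
  then show ?thesis
  proof eventually_elim
    case (elim \<delta>)
    then have "ln \<delta> \<le> ln (exp (- X))" by (subst ln_le_cancel_iff) auto
    with elim show ?case by (simp add: ln_div)
  qed
qed

locale recovery_setting =
  fixes s \<mu> :: real and p :: ennreal and r1 r2 :: nat
  assumes s: "1 \<le> s" and p: "1 \<le> p" and r2: "1 \<le> r2" and r21: "r2 \<le> r1"
    and smooth: "\<mu> > 2 * real r1 + 3 / 2 - 1 / s"
begin

definition \<alpha> :: real where "\<alpha> = \<mu> - 2 * real r1 + 1 / s - 3 / 2"
text \<open>Equals \<alpha> plus the exponent of n in the noise term; without logarithms the two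
  errors balance when \<delta> n^D is of order 1.\<close>

definition D :: real where "D = \<mu> - recip_exp p + 1 / s"

lemma \<alpha>_pos: "\<alpha> > 0" using smooth by (simp add: \<alpha>_def)

lemma r1: "1 \<le> r1" using r2 r21 by simp

lemma \<mu>_pos: "\<mu> > 0"
proof -
  have "1 / s \<le> 1" using s by simp
  then show ?thesis using smooth by linarith
qed

lemma D_pos: "D > 0"
proof -
  have "real r1 \<ge> 1" using r1 by simp
  then have "\<mu> + 1 / s > 2" using smooth by linarith
  then show ?thesis using recip_exp_bounds[OF p] by (simp add: D_def)
qed

lemma exponent: "2 * real r1 + 3 / 2 - recip_exp p - D = - \<alpha>"
  by (simp add: \<alpha>_def D_def)

lemma exponent': "- \<mu> + 2 * real r1 - 1 / s + 3 / 2 = - \<alpha>"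
  by (simp add: \<alpha>_def)

subsection \<open>Different orders of differentiation\<close>

definition scale :: "real \<Rightarrow> real" where "scale \<delta> = \<delta> powr (- (1 / D))"

lemma scale_powr: "\<delta> > 0 \<Longrightarrow> scale \<delta> powr (- \<alpha>) = \<delta> powr (\<alpha> / D)"
  and scale_D: "\<delta> > 0 \<Longrightarrow> \<delta> = scale \<delta> powr (- D)"
  using D_pos by (simp_all add: scale_def powr_powr)

lemma eventually_scale_ge: "\<forall>\<^sub>F \<delta> in at_right (0::real). 0 < \<delta> \<and> X \<le> scale \<delta>"
  using eventually_ln_inverse_ge[of "D * max 0 X"]
proof eventually_elim
  case (elim \<delta>)
  define L where "L = ln (1 / \<delta>)"
  have "D * max 0 X \<le> L" using elim unfolding L_def by blast
  then have "max 0 X \<le> 1 / D * L" by (metis D_pos mult.commute pos_le_divide_eq mult_1 times_divide_eq_left)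
  also have "\<dots> \<le> exp (1 / D * L)" using exp_ge_add_one_self[of "1 / D * L"] by linarith
  also have "\<dots> = scale \<delta>" using elim by (simp add: scale_def powr_def ln_div L_def)
  finally show ?case using elim by simp
qed

text \<open>No logarithm arises, so the general bound is used with \<open>\<l>\<close> = 1; at n of
  order \<open>scale \<delta>\<close> tail and noise have the same order.\<close>

lemma truncation_rate:
  assumes \<gamma>: "1 < \<gamma>" "\<gamma> * \<alpha> < \<mu> - 2 * real r2 + 1 / s - 3 / 2" and d: "d1 > 0" "d2 > 0"
  shows "\<exists>C>0. \<forall>\<^sub>F \<delta> in at_right 0. \<forall>n. comparable d1 d2 n (scale \<delta>) \<longrightarrow>
     finite (Gam r1 r2 n \<gamma>) \<and> recovery_error r1 r2 s \<mu> p \<delta> (Gam r1 r2 n \<gamma>) (truncation r1 r2 n \<gamma>)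
       \<le> ennreal (C * scale \<delta> powr (- \<alpha>))"
proof -
  define a2 where "a2 = \<mu> - 2 * real r2 + 1 / s - 3 / 2"
  have \<gamma>2: "\<gamma> * \<alpha> < a2" using \<gamma> by (simp add: a2_def)
  obtain C1 where C1: "C1 > 0" "\<And>n F. n \<ge> 1 \<Longrightarrow> finite F \<Longrightarrow> F \<subseteq> hyp_out n \<gamma> \<Longrightarrow>
      (\<Sum>(k, j)\<in>F. real k powr (- 1 - \<alpha>) * real j powr (- 1 - a2)) \<le> C1 * n powr (- \<alpha>)"
    using hyp_out_sum_gt[OF \<alpha>_pos \<gamma>2] by blast
  obtain C2 where C2: "C2 > 0" "\<And>n. n \<ge> 1 \<Longrightarrow> real (card (Gam r1 r2 n \<gamma>)) \<le> C2 * n"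
    using Gam_card_gt[OF \<gamma>(1)] r1 r2 by blast
  obtain C where C: "C > 0" "\<And>n \<l> \<delta>. 1 \<le> n \<Longrightarrow> 1 \<le> \<l> \<Longrightarrow> 0 < \<delta> \<Longrightarrow>
     (\<forall>F. finite F \<longrightarrow> F \<subseteq> hyp_out n \<gamma> \<longrightarrow>
        (\<Sum>(k, j)\<in>F. real k powr (- 1 - \<alpha>) * real j powr (- 1 - a2)) \<le> C1 * n powr (- \<alpha>) * \<l>) \<Longrightarrow>
     real (card (Gam r1 r2 n \<gamma>)) \<le> C2 * n * \<l> \<Longrightarrow>
     recovery_error r1 r2 s \<mu> p \<delta> (Gam r1 r2 n \<gamma>) (truncation r1 r2 n \<gamma>)
       \<le> ennreal (C * (n powr (- \<alpha>) * \<l> powr (1 - 1 / s) +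
            \<delta> * n powr (2 * real r1 + 3 / 2 - recip_exp p) * \<l> powr (1 - recip_exp p)))"
    using recovery_error_truncation[OF s p r2 r21, of \<mu> \<gamma> C1 C2] \<alpha>_pos \<gamma>(1) \<gamma>2 C1(1) C2(1)
    unfolding \<alpha>_def[symmetric] a2_def[symmetric] by auto
  define E where "E = 2 * real r1 + 3 / 2 - recip_exp p"
  have E: "E \<ge> 0" using recip_exp_bounds[OF p] by (simp add: E_def)
  define K where "K = C * (d1 powr (- \<alpha>) + d2 powr E)"
  have "\<forall>\<^sub>F \<delta> in at_right 0. \<forall>n. comparable d1 d2 n (scale \<delta>) \<longrightarrow>
     finite (Gam r1 r2 n \<gamma>) \<and> recovery_error r1 r2 s \<mu> p \<delta> (Gam r1 r2 n \<gamma>) (truncation r1 r2 n \<gamma>)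
       \<le> ennreal (K * scale \<delta> powr (- \<alpha>))"
    \<comment> \<open>Beyond 1 / d1 the lower comparison forces \<open>n \<ge> 1\<close>.\<close>
    using eventually_scale_ge[of "max 1 (1 / d1)"]
  proof (eventually_elim, intro allI impI)
    fix \<delta> n assume \<delta>: "0 < \<delta> \<and> max 1 (1 / d1) \<le> scale \<delta>" and "comparable d1 d2 n (scale \<delta>)"
    then have n: "d1 * scale \<delta> \<le> n" "n \<le> d2 * scale \<delta>" by (auto simp: comparable_def)
    have h: "scale \<delta> > 0" "1 \<le> d1 * scale \<delta>" using \<delta> d by (auto simp: field_simps)
    then have n1: "n \<ge> 1" using n by linarith
    have "finite (Gam r1 r2 n \<gamma>)" using r1 r2 \<gamma> n1 by (intro Gam_card) auto
    moreover have "recovery_error r1 r2 s \<mu> p \<delta> (Gam r1 r2 n \<gamma>) (truncation r1 r2 n \<gamma>)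
       \<le> ennreal (C * (n powr (- \<alpha>) * 1 powr (1 - 1 / s) + \<delta> * n powr E * 1 powr (1 - recip_exp p)))"
      unfolding E_def using C1 C2 n1 \<delta> by (intro C) auto
    moreover have "C * (n powr (- \<alpha>) * 1 powr (1 - 1 / s) + \<delta> * n powr E * 1 powr (1 - recip_exp p))
        \<le> K * scale \<delta> powr (- \<alpha>)"
    proof -
      have "n powr (- \<alpha>) \<le> (d1 * scale \<delta>) powr (- \<alpha>)"
        using n h \<alpha>_pos by (intro powr_mono2') auto
      also have "\<dots> = d1 powr (- \<alpha>) * scale \<delta> powr (- \<alpha>)" using d h by (simp add: powr_mult)
      finally have 1: "n powr (- \<alpha>) \<le> d1 powr (- \<alpha>) * scale \<delta> powr (- \<alpha>)" .
      have "\<delta> * n powr E \<le> \<delta> * (d2 * scale \<delta>) powr E"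
        using n n1 \<delta> E by (intro mult_left_mono powr_mono2) auto
      also have "\<dots> = d2 powr E * (scale \<delta> powr E * scale \<delta> powr (- D))"
        using d h \<delta> scale_D[of \<delta>] by (simp add: powr_mult)
      also have "scale \<delta> powr E * scale \<delta> powr (- D) = scale \<delta> powr (- \<alpha>)"
        unfolding powr_add[symmetric] using exponent by (simp add: E_def)
      finally have "\<delta> * n powr E \<le> d2 powr E * scale \<delta> powr (- \<alpha>)" .
      with 1 have "n powr (- \<alpha>) + \<delta> * n powr E \<le> (d1 powr (- \<alpha>) + d2 powr E) * scale \<delta> powr (- \<alpha>)"
        by (simp add: algebra_simps)
      then have "C * (n powr (- \<alpha>) + \<delta> * n powr E) \<le> C * ((d1 powr (- \<alpha>) + d2 powr E) * scale \<delta> powr (- \<alpha>))"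
        using C(1) by (intro mult_left_mono) auto
      then show ?thesis by (simp add: K_def mult.assoc)
    qed
    ultimately show "finite (Gam r1 r2 n \<gamma>) \<and> recovery_error r1 r2 s \<mu> p \<delta> (Gam r1 r2 n \<gamma>) (truncation r1 r2 n \<gamma>)
       \<le> ennreal (K * scale \<delta> powr (- \<alpha>))"
      by (meson ennreal_leI order_trans)
  qed
  moreover have "K > 0" using C d by (simp add: K_def add_pos_pos)
  ultimately show ?thesis by blast
qed

lemma scale_le_N:
  assumes "comparable c1 c2 (real N) (scale \<delta>)" "c1 > 0" "c2 > 0" "\<delta> > 0"
  shows "scale \<delta> powr (- \<alpha>) \<le> c2 powr \<alpha> * real N powr (- \<alpha>)"
    and "real N powr (- \<alpha>) \<le> c1 powr (- \<alpha>) * scale \<delta> powr (- \<alpha>)"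
    and "N \<ge> 1"
proof -
  have h: "scale \<delta> > 0" using assms(4) by (simp add: scale_def)
  have N: "c1 * scale \<delta> \<le> real N" "real N \<le> c2 * scale \<delta>" using assms(1) by (auto simp: comparable_def)
  have pos: "real N > 0" using N h assms(2) by (meson mult_pos_pos order_less_le_trans)
  then show "N \<ge> 1" by simp
  have "real N powr (- \<alpha>) \<ge> (c2 * scale \<delta>) powr (- \<alpha>)"
    using N pos \<alpha>_pos by (intro powr_mono2') auto
  then have "c2 powr \<alpha> * (c2 * scale \<delta>) powr (- \<alpha>) \<le> c2 powr \<alpha> * real N powr (- \<alpha>)"
    by (intro mult_left_mono) auto
  moreover have "c2 powr \<alpha> * c2 powr (- \<alpha>) = 1"
    unfolding powr_add[symmetric] using assms(3) by simp
  then have "c2 powr \<alpha> * (c2 * scale \<delta>) powr (- \<alpha>) = scale \<delta> powr (- \<alpha>)"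
    using h assms(3) by (simp add: powr_mult flip: mult.assoc)
  ultimately show "scale \<delta> powr (- \<alpha>) \<le> c2 powr \<alpha> * real N powr (- \<alpha>)" by simp
  have "real N powr (- \<alpha>) \<le> (c1 * scale \<delta>) powr (- \<alpha>)"
    using N h assms(2) \<alpha>_pos by (intro powr_mono2') auto
  then show "real N powr (- \<alpha>) \<le> c1 powr (- \<alpha>) * scale \<delta> powr (- \<alpha>)"
    using h assms(2) by (simp add: powr_mult)
qed

lemma truncation_implements_gt:
  assumes \<gamma>: "1 < \<gamma>" "\<gamma> * \<alpha> < \<mu> - 2 * real r2 + 1 / s - 3 / 2"
  shows "truncation_implements r1 r2 s \<mu> p \<gamma> scale scale
     {\<lambda>N \<delta>. real N powr (- \<alpha>), \<lambda>N \<delta>. \<delta> powr (\<alpha> / D)}"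
  unfolding truncation_implements_def
proof (intro allI impI)
  fix c1 c2 d1 d2 :: real
  assume pos: "c1 > 0" "c2 > 0" "d1 > 0" "d2 > 0"
  obtain C where C: "C > 0" and C': "\<forall>\<^sub>F \<delta> in at_right 0. \<forall>n. comparable d1 d2 n (scale \<delta>) \<longrightarrow>
     finite (Gam r1 r2 n \<gamma>) \<and> recovery_error r1 r2 s \<mu> p \<delta> (Gam r1 r2 n \<gamma>) (truncation r1 r2 n \<gamma>)
       \<le> ennreal (C * scale \<delta> powr (- \<alpha>))"
    using truncation_rate[OF \<gamma> pos(3,4)] by blast
  obtain C2 where C2: "C2 > 0" "\<And>n. n \<ge> 1 \<Longrightarrow> real (card (Gam r1 r2 n \<gamma>)) \<le> C2 * n"
    using Gam_card_gt[OF \<gamma>(1)] r1 r2 by blast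
  \<comment> \<open>One constant for the error in terms of \<delta>, the error in terms of N, and
    the cardinality.\<close>
  define K where "K = max C (max (C * c2 powr \<alpha>) (C2 * d2 / c1))"
  have "\<forall>\<^sub>F \<delta> in at_right 0. \<forall>(N::nat) (n::real). comparable c1 c2 (real N) (scale \<delta>) \<longrightarrow>
     comparable d1 d2 n (scale \<delta>) \<longrightarrow> finite (Gam r1 r2 n \<gamma>) \<and> real (card (Gam r1 r2 n \<gamma>)) \<le> K * real N \<and>
     (\<forall>B\<in>{\<lambda>N \<delta>. real N powr (- \<alpha>), \<lambda>N \<delta>. \<delta> powr (\<alpha> / D)}.
        recovery_error r1 r2 s \<mu> p \<delta> (Gam r1 r2 n \<gamma>) (truncation r1 r2 n \<gamma>) \<le> ennreal (K * B N \<delta>))"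
    using C' eventually_scale_ge[of "1 / d1"]
  proof (eventually_elim, intro allI impI)
    fix \<delta> n and N :: nat
    assume H: "\<forall>n. comparable d1 d2 n (scale \<delta>) \<longrightarrow> finite (Gam r1 r2 n \<gamma>) \<and>
        recovery_error r1 r2 s \<mu> p \<delta> (Gam r1 r2 n \<gamma>) (truncation r1 r2 n \<gamma>) \<le> ennreal (C * scale \<delta> powr (- \<alpha>))"
      and \<delta>: "0 < \<delta> \<and> 1 / d1 \<le> scale \<delta>"
      and N: "comparable c1 c2 (real N) (scale \<delta>)" and n: "comparable d1 d2 n (scale \<delta>)"
    let ?R = "recovery_error r1 r2 s \<mu> p \<delta> (Gam r1 r2 n \<gamma>) (truncation r1 r2 n \<gamma>)"
    have fin: "finite (Gam r1 r2 n \<gamma>)" and R: "?R \<le> ennreal (C * scale \<delta> powr (- \<alpha>))"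
      using H n by auto
    have "1 \<le> d1 * scale \<delta>" using \<delta> pos by (simp add: field_simps)
    then have n1: "n \<ge> 1" "n \<le> d2 * scale \<delta>" using n by (auto simp: comparable_def)
    have "real (card (Gam r1 r2 n \<gamma>)) \<le> C2 * n" by (rule C2(2)[OF n1(1)])
    also have "\<dots> \<le> C2 * (d2 * (real N / c1))"
    proof -
      have "scale \<delta> \<le> real N / c1" using N pos by (simp add: comparable_def field_simps)
      then have "d2 * scale \<delta> \<le> d2 * (real N / c1)" using pos by (intro mult_left_mono) auto
      then show ?thesis using C2(1) n1 by (intro mult_left_mono) auto
    qed
    also have "\<dots> = (C2 * d2 / c1) * real N" by simp
    also have "\<dots> \<le> K * real N" by (intro mult_right_mono) (auto simp: K_def)
    finally have card: "real (card (Gam r1 r2 n \<gamma>)) \<le> K * real N" .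
    have "C * scale \<delta> powr (- \<alpha>) \<le> C * c2 powr \<alpha> * real N powr (- \<alpha>)"
      using scale_le_N(1)[OF N pos(1,2)] \<delta> C by simp
    also have "\<dots> \<le> K * real N powr (- \<alpha>)" by (intro mult_right_mono) (auto simp: K_def)
    finally have "?R \<le> ennreal (K * real N powr (- \<alpha>))" using R by (meson ennreal_leI order_trans)
    moreover have "C * scale \<delta> powr (- \<alpha>) \<le> K * \<delta> powr (\<alpha> / D)"
      using scale_powr \<delta> by (simp add: K_def mult_right_mono)
    then have "?R \<le> ennreal (K * \<delta> powr (\<alpha> / D))" using R by (meson ennreal_leI order_trans)
    ultimately show "finite (Gam r1 r2 n \<gamma>) \<and> real (card (Gam r1 r2 n \<gamma>)) \<le> K * real N \<and>
     (\<forall>B\<in>{\<lambda>N \<delta>. real N powr (- \<alpha>), \<lambda>N \<delta>. \<delta> powr (\<alpha> / D)}. ?R \<le> ennreal (K * B N \<delta>))"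
      using fin card by simp
  qed
  moreover have "K > 0" using C by (simp add: K_def)
  ultimately show "\<exists>C>0. \<forall>\<^sub>F \<delta> in at_right 0. \<forall>(N::nat) (n::real). comparable c1 c2 (real N) (scale \<delta>) \<longrightarrow>
     comparable d1 d2 n (scale \<delta>) \<longrightarrow> finite (Gam r1 r2 n \<gamma>) \<and> real (card (Gam r1 r2 n \<gamma>)) \<le> C * real N \<and>
     (\<forall>B\<in>{\<lambda>N \<delta>. real N powr (- \<alpha>), \<lambda>N \<delta>. \<delta> powr (\<alpha> / D)}.
        recovery_error r1 r2 s \<mu> p \<delta> (Gam r1 r2 n \<gamma>) (truncation r1 r2 n \<gamma>) \<le> ennreal (C * B N \<delta>))"
    by blast
qed

lemma min_radius_gt:
  assumes "r2 < r1" and pos: "c1 > 0" "c2 > 0"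
  shows "\<exists>c>0. \<exists>C>0. \<forall>\<^sub>F \<delta> in at_right 0. \<forall>N::nat. comparable c1 c2 (real N) (scale \<delta>) \<longrightarrow>
     ecomparable c C (min_radius r1 r2 s \<mu> p N \<delta>) (real N powr (- \<alpha>)) \<and>
     comparable c C (real N powr (- \<alpha>)) (\<delta> powr (\<alpha> / D))"
proof -
  define a2 where "a2 = \<mu> - 2 * real r2 + 1 / s - 3 / 2"
  have a2: "\<alpha> < a2" using assms(1) by (simp add: \<alpha>_def a2_def)
  \<comment> \<open>The midpoint of the interval from 1 to a2 / \<alpha>, which is nonempty because
    r2 < r1.\<close>
  define \<gamma> where "\<gamma> = (1 + a2 / \<alpha>) / 2"
  have "\<gamma> * \<alpha> = (\<alpha> + a2) / 2" using \<alpha>_pos by (simp add: \<gamma>_def field_simps)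
  then have \<gamma>: "1 < \<gamma>" "\<gamma> * \<alpha> < \<mu> - 2 * real r2 + 1 / s - 3 / 2"
    unfolding a2_def[symmetric] using a2 \<alpha>_pos by (auto simp: \<gamma>_def)
  obtain C2 where C2: "C2 > 0" "\<And>n. n \<ge> 1 \<Longrightarrow> real (card (Gam r1 r2 n \<gamma>)) \<le> C2 * n"
    using Gam_card_gt[OF \<gamma>(1)] r1 r2 by blast
  \<comment> \<open>Chosen so that the cross at n = \<kappa> \<open>scale \<delta>\<close> has at
    most c1 \<open>scale \<delta>\<close>, hence at most N, points.\<close>
  define \<kappa> where "\<kappa> = c1 / C2"
  have \<kappa>: "\<kappa> > 0" using pos C2 by (simp add: \<kappa>_def)
  obtain C where C: "C > 0" and C': "\<forall>\<^sub>F \<delta> in at_right 0. \<forall>n. comparable \<kappa> \<kappa> n (scale \<delta>) \<longrightarrow>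
     finite (Gam r1 r2 n \<gamma>) \<and> recovery_error r1 r2 s \<mu> p \<delta> (Gam r1 r2 n \<gamma>) (truncation r1 r2 n \<gamma>)
       \<le> ennreal (C * scale \<delta> powr (- \<alpha>))"
    using truncation_rate[OF \<gamma> \<kappa> \<kappa>] by blast
  obtain c where c: "c > 0" "\<And>N \<delta>. N \<ge> 1 \<Longrightarrow> ennreal (c * real N powr (- \<alpha>)) \<le> min_radius r1 r2 s \<mu> p N \<delta>"
    using min_radius_ge[OF s p r1 r2 \<mu>_pos] unfolding exponent' by blast
  define c' where "c' = min c (c2 powr (- \<alpha>))"
  define K where "K = max (C * c2 powr \<alpha>) (c1 powr (- \<alpha>))"
  have "\<forall>\<^sub>F \<delta> in at_right 0. \<forall>N::nat. comparable c1 c2 (real N) (scale \<delta>) \<longrightarrow>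
     ecomparable c' K (min_radius r1 r2 s \<mu> p N \<delta>) (real N powr (- \<alpha>)) \<and>
     comparable c' K (real N powr (- \<alpha>)) (\<delta> powr (\<alpha> / D))"
    using C' eventually_scale_ge[of "1 / \<kappa>"]
  proof (eventually_elim, intro allI impI)
    fix \<delta> and N :: nat
    assume H: "\<forall>n. comparable \<kappa> \<kappa> n (scale \<delta>) \<longrightarrow> finite (Gam r1 r2 n \<gamma>) \<and>
        recovery_error r1 r2 s \<mu> p \<delta> (Gam r1 r2 n \<gamma>) (truncation r1 r2 n \<gamma>) \<le> ennreal (C * scale \<delta> powr (- \<alpha>))"
      and \<delta>: "0 < \<delta> \<and> 1 / \<kappa> \<le> scale \<delta>"
      and N: "comparable c1 c2 (real N) (scale \<delta>)"
    note N' = scale_le_N[OF N pos conjunct1[OF \<delta>]]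
    define n where "n = \<kappa> * scale \<delta>"
    have n: "n \<ge> 1" using \<delta> \<kappa> by (simp add: n_def field_simps)
    have fin: "finite (Gam r1 r2 n \<gamma>)"
      and R: "recovery_error r1 r2 s \<mu> p \<delta> (Gam r1 r2 n \<gamma>) (truncation r1 r2 n \<gamma>) \<le> ennreal (C * scale \<delta> powr (- \<alpha>))"
      using H by (auto simp: comparable_def n_def)
    have "real (card (Gam r1 r2 n \<gamma>)) \<le> C2 * n" by (rule C2(2)[OF n])
    also have "\<dots> = c1 * scale \<delta>" using C2(1) by (simp add: n_def \<kappa>_def)
    also have "\<dots> \<le> real N" using N by (simp add: comparable_def)
    finally have "card (Gam r1 r2 n \<gamma>) \<le> N" by simp
    from min_radius_le[OF fin this] R have "min_radius r1 r2 s \<mu> p N \<delta> \<le> ennreal (C * scale \<delta> powr (- \<alpha>))"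
      by (rule order_trans)
    also have "C * scale \<delta> powr (- \<alpha>) \<le> C * c2 powr \<alpha> * real N powr (- \<alpha>)"
      using N'(1) C by simp
    also have "\<dots> \<le> K * real N powr (- \<alpha>)" by (intro mult_right_mono) (auto simp: K_def)
    finally have up: "min_radius r1 r2 s \<mu> p N \<delta> \<le> ennreal (K * real N powr (- \<alpha>))"
      by (simp add: ennreal_leI)
    have "ennreal (c' * real N powr (- \<alpha>)) \<le> ennreal (c * real N powr (- \<alpha>))"
      by (intro ennreal_leI mult_right_mono) (auto simp: c'_def)
    also have "\<dots> \<le> min_radius r1 r2 s \<mu> p N \<delta>" by (rule c(2)[OF N'(3)])
    finally have low: "ennreal (c' * real N powr (- \<alpha>)) \<le> min_radius r1 r2 s \<mu> p N \<delta>" .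
    have "c' * scale \<delta> powr (- \<alpha>) \<le> c2 powr (- \<alpha>) * scale \<delta> powr (- \<alpha>)"
      by (intro mult_right_mono) (auto simp: c'_def)
    also have "\<dots> \<le> c2 powr (- \<alpha>) * (c2 powr \<alpha> * real N powr (- \<alpha>))"
      by (intro mult_left_mono N') auto
    also have "\<dots> = real N powr (- \<alpha>)"
      using pos unfolding mult.assoc[symmetric] powr_add[symmetric] by simp
    finally have 1: "c' * scale \<delta> powr (- \<alpha>) \<le> real N powr (- \<alpha>)" .
    have "real N powr (- \<alpha>) \<le> c1 powr (- \<alpha>) * scale \<delta> powr (- \<alpha>)" by (rule N'(2))
    also have "\<dots> \<le> K * scale \<delta> powr (- \<alpha>)" by (intro mult_right_mono) (auto simp: K_def)
    finally show "ecomparable c' K (min_radius r1 r2 s \<mu> p N \<delta>) (real N powr (- \<alpha>)) \<and>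
        comparable c' K (real N powr (- \<alpha>)) (\<delta> powr (\<alpha> / D))"
      using up low 1 scale_powr[OF conjunct1[OF \<delta>]] by (simp add: ecomparable_def comparable_def)
  qed
  moreover have "c' > 0" "K > 0" using c pos by (auto simp: c'_def K_def less_max_iff_disj)
  ultimately show ?thesis by blast
qed

subsection \<open>Equal orders of differentiation\<close>

text \<open>With L = ln(1/\<delta>) in place of \<open>\<l>\<close>, the solution n of n^(-\<alpha>)
  L^(1 - 1/s) = \<delta> n^(D - \<alpha>) L^(1 - 1/p).\<close>

definition lscale :: "real \<Rightarrow> real" where
  "lscale \<delta> = (\<delta> / ln (1 / \<delta>) powr (recip_exp p - 1 / s)) powr (- (1 / D))"

definition Nscale :: "real \<Rightarrow> real" where
  "Nscale \<delta> = (\<delta> / ln (1 / \<delta>) powr \<mu>) powr (- (1 / D))"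

text \<open>The common value of the two error terms at n = \<open>lscale \<delta>\<close>.\<close>

definition rate :: "real \<Rightarrow> real" where
  "rate \<delta> = lscale \<delta> powr (- \<alpha>) * ln (1 / \<delta>) powr (1 - 1 / s)"

context
  fixes \<delta> L :: real
  assumes \<delta>: "\<delta> > 0" and L: "L \<ge> 1" and L_eq: "L = ln (1 / \<delta>)"
begin

lemma lscale_pos: "lscale \<delta> > 0"
  using \<delta> L by (simp add: lscale_def flip: L_eq)

lemma lscale_eq: "lscale \<delta> = \<delta> powr (- (1 / D)) * L powr ((recip_exp p - 1 / s) * (1 / D))"
  unfolding lscale_def L_eq[symmetric] by (rule powr_divide_powr_minus) (use \<delta> L in auto)

text \<open>Rests on \<mu> = D + 1/p - 1/s. It identifies the prescribed N with the size n L of the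
  cross for \<gamma> = 1.\<close>

lemma Nscale_eq: "Nscale \<delta> = lscale \<delta> * L"
proof -
  have "Nscale \<delta> = \<delta> powr (- (1 / D)) * L powr (\<mu> * (1 / D))"
    unfolding Nscale_def L_eq[symmetric] by (rule powr_divide_powr_minus) (use \<delta> L in auto)
  also have "\<mu> * (1 / D) = (recip_exp p - 1 / s) * (1 / D) + 1"
    using D_pos by (simp add: D_def field_simps)
  finally show ?thesis using L by (simp add: lscale_eq powr_add)
qed

lemma delta_eq: "\<delta> = lscale \<delta> powr (- D) * L powr (recip_exp p - 1 / s)"
  using D_pos \<delta> L by (simp add: lscale_def powr_powr flip: L_eq)

lemma lscale_powr: "(\<delta> * L powr (1 / s - recip_exp p)) powr (\<alpha> / D) = lscale \<delta> powr (- \<alpha>)"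
proof -
  have "\<delta> * L powr (1 / s - recip_exp p) = \<delta> / L powr (recip_exp p - 1 / s)"
    using powr_minus_divide[of L "recip_exp p - 1 / s"] by simp
  then show ?thesis by (simp add: lscale_def powr_powr flip: L_eq)
qed

lemma Nscale_powr: "(\<delta> / L powr \<mu>) powr (\<alpha> / D) = Nscale \<delta> powr (- \<alpha>)"
  by (simp add: Nscale_def powr_powr flip: L_eq)

lemma ln_lscale: "ln (lscale \<delta>) = L / D + (recip_exp p - 1 / s) * (1 / D) * ln L"
  unfolding lscale_eq using \<delta> L by (simp add: ln_mult ln_powr L_eq ln_div)

text \<open>The exponent 1/p - 1/s of L can have either sign, hence the absolute value; ln L \<le> L
  absorbs that term.\<close>

lemma ln_lscale_le: "ln (lscale \<delta>) \<le> (1 + \<bar>recip_exp p - 1 / s\<bar>) / D * L"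
proof -
  have "0 \<le> ln L" "ln L \<le> L" using L ln_le_minus_one[of L] by auto
  then have "(recip_exp p - 1 / s) * (1 / D) * ln L \<le> \<bar>recip_exp p - 1 / s\<bar> * (1 / D) * L"
    using D_pos by (intro mult_mono) (auto simp: divide_right_mono)
  then show ?thesis by (simp add: ln_lscale add_divide_distrib distrib_right)
qed

text \<open>Since \<open>ln L \<le> 2 \<surd>L\<close>, the logarithmic factor is harmless.\<close>
lemma ln_lscale_ge:
  assumes "L \<ge> (4 * \<bar>recip_exp p - 1 / s\<bar>)\<^sup>2"
  shows "ln (lscale \<delta>) \<ge> L / (2 * D)"
proof -
  let ?e = "\<bar>recip_exp p - 1 / s\<bar>"
  have lnL: "0 \<le> ln L" using L by simp
  have "4 * ?e \<le> sqrt L" using assms by (intro real_le_rsqrt) auto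
  then have "4 * ?e * sqrt L \<le> sqrt L * sqrt L" using L by (intro mult_right_mono) auto
  then have 1: "?e * (2 * sqrt L) \<le> L / 2" using L by simp
  have "ln L \<le> L powr (1 / 2) / (1 / 2)" using L by (intro ln_powr_bound) auto
  then have "?e * ln L \<le> ?e * (2 * sqrt L)" using L by (intro mult_left_mono) (auto simp: powr_half_sqrt)
  moreover have "- (?e * ln L) \<le> (recip_exp p - 1 / s) * ln L"
    using mult_right_mono[OF _ lnL, of "- ?e" "recip_exp p - 1 / s"] by simp
  ultimately have "- (L / 2) \<le> (recip_exp p - 1 / s) * ln L" using 1 by linarith
  then have "- (L / 2) / D \<le> (recip_exp p - 1 / s) * ln L / D"
    using D_pos by (intro divide_right_mono) auto
  then show ?thesis unfolding ln_lscale by (simp add: field_simps)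
qed

text \<open>The first factor is exactly the power of \<open>lscale \<delta>\<close> in
  \<open>rate\<close>; the logarithmic exponent is larger by 1, and L \<ge> 1.\<close>

lemma rate_le_second:
  "rate \<delta> \<le> (\<delta> * L powr (1 / s - recip_exp p)) powr (\<alpha> / D) * L powr (2 - 1 / s)"
  unfolding lscale_powr rate_def L_eq[symmetric] using L by (intro mult_left_mono powr_mono) auto

text \<open>As \<open>lscale\<close> is \<open>Nscale\<close> / L, passing to N costs L^\<alpha>.
  Together with the L^(1 - 1/s) of \<open>rate\<close> this stays below L^(\<mu> - 2 r1 + 1/2), and
  L is at most 2 D ln N.\<close>

lemma rate_comparison:
  assumes N: "comparable c1 c2 (real N) (Nscale \<delta>)" and c: "c1 > 0" "c2 > 0"
    and large: "L \<ge> 2 * D * \<bar>ln c1\<bar>"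
  shows "N \<ge> 1"
    and "Nscale \<delta> powr (- \<alpha>) \<le> c2 powr \<alpha> * real N powr (- \<alpha>)"
    and "rate \<delta> \<le> c2 powr \<alpha> * (2 * D) powr (\<mu> - 2 * real r1 + 1 / 2) *
           (real N powr (- \<alpha>) * ln (real N) powr (\<mu> - 2 * real r1 + 1 / 2))"
proof -
  have h: "lscale \<delta> > 0" by (rule lscale_pos)
  have g: "Nscale \<delta> > 0" using h L by (simp add: Nscale_eq)
  have N': "c1 * Nscale \<delta> \<le> real N" "real N \<le> c2 * Nscale \<delta>" using N by (auto simp: comparable_def)
  have pos: "real N > 0" using N'(1) g c(1) by (meson mult_pos_pos order_less_le_trans)
  then show "N \<ge> 1" by simp
  have "real N powr (- \<alpha>) \<ge> (c2 * Nscale \<delta>) powr (- \<alpha>)"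
    using N' pos \<alpha>_pos by (intro powr_mono2') auto
  then have "c2 powr \<alpha> * (c2 * Nscale \<delta>) powr (- \<alpha>) \<le> c2 powr \<alpha> * real N powr (- \<alpha>)"
    by (intro mult_left_mono) auto
  moreover have "c2 powr \<alpha> * c2 powr (- \<alpha>) = 1"
    unfolding powr_add[symmetric] using c by simp
  then have "c2 powr \<alpha> * (c2 * Nscale \<delta>) powr (- \<alpha>) = Nscale \<delta> powr (- \<alpha>)"
    using g c by (simp add: powr_mult flip: mult.assoc)
  ultimately show 1: "Nscale \<delta> powr (- \<alpha>) \<le> c2 powr \<alpha> * real N powr (- \<alpha>)" by simp
  \<comment> \<open>N is at least c1 \<delta>^(-1/D), whose logarithm is ln c1 + L / D; by
    \<open>large\<close>, half of L / D absorbs ln c1.\<close>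
  have lnN: "L / (2 * D) \<le> ln (real N)"
  proof -
    have "\<delta> powr (- (1 / D)) \<le> Nscale \<delta>"
    proof -
      have "\<delta> powr (- (1 / D)) * L powr 0 \<le> \<delta> powr (- (1 / D)) * L powr (\<mu> * (1 / D))"
        using L \<mu>_pos D_pos by (intro mult_left_mono powr_mono) auto
      also have "\<dots> = Nscale \<delta>"
        unfolding Nscale_def L_eq[symmetric]
        by (rule powr_divide_powr_minus[symmetric]) (use \<delta> L in auto)
      finally show ?thesis using L by simp
    qed
    then have "ln (c1 * \<delta> powr (- (1 / D))) \<le> ln (real N)"
      using N'(1) c \<delta> pos by (subst ln_le_cancel_iff) (auto intro: order_trans[OF mult_left_mono])
    moreover have "ln (c1 * \<delta> powr (- (1 / D))) = ln c1 + L / D"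
      using c \<delta> by (simp add: ln_mult ln_powr L_eq ln_div)
    moreover have "\<bar>ln c1\<bar> \<le> L / (2 * D)" using large D_pos by (simp add: field_simps)
    moreover have "L / D = L / (2 * D) + L / (2 * D)" using D_pos by (simp add: field_simps)
    ultimately show ?thesis by linarith
  qed
  define \<beta> where "\<beta> = \<mu> - 2 * real r1 + 1 / 2"
  have \<beta>: "\<beta> = \<alpha> + 1 + (1 - 1 / s)" by (simp add: \<beta>_def \<alpha>_def)
  have "1 / s \<le> 1" using s by simp
  then have "\<beta> \<ge> 0" using \<alpha>_pos by (simp add: \<beta>)
  have "rate \<delta> = Nscale \<delta> powr (- \<alpha>) * L powr (\<alpha> + (1 - 1 / s))"
  proof -
    have "Nscale \<delta> powr (- \<alpha>) * L powr (\<alpha> + (1 - 1 / s)) =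
        lscale \<delta> powr (- \<alpha>) * (L powr (- \<alpha>) * L powr (\<alpha> + (1 - 1 / s)))"
      unfolding Nscale_eq using h L by (simp add: powr_mult)
    also have "L powr (- \<alpha>) * L powr (\<alpha> + (1 - 1 / s)) = L powr (1 - 1 / s)"
      unfolding powr_add[symmetric] by (rule arg_cong) simp
    finally show ?thesis by (simp only: rate_def L_eq)
  qed
  also have "\<dots> \<le> Nscale \<delta> powr (- \<alpha>) * L powr \<beta>"
    using L by (intro mult_left_mono powr_mono) (auto simp: \<beta>)
  also have "\<dots> \<le> Nscale \<delta> powr (- \<alpha>) * ((2 * D) powr \<beta> * ln (real N) powr \<beta>)"
  proof (rule mult_left_mono)
    have "L powr \<beta> = (2 * D) powr \<beta> * (L / (2 * D)) powr \<beta>"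
      using L D_pos by (simp flip: powr_mult)
    also have "\<dots> \<le> (2 * D) powr \<beta> * ln (real N) powr \<beta>"
      using lnN \<open>\<beta> \<ge> 0\<close> L D_pos by (intro mult_left_mono powr_mono2) auto
    finally show "L powr \<beta> \<le> (2 * D) powr \<beta> * ln (real N) powr \<beta>" .
  qed simp
  also have "Nscale \<delta> powr (- \<alpha>) * ((2 * D) powr \<beta> * ln (real N) powr \<beta>) \<le>
      (c2 powr \<alpha> * real N powr (- \<alpha>)) * ((2 * D) powr \<beta> * ln (real N) powr \<beta>)"
    by (intro mult_right_mono 1) auto
  finally show "rate \<delta> \<le> c2 powr \<alpha> * (2 * D) powr (\<mu> - 2 * real r1 + 1 / 2) *
           (real N powr (- \<alpha>) * ln (real N) powr (\<mu> - 2 * real r1 + 1 / 2))"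
    by (simp only: \<beta>_def mult_ac)
qed

end

text \<open>Even when the exponent of the logarithm in \<open>lscale\<close> is negative,
  ln(\<open>lscale \<delta>\<close>) is at least L / (2 D) for large L.\<close>

lemma eventually_lscale_ge:
  "\<forall>\<^sub>F \<delta> in at_right (0::real). 0 < \<delta> \<and> Y \<le> ln (1 / \<delta>) \<and> 1 \<le> ln (1 / \<delta>) \<and> X \<le> lscale \<delta>"
  using eventually_ln_inverse_ge[of "max (max 1 Y) (max ((4 * \<bar>recip_exp p - 1 / s\<bar>)\<^sup>2) (2 * D * X))"]
proof eventually_elim
  case (elim \<delta>)
  define L where "L = ln (1 / \<delta>)"
  have L: "L \<ge> 1" "L \<ge> Y" "L \<ge> (4 * \<bar>recip_exp p - 1 / s\<bar>)\<^sup>2" "2 * D * X \<le> L" and \<delta>: "0 < \<delta>"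
    using elim by (auto simp: L_def)
  have "X \<le> L / (2 * D)" using L(4) D_pos by (simp add: field_simps)
  also have "\<dots> \<le> ln (lscale \<delta>)" by (rule ln_lscale_ge[OF \<delta> L(1) L_def L(3)])
  also have "\<dots> \<le> lscale \<delta>" using ln_le_minus_one[OF lscale_pos[OF \<delta> L(1) L_def]] by simp
  finally show ?case using L \<delta> by (simp add: L_def)
qed

lemma truncation_rate_eq:
  assumes d: "d1 > 0" "d2 > 0"
  shows "\<exists>C>0. \<forall>\<^sub>F \<delta> in at_right 0. \<forall>n. comparable d1 d2 n (lscale \<delta>) \<longrightarrow>
     finite (Gam r1 r1 n 1) \<and> real (card (Gam r1 r1 n 1)) \<le> C * Nscale \<delta> \<and>
     recovery_error r1 r1 s \<mu> p \<delta> (Gam r1 r1 n 1) (truncation r1 r1 n 1) \<le> ennreal (C * rate \<delta>)"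
proof -
  obtain C1 where C1: "C1 > 0" "\<And>n F. n \<ge> 1 \<Longrightarrow> finite F \<Longrightarrow> F \<subseteq> hyp_out n 1 \<Longrightarrow>
      (\<Sum>(k, j)\<in>F. real k powr (- 1 - \<alpha>) * real j powr (- 1 - \<alpha>)) \<le> C1 * n powr (- \<alpha>) * (1 + ln n)"
    using hyp_out_sum_eq[OF \<alpha>_pos] by blast
  obtain C where C: "C > 0" "\<And>n \<l> \<delta>. 1 \<le> n \<Longrightarrow> 1 \<le> \<l> \<Longrightarrow> 0 < \<delta> \<Longrightarrow>
     (\<forall>F. finite F \<longrightarrow> F \<subseteq> hyp_out n 1 \<longrightarrow>
        (\<Sum>(k, j)\<in>F. real k powr (- 1 - \<alpha>) * real j powr (- 1 - \<alpha>)) \<le> C1 * n powr (- \<alpha>) * \<l>) \<Longrightarrow>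
     real (card (Gam r1 r1 n 1)) \<le> 1 * n * \<l> \<Longrightarrow>
     recovery_error r1 r1 s \<mu> p \<delta> (Gam r1 r1 n 1) (truncation r1 r1 n 1)
       \<le> ennreal (C * (n powr (- \<alpha>) * \<l> powr (1 - 1 / s) +
            \<delta> * n powr (2 * real r1 + 3 / 2 - recip_exp p) * \<l> powr (1 - recip_exp p)))"
    using recovery_error_truncation[OF s p r1 order_refl, of \<mu> 1 C1 1] \<alpha>_pos C1(1)
    unfolding \<alpha>_def[symmetric] by auto
  define E where "E = 2 * real r1 + 3 / 2 - recip_exp p"
  have E: "E \<ge> 0" using recip_exp_bounds[OF p] by (simp add: E_def)
  \<comment> \<open>Chosen so that 1 + ln n \<le> \<Lambda> L whenever n \<le> d2
    \<open>lscale \<delta>\<close>; then \<Lambda> L serves as \<open>\<l>\<close>.\<close>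
  define \<Lambda> where "\<Lambda> = 1 + \<bar>ln d2\<bar> + (1 + \<bar>recip_exp p - 1 / s\<bar>) / D"
  have \<Lambda>: "\<Lambda> \<ge> 1" using D_pos by (simp add: \<Lambda>_def)
  define Q where "Q = d1 powr (- \<alpha>) * \<Lambda> powr (1 - 1 / s) + d2 powr E * \<Lambda> powr (1 - recip_exp p)"
  define K where "K = max (C * Q) (d2 * \<Lambda>)"
  have "\<forall>\<^sub>F \<delta> in at_right 0. \<forall>n. comparable d1 d2 n (lscale \<delta>) \<longrightarrow>
     finite (Gam r1 r1 n 1) \<and> real (card (Gam r1 r1 n 1)) \<le> K * Nscale \<delta> \<and>
     recovery_error r1 r1 s \<mu> p \<delta> (Gam r1 r1 n 1) (truncation r1 r1 n 1) \<le> ennreal (K * rate \<delta>)"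
    using eventually_lscale_ge[of 1 "1 / d1"]
  proof (eventually_elim, intro allI impI)
    fix \<delta> n
    assume H: "0 < \<delta> \<and> 1 \<le> ln (1 / \<delta>) \<and> 1 \<le> ln (1 / \<delta>) \<and> 1 / d1 \<le> lscale \<delta>"
      and n: "comparable d1 d2 n (lscale \<delta>)"
    define L where "L = ln (1 / \<delta>)"
    have \<delta>: "0 < \<delta>" and L: "L \<ge> 1" using H by (auto simp: L_def)
    note facts = lscale_pos[OF \<delta> L L_def] Nscale_eq[OF \<delta> L L_def] delta_eq[OF \<delta> L L_def]
      ln_lscale_le[OF \<delta> L L_def]
    let ?h = "lscale \<delta>"
    have n': "d1 * ?h \<le> n" "n \<le> d2 * ?h" using n by (auto simp: comparable_def)
    have "1 \<le> d1 * ?h" using H d by (simp add: field_simps)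
    then have n1: "n \<ge> 1" using n' by linarith
    define \<l> where "\<l> = \<Lambda> * L"
    have \<l>: "1 \<le> \<l>" using mult_mono[OF \<Lambda> L] \<Lambda> L by (simp add: \<l>_def)
    have ln_n: "1 + ln n \<le> \<l>"
    proof -
      have "ln n \<le> ln (d2 * ?h)" using n' n1 by (subst ln_le_cancel_iff) auto
      also have "\<dots> = ln d2 + ln ?h" using d facts(1) by (simp add: ln_mult)
      also have "\<dots> \<le> \<bar>ln d2\<bar> * L + (1 + \<bar>recip_exp p - 1 / s\<bar>) / D * L"
        using facts(4) mult_left_mono[OF L, of "\<bar>ln d2\<bar>"] by linarith
      finally have "1 + ln n \<le> L + \<bar>ln d2\<bar> * L + (1 + \<bar>recip_exp p - 1 / s\<bar>) / D * L"
        using L by linarith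
      then show ?thesis by (simp add: \<l>_def \<Lambda>_def distrib_right)
    qed
    have fin: "finite (Gam r1 r1 n 1)" using r1 n1 by (intro Gam_card) auto
    have card: "real (card (Gam r1 r1 n 1)) \<le> 1 * n * \<l>"
    proof -
      have "real (card (Gam r1 r1 n 1)) \<le> n * (1 + ln n)" using r1 n1 by (intro Gam_card_eq) auto
      also have "\<dots> \<le> n * \<l>" using n1 ln_n by (intro mult_left_mono) auto
      finally show ?thesis by simp
    qed
    also have "1 * n * \<l> \<le> (d2 * ?h) * \<l>" using n' \<l> by (simp add: mult_right_mono)
    also have "\<dots> = (d2 * \<Lambda>) * Nscale \<delta>" by (simp add: facts(2) \<l>_def)
    also have "\<dots> \<le> K * Nscale \<delta>" using facts(1,2) L by (intro mult_right_mono) (auto simp: K_def)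
    finally have cardN: "real (card (Gam r1 r1 n 1)) \<le> K * Nscale \<delta>" .
    have "recovery_error r1 r1 s \<mu> p \<delta> (Gam r1 r1 n 1) (truncation r1 r1 n 1)
       \<le> ennreal (C * (n powr (- \<alpha>) * \<l> powr (1 - 1 / s) + \<delta> * n powr E * \<l> powr (1 - recip_exp p)))"
      unfolding E_def
    proof (rule C(2)[OF n1 \<l> \<delta> _ card], intro allI impI)
      fix F assume F: "finite F" "F \<subseteq> hyp_out n 1"
      have "C1 * n powr (- \<alpha>) * (1 + ln n) \<le> C1 * n powr (- \<alpha>) * \<l>"
        using C1(1) ln_n by (intro mult_left_mono) auto
      with C1(2)[OF n1 F] show "(\<Sum>(k, j)\<in>F. real k powr (- 1 - \<alpha>) * real j powr (- 1 - \<alpha>))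
          \<le> C1 * n powr (- \<alpha>) * \<l>" by (rule order_trans)
    qed
    also have "\<dots> \<le> ennreal (K * rate \<delta>)"
    proof (rule ennreal_leI)
      have "n powr (- \<alpha>) \<le> (d1 * ?h) powr (- \<alpha>)"
        using n' d facts(1) \<alpha>_pos by (intro powr_mono2') auto
      then have "n powr (- \<alpha>) * \<l> powr (1 - 1 / s) \<le> (d1 * ?h) powr (- \<alpha>) * \<l> powr (1 - 1 / s)"
        by (intro mult_right_mono) auto
      also have "\<dots> = (d1 powr (- \<alpha>) * \<Lambda> powr (1 - 1 / s)) * rate \<delta>"
        using d facts(1) \<Lambda> L by (simp add: \<l>_def rate_def powr_mult flip: L_def)
      finally have 1: "n powr (- \<alpha>) * \<l> powr (1 - 1 / s) \<le> (d1 powr (- \<alpha>) * \<Lambda> powr (1 - 1 / s)) * rate \<delta>" .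
      have "\<delta> * n powr E * \<l> powr (1 - recip_exp p) \<le> \<delta> * (d2 * ?h) powr E * \<l> powr (1 - recip_exp p)"
        using n' n1 \<delta> E by (intro mult_left_mono mult_right_mono powr_mono2) auto
      also have "\<dots> = d2 powr E * \<Lambda> powr (1 - recip_exp p) *
          ((?h powr E * ?h powr (- D)) * (L powr (recip_exp p - 1 / s) * L powr (1 - recip_exp p)))"
        by (subst facts(3)) (use d facts(1) \<Lambda> L in \<open>simp add: \<l>_def powr_mult\<close>)
      also have "?h powr E * ?h powr (- D) = ?h powr (- \<alpha>)"
        unfolding powr_add[symmetric] using exponent by (simp add: E_def)
      \<comment> \<open>The logarithm built into \<open>lscale\<close> turns the noise exponent 1 -
        1/p into the tail exponent 1 - 1/s.\<close>
      also have "L powr (recip_exp p - 1 / s) * L powr (1 - recip_exp p) = L powr (1 - 1 / s)"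
        unfolding powr_add[symmetric] by simp
      finally have 2: "\<delta> * n powr E * \<l> powr (1 - recip_exp p) \<le>
          (d2 powr E * \<Lambda> powr (1 - recip_exp p)) * rate \<delta>"
        by (simp only: rate_def L_def)
      have "C * (n powr (- \<alpha>) * \<l> powr (1 - 1 / s) + \<delta> * n powr E * \<l> powr (1 - recip_exp p)) \<le> C * (Q * rate \<delta>)"
        using 1 2 C(1) by (intro mult_left_mono) (auto simp: Q_def distrib_right)
      also have "\<dots> \<le> K * rate \<delta>"
        unfolding mult.assoc[symmetric] by (intro mult_right_mono) (auto simp: K_def rate_def)
      finally show "C * (n powr (- \<alpha>) * \<l> powr (1 - 1 / s) + \<delta> * n powr E * \<l> powr (1 - recip_exp p)) \<le> K * rate \<delta>" .
    qed
    finally show "finite (Gam r1 r1 n 1) \<and> real (card (Gam r1 r1 n 1)) \<le> K * Nscale \<delta> \<and>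
        recovery_error r1 r1 s \<mu> p \<delta> (Gam r1 r1 n 1) (truncation r1 r1 n 1) \<le> ennreal (K * rate \<delta>)"
      using fin cardN by simp
  qed
  moreover have "K > 0" using d \<Lambda> by (simp add: K_def less_max_iff_disj)
  ultimately show ?thesis by blast
qed

abbreviation "bound1 \<equiv> (\<lambda>(N::nat) (\<delta>::real). real N powr (- \<alpha>) * ln (real N) powr (\<mu> - 2 * real r1 + 1 / 2))"
abbreviation "bound2 \<equiv> (\<lambda>(N::nat) (\<delta>::real).
  (\<delta> * ln (1 / \<delta>) powr (1 / s - recip_exp p)) powr (\<alpha> / D) * ln (1 / \<delta>) powr (2 - 1 / s))"

lemma truncation_implements_eq:
  "truncation_implements r1 r1 s \<mu> p 1 Nscale lscale {bound1, bound2}"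
  unfolding truncation_implements_def
proof (intro allI impI)
  fix c1 c2 d1 d2 :: real
  assume pos: "c1 > 0" "c2 > 0" "d1 > 0" "d2 > 0"
  obtain C where C: "C > 0" and C': "\<forall>\<^sub>F \<delta> in at_right 0. \<forall>n. comparable d1 d2 n (lscale \<delta>) \<longrightarrow>
     finite (Gam r1 r1 n 1) \<and> real (card (Gam r1 r1 n 1)) \<le> C * Nscale \<delta> \<and>
     recovery_error r1 r1 s \<mu> p \<delta> (Gam r1 r1 n 1) (truncation r1 r1 n 1) \<le> ennreal (C * rate \<delta>)"
    using truncation_rate_eq[OF pos(3,4)] by blast
  define k where "k = c2 powr \<alpha> * (2 * D) powr (\<mu> - 2 * real r1 + 1 / 2)"
  define K where "K = max C (max (C * k) (C / c1))"
  have "\<forall>\<^sub>F \<delta> in at_right 0. \<forall>(N::nat) (n::real). comparable c1 c2 (real N) (Nscale \<delta>) \<longrightarrow>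
     comparable d1 d2 n (lscale \<delta>) \<longrightarrow> finite (Gam r1 r1 n 1) \<and> real (card (Gam r1 r1 n 1)) \<le> K * real N \<and>
     (\<forall>B\<in>{bound1, bound2}.
        recovery_error r1 r1 s \<mu> p \<delta> (Gam r1 r1 n 1) (truncation r1 r1 n 1) \<le> ennreal (K * B N \<delta>))"
    using C' eventually_lscale_ge[of "2 * D * \<bar>ln c1\<bar>" 1]
  proof (eventually_elim, intro allI impI)
    fix \<delta> n and N :: nat
    assume H: "\<forall>n. comparable d1 d2 n (lscale \<delta>) \<longrightarrow>
         finite (Gam r1 r1 n 1) \<and> real (card (Gam r1 r1 n 1)) \<le> C * Nscale \<delta> \<and>
         recovery_error r1 r1 s \<mu> p \<delta> (Gam r1 r1 n 1) (truncation r1 r1 n 1) \<le> ennreal (C * rate \<delta>)"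
      and \<delta>: "0 < \<delta> \<and> 2 * D * \<bar>ln c1\<bar> \<le> ln (1 / \<delta>) \<and> 1 \<le> ln (1 / \<delta>) \<and> 1 \<le> lscale \<delta>"
      and N: "comparable c1 c2 (real N) (Nscale \<delta>)" and n: "comparable d1 d2 n (lscale \<delta>)"
    let ?R = "recovery_error r1 r1 s \<mu> p \<delta> (Gam r1 r1 n 1) (truncation r1 r1 n 1)"
    have fin: "finite (Gam r1 r1 n 1)" and cardC: "real (card (Gam r1 r1 n 1)) \<le> C * Nscale \<delta>"
      and R: "?R \<le> ennreal (C * rate \<delta>)"
      using H n by auto
    have \<delta>': "0 < \<delta>" "1 \<le> ln (1 / \<delta>)" "2 * D * \<bar>ln c1\<bar> \<le> ln (1 / \<delta>)" using \<delta> by auto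
    note cmp = rate_comparison[OF \<delta>'(1,2) refl N pos(1,2) \<delta>'(3)]
    note cardC
    also have "C * Nscale \<delta> \<le> C * (real N / c1)"
      using N pos C by (intro mult_left_mono) (auto simp: comparable_def field_simps)
    also have "\<dots> \<le> K * real N"
      using mult_right_mono[of "C / c1" K "real N"] by (simp add: K_def)
    finally have card: "real (card (Gam r1 r1 n 1)) \<le> K * real N" .
    have "C * rate \<delta> \<le> C * (k * bound1 N \<delta>)"
      using cmp(3) C by (intro mult_left_mono) (auto simp: k_def)
    also have "\<dots> \<le> K * bound1 N \<delta>"
      unfolding mult.assoc[symmetric, of C] by (intro mult_right_mono) (auto simp: K_def)
    finally have "?R \<le> ennreal (K * bound1 N \<delta>)" using R by (meson ennreal_leI order_trans)
    moreover have "C * rate \<delta> \<le> K * bound2 N \<delta>"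
      using rate_le_second[OF \<delta>'(1,2) refl] C by (intro mult_mono) (auto simp: K_def rate_def)
    then have "?R \<le> ennreal (K * bound2 N \<delta>)" using R by (meson ennreal_leI order_trans)
    ultimately show "finite (Gam r1 r1 n 1) \<and> real (card (Gam r1 r1 n 1)) \<le> K * real N \<and>
        (\<forall>B\<in>{bound1, bound2}. ?R \<le> ennreal (K * B N \<delta>))"
      using fin card by simp
  qed
  moreover have "K > 0" using C by (simp add: K_def)
  ultimately show "\<exists>C>0. \<forall>\<^sub>F \<delta> in at_right 0. \<forall>(N::nat) (n::real). comparable c1 c2 (real N) (Nscale \<delta>) \<longrightarrow>
     comparable d1 d2 n (lscale \<delta>) \<longrightarrow> finite (Gam r1 r1 n 1) \<and> real (card (Gam r1 r1 n 1)) \<le> C * real N \<and>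
     (\<forall>B\<in>{bound1, bound2}.
        recovery_error r1 r1 s \<mu> p \<delta> (Gam r1 r1 n 1) (truncation r1 r1 n 1) \<le> ennreal (C * B N \<delta>))"
    by blast
qed

lemma min_radius_eq:
  assumes pos: "c1 > 0" "c2 > 0"
  shows "\<exists>c>0. \<exists>C>0. \<forall>\<^sub>F \<delta> in at_right 0. \<forall>N::nat. comparable c1 c2 (real N) (Nscale \<delta>) \<longrightarrow>
     ennreal (c * real N powr (- \<alpha>)) \<le> min_radius r1 r1 s \<mu> p N \<delta> \<and>
     min_radius r1 r1 s \<mu> p N \<delta> \<le> ennreal (C * bound1 N \<delta>) \<and>
     ennreal (c * (\<delta> / ln (1 / \<delta>) powr \<mu>) powr (\<alpha> / D)) \<le> min_radius r1 r1 s \<mu> p N \<delta> \<and>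
     min_radius r1 r1 s \<mu> p N \<delta> \<le> ennreal (C * bound2 N \<delta>)"
proof -
  define c0 where "c0 = (1 + \<bar>recip_exp p - 1 / s\<bar>) / D"
  have c0: "c0 \<ge> 0" using D_pos by (simp add: c0_def)
  \<comment> \<open>The bound 1 gives n \<le> \<open>lscale \<delta>\<close>, so that 1 + ln n \<le>
    (1 + c0) L; the other bound then makes the cross fit into c1 \<open>Nscale \<delta>\<close>,
    hence into N.\<close>
  define \<kappa> where "\<kappa> = min 1 (c1 / (1 + c0))"
  have \<kappa>: "0 < \<kappa>" "\<kappa> \<le> 1" "\<kappa> * (1 + c0) \<le> c1"
  proof -
    show "0 < \<kappa>" "\<kappa> \<le> 1" using pos c0 by (auto simp: \<kappa>_def)
    have "\<kappa> \<le> c1 / (1 + c0)" by (simp add: \<kappa>_def)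
    then show "\<kappa> * (1 + c0) \<le> c1" using c0 by (simp add: pos_le_divide_eq)
  qed
  obtain C where C: "C > 0" and C': "\<forall>\<^sub>F \<delta> in at_right 0. \<forall>n. comparable \<kappa> \<kappa> n (lscale \<delta>) \<longrightarrow>
     finite (Gam r1 r1 n 1) \<and> real (card (Gam r1 r1 n 1)) \<le> C * Nscale \<delta> \<and>
     recovery_error r1 r1 s \<mu> p \<delta> (Gam r1 r1 n 1) (truncation r1 r1 n 1) \<le> ennreal (C * rate \<delta>)"
    using truncation_rate_eq[OF \<kappa>(1) \<kappa>(1)] by blast
  obtain c where c: "c > 0" "\<And>N \<delta>. N \<ge> 1 \<Longrightarrow> ennreal (c * real N powr (- \<alpha>)) \<le> min_radius r1 r1 s \<mu> p N \<delta>"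
    using min_radius_ge[OF s p r1 r1 \<mu>_pos] unfolding exponent' by blast
  define k where "k = c2 powr \<alpha> * (2 * D) powr (\<mu> - 2 * real r1 + 1 / 2)"
  define K where "K = max C (C * k)"
  define c' where "c' = min c (c * c2 powr (- \<alpha>))"
  have "\<forall>\<^sub>F \<delta> in at_right 0. \<forall>N::nat. comparable c1 c2 (real N) (Nscale \<delta>) \<longrightarrow>
     ennreal (c' * real N powr (- \<alpha>)) \<le> min_radius r1 r1 s \<mu> p N \<delta> \<and>
     min_radius r1 r1 s \<mu> p N \<delta> \<le> ennreal (K * bound1 N \<delta>) \<and>
     ennreal (c' * (\<delta> / ln (1 / \<delta>) powr \<mu>) powr (\<alpha> / D)) \<le> min_radius r1 r1 s \<mu> p N \<delta> \<and>
     min_radius r1 r1 s \<mu> p N \<delta> \<le> ennreal (K * bound2 N \<delta>)"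
    using C' eventually_lscale_ge[of "2 * D * \<bar>ln c1\<bar>" "1 / \<kappa>"]
  proof (eventually_elim, intro allI impI)
    fix \<delta> and N :: nat
    assume H: "\<forall>n. comparable \<kappa> \<kappa> n (lscale \<delta>) \<longrightarrow>
         finite (Gam r1 r1 n 1) \<and> real (card (Gam r1 r1 n 1)) \<le> C * Nscale \<delta> \<and>
         recovery_error r1 r1 s \<mu> p \<delta> (Gam r1 r1 n 1) (truncation r1 r1 n 1) \<le> ennreal (C * rate \<delta>)"
      and \<delta>: "0 < \<delta> \<and> 2 * D * \<bar>ln c1\<bar> \<le> ln (1 / \<delta>) \<and> 1 \<le> ln (1 / \<delta>) \<and> 1 / \<kappa> \<le> lscale \<delta>"
      and N: "comparable c1 c2 (real N) (Nscale \<delta>)"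
    let ?M = "min_radius r1 r1 s \<mu> p N \<delta>"
    define L where "L = ln (1 / \<delta>)"
    have \<delta>': "0 < \<delta>" "1 \<le> L" "2 * D * \<bar>ln c1\<bar> \<le> L" using \<delta> by (auto simp: L_def)
    note cmp = rate_comparison[OF \<delta>'(1,2) L_def N pos \<delta>'(3)]
    have h: "lscale \<delta> > 0" by (rule lscale_pos[OF \<delta>'(1,2) L_def])
    define n where "n = \<kappa> * lscale \<delta>"
    have n: "n \<ge> 1" using \<delta> \<kappa>(1) by (simp add: n_def field_simps)
    have fin: "finite (Gam r1 r1 n 1)"
      and R: "recovery_error r1 r1 s \<mu> p \<delta> (Gam r1 r1 n 1) (truncation r1 r1 n 1) \<le> ennreal (C * rate \<delta>)"
      using H by (auto simp: comparable_def n_def)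
    have "real (card (Gam r1 r1 n 1)) \<le> n * (1 + ln n)" using r1 n by (intro Gam_card_eq) auto
    also have "\<dots> \<le> n * ((1 + c0) * L)"
    proof (rule mult_left_mono)
      have "n \<le> lscale \<delta>" using \<kappa>(2) h by (simp add: n_def)
      then have "ln n \<le> ln (lscale \<delta>)" using n by simp
      also have "\<dots> \<le> c0 * L" unfolding c0_def by (rule ln_lscale_le[OF \<delta>'(1,2) L_def])
      finally show "1 + ln n \<le> (1 + c0) * L" using \<delta>'(2) by (simp add: distrib_right)
    qed (use n in simp)
    also have "\<dots> = \<kappa> * (1 + c0) * Nscale \<delta>"
      by (simp add: n_def Nscale_eq[OF \<delta>'(1,2) L_def])
    also have "\<dots> \<le> c1 * Nscale \<delta>"
      using \<kappa>(3) by (intro mult_right_mono) (auto simp: Nscale_def)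
    also have "\<dots> \<le> real N" using N by (simp add: comparable_def)
    finally have "card (Gam r1 r1 n 1) \<le> N" by simp
    from min_radius_le[OF fin this] R have M: "?M \<le> ennreal (C * rate \<delta>)" by (rule order_trans)
    have "C * rate \<delta> \<le> C * (k * bound1 N \<delta>)"
      using cmp(3) C by (intro mult_left_mono) (auto simp: k_def)
    also have "\<dots> \<le> K * bound1 N \<delta>"
      unfolding mult.assoc[symmetric, of C] by (intro mult_right_mono) (auto simp: K_def)
    finally have up1: "?M \<le> ennreal (K * bound1 N \<delta>)" using M by (meson ennreal_leI order_trans)
    have "C * rate \<delta> \<le> K * bound2 N \<delta>"
      using rate_le_second[OF \<delta>'(1,2) L_def] C unfolding L_def
      by (intro mult_mono) (auto simp: K_def rate_def)
    then have up2: "?M \<le> ennreal (K * bound2 N \<delta>)" using M by (meson ennreal_leI order_trans)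
    have low: "ennreal (c * real N powr (- \<alpha>)) \<le> ?M" by (rule c(2)[OF cmp(1)])
    have "c' * real N powr (- \<alpha>) \<le> c * real N powr (- \<alpha>)"
      by (intro mult_right_mono) (auto simp: c'_def)
    then have low1: "ennreal (c' * real N powr (- \<alpha>)) \<le> ?M" using low by (meson ennreal_leI order_trans)
    \<comment> \<open>The upper comparison of N with \<open>Nscale \<delta>\<close> converts the
      lower bound in N into one in \<delta>.\<close>
    have "c' * Nscale \<delta> powr (- \<alpha>) \<le> (c * c2 powr (- \<alpha>)) * (c2 powr \<alpha> * real N powr (- \<alpha>))"
      using c(1) cmp(2) by (intro mult_mono) (auto simp: c'_def)
    also have "\<dots> = c * real N powr (- \<alpha>) * (c2 powr (- \<alpha>) * c2 powr \<alpha>)" by simp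
    also have "c2 powr (- \<alpha>) * c2 powr \<alpha> = 1" unfolding powr_add[symmetric] using pos by simp
    finally have "ennreal (c' * (\<delta> / ln (1 / \<delta>) powr \<mu>) powr (\<alpha> / D)) \<le> ?M"
      unfolding L_def[symmetric] Nscale_powr[OF \<delta>'(1,2) L_def] using low by (simp add: order_trans[OF ennreal_leI])
    with up1 up2 low1 show "ennreal (c' * real N powr (- \<alpha>)) \<le> ?M \<and> ?M \<le> ennreal (K * bound1 N \<delta>) \<and>
        ennreal (c' * (\<delta> / ln (1 / \<delta>) powr \<mu>) powr (\<alpha> / D)) \<le> ?M \<and> ?M \<le> ennreal (K * bound2 N \<delta>)"
      by blast
  qed
  moreover have "c' > 0" "K > 0" using c C pos by (auto simp: c'_def K_def)
  ultimately show ?thesis by blast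
qed

end

section \<open>Assembly of the three cases\<close>

theorem theorem0p4p2:
  fixes s \<mu> :: real and p :: ennreal and r1 r2 :: nat
  assumes "1 \<le> s" and "1 \<le> p" and "1 \<le> r2" and "r2 \<le> r1"
    and "\<mu> > 2 * real r1 + 3 / 2 - 1 / s"
  shows
    "(r1 = r2 \<longrightarrow>
        (\<forall>c1>0. \<forall>c2>0. \<exists>c>0. \<exists>C>0. \<forall>\<^sub>F \<delta> in at_right 0. \<forall>N::nat.
          comparable c1 c2 (real N) ((\<delta> / ln (1 / \<delta>) powr \<mu>) powr (- (1 / (\<mu> - recip_exp p + 1 / s)))) \<longrightarrow>
            ennreal (c * real N powr (- \<mu> + 2 * real r1 - 1 / s + 3 / 2)) \<le> min_radius r1 r1 s \<mu> p N \<delta> \<and>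
            min_radius r1 r1 s \<mu> p N \<delta>
              \<le> ennreal (C * (real N powr (- \<mu> + 2 * real r1 - 1 / s + 3 / 2)
                              * ln (real N) powr (\<mu> - 2 * real r1 + 1 / 2))) \<and>
            ennreal (c * (\<delta> / ln (1 / \<delta>) powr \<mu>)
                         powr ((\<mu> - 2 * real r1 + 1 / s - 3 / 2) / (\<mu> - recip_exp p + 1 / s)))
              \<le> min_radius r1 r1 s \<mu> p N \<delta> \<and>
            min_radius r1 r1 s \<mu> p N \<delta>
              \<le> ennreal (C * ((\<delta> * ln (1 / \<delta>) powr (1 / s - recip_exp p))
                                 powr ((\<mu> - 2 * real r1 + 1 / s - 3 / 2) / (\<mu> - recip_exp p + 1 / s))
                              * ln (1 / \<delta>) powr (2 - 1 / s)))) \<and>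
        truncation_implements r1 r1 s \<mu> p 1
          (\<lambda>\<delta>. (\<delta> / ln (1 / \<delta>) powr \<mu>) powr (- (1 / (\<mu> - recip_exp p + 1 / s))))
          (\<lambda>\<delta>. (\<delta> / ln (1 / \<delta>) powr (recip_exp p - 1 / s)) powr (- (1 / (\<mu> - recip_exp p + 1 / s))))
          {\<lambda>N \<delta>. real N powr (- \<mu> + 2 * real r1 - 1 / s + 3 / 2)
                   * ln (real N) powr (\<mu> - 2 * real r1 + 1 / 2),
           \<lambda>N \<delta>. (\<delta> * ln (1 / \<delta>) powr (1 / s - recip_exp p))
                     powr ((\<mu> - 2 * real r1 + 1 / s - 3 / 2) / (\<mu> - recip_exp p + 1 / s))
                   * ln (1 / \<delta>) powr (2 - 1 / s)}) \<and>
     (r1 = r2 + 1 \<longrightarrow>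
        (\<forall>c1>0. \<forall>c2>0. \<exists>c>0. \<exists>C>0. \<forall>\<^sub>F \<delta> in at_right 0. \<forall>N::nat.
          comparable c1 c2 (real N) (\<delta> powr (- (1 / (\<mu> - recip_exp p + 1 / s)))) \<longrightarrow>
            ecomparable c C (min_radius r1 (r1 - 1) s \<mu> p N \<delta>)
              (real N powr (- \<mu> + 2 * real r1 - 1 / s + 3 / 2)) \<and>
            comparable c C (real N powr (- \<mu> + 2 * real r1 - 1 / s + 3 / 2))
              (\<delta> powr ((\<mu> - 2 * real r1 + 1 / s - 3 / 2) / (\<mu> - recip_exp p + 1 / s)))) \<and>
        (\<forall>\<gamma> \<in> {1 <..< (\<mu> - 2 * real r1 + 1 / s + 5 / 2) / (\<mu> - 2 * real r1 + 1 / s + 1 / 2)} \<union>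
               {(\<mu> - 2 * real r1 + 1 / s + 5 / 2) / (\<mu> - 2 * real r1 + 1 / s + 1 / 2) <..<
                (\<mu> - 2 * real r1 + 1 / s + 1 / 2) / (\<mu> - 2 * real r1 + 1 / s - 3 / 2)}.
          truncation_implements r1 (r1 - 1) s \<mu> p \<gamma>
            (\<lambda>\<delta>. \<delta> powr (- (1 / (\<mu> - recip_exp p + 1 / s))))
            (\<lambda>\<delta>. \<delta> powr (- (1 / (\<mu> - recip_exp p + 1 / s))))
            {\<lambda>N \<delta>. real N powr (- \<mu> + 2 * real r1 - 1 / s + 3 / 2),
             \<lambda>N \<delta>. \<delta> powr ((\<mu> - 2 * real r1 + 1 / s - 3 / 2) / (\<mu> - recip_exp p + 1 / s))})) \<and>
     (r1 > r2 + 1 \<longrightarrow>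
        (\<forall>c1>0. \<forall>c2>0. \<exists>c>0. \<exists>C>0. \<forall>\<^sub>F \<delta> in at_right 0. \<forall>N::nat.
          comparable c1 c2 (real N) (\<delta> powr (- (1 / (\<mu> - recip_exp p + 1 / s)))) \<longrightarrow>
            ecomparable c C (min_radius r1 r2 s \<mu> p N \<delta>)
              (real N powr (- \<mu> + 2 * real r1 - 1 / s + 3 / 2)) \<and>
            comparable c C (real N powr (- \<mu> + 2 * real r1 - 1 / s + 3 / 2))
              (\<delta> powr ((\<mu> - 2 * real r1 + 1 / s - 3 / 2) / (\<mu> - recip_exp p + 1 / s)))) \<and>
        (\<forall>\<gamma> \<in> {1 <..< (\<mu> - 2 * real r2 + 1 / s - 3 / 2) / (\<mu> - 2 * real r1 + 1 / s + 1 / 2)} \<union>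
               {(\<mu> - 2 * real r2 + 1 / s - 3 / 2) / (\<mu> - 2 * real r1 + 1 / s + 1 / 2) <..<
                (\<mu> - 2 * real r2 + 1 / s + 1 / 2) / (\<mu> - 2 * real r1 + 1 / s + 1 / 2)} \<union>
               {(\<mu> - 2 * real r2 + 1 / s + 1 / 2) / (\<mu> - 2 * real r1 + 1 / s + 1 / 2) <..<
                (\<mu> - 2 * real r2 + 1 / s - 3 / 2) / (\<mu> - 2 * real r1 + 1 / s - 3 / 2)}.
          truncation_implements r1 r2 s \<mu> p \<gamma>
            (\<lambda>\<delta>. \<delta> powr (- (1 / (\<mu> - recip_exp p + 1 / s))))
            (\<lambda>\<delta>. \<delta> powr (- (1 / (\<mu> - recip_exp p + 1 / s))))
            {\<lambda>N \<delta>. real N powr (- \<mu> + 2 * real r1 - 1 / s + 3 / 2),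
             \<lambda>N \<delta>. \<delta> powr ((\<mu> - 2 * real r1 + 1 / s - 3 / 2) / (\<mu> - recip_exp p + 1 / s))}))"
proof -
  interpret recovery_setting s \<mu> p r1 r2 by unfold_locales (use assms in auto)
  \<comment> \<open>From \<gamma> (\<alpha> + 2) < y + 2 subtract 2 \<gamma> > 2. This fact and the
    next convert the interval endpoints into the inequality that controls the tail.\<close>
  have \<gamma>: "\<gamma> * \<alpha> < y" if "1 < \<gamma>" "\<gamma> < (y + 2) / (\<alpha> + 2)" for \<gamma> y
  proof -
    have "\<gamma> * (\<alpha> + 2) < y + 2" using that \<alpha>_pos by (simp add: pos_less_divide_eq)
    then show ?thesis using that(1) by (simp add: distrib_left)
  qed
  have \<gamma>': "\<gamma> * \<alpha> < y" if "1 < \<gamma>" "\<gamma> < y / \<alpha>" for \<gamma> y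
    using that \<alpha>_pos by (simp add: pos_less_divide_eq)
  \<comment> \<open>Folding \<open>D\<close> and \<open>\<alpha>\<close> first exposes the scales,
    so that the goals become the statements of the locale.\<close>
  show ?thesis
    unfolding D_def[symmetric]
    unfolding \<alpha>_def[symmetric] exponent'
    unfolding Nscale_def[symmetric] lscale_def[symmetric]
    unfolding scale_def[symmetric]
  proof (intro conjI impI allI ballI)
    fix c1 c2 :: real assume "0 < c1" "0 < c2"
    then show "\<exists>c>0. \<exists>C>0. \<forall>\<^sub>F \<delta> in at_right 0. \<forall>N::nat. comparable c1 c2 (real N) (Nscale \<delta>) \<longrightarrow>
        ennreal (c * real N powr (- \<alpha>)) \<le> min_radius r1 r1 s \<mu> p N \<delta> \<and>
        min_radius r1 r1 s \<mu> p N \<delta> \<le> ennreal (C * bound1 N \<delta>) \<and>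
        ennreal (c * (\<delta> / ln (1 / \<delta>) powr \<mu>) powr (\<alpha> / D)) \<le> min_radius r1 r1 s \<mu> p N \<delta> \<and>
        min_radius r1 r1 s \<mu> p N \<delta> \<le> ennreal (C * bound2 N \<delta>)"
      by (rule min_radius_eq)
  next
    show "truncation_implements r1 r1 s \<mu> p 1 Nscale lscale {bound1, bound2}"
      by (rule truncation_implements_eq)
  next
    fix c1 c2 :: real assume "r1 = r2 + 1" "0 < c1" "0 < c2"
    then show "\<exists>c>0. \<exists>C>0. \<forall>\<^sub>F \<delta> in at_right 0. \<forall>N::nat. comparable c1 c2 (real N) (scale \<delta>) \<longrightarrow>
        ecomparable c C (min_radius r1 (r1 - 1) s \<mu> p N \<delta>) (real N powr (- \<alpha>)) \<and>
        comparable c C (real N powr (- \<alpha>)) (\<delta> powr (\<alpha> / D))"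
      using min_radius_gt[of c1 c2] by simp
  next
    fix \<gamma>
    have \<alpha>2: "\<mu> - 2 * real r1 + 1 / s + 1 / 2 = \<alpha> + 2" "\<mu> - 2 * real r1 + 1 / s + 5 / 2 = \<alpha> + 2 + 2"
      by (simp_all add: \<alpha>_def)
    assume r: "r1 = r2 + 1" and "\<gamma> \<in> {1<..<(\<mu> - 2 * real r1 + 1 / s + 5 / 2) / (\<mu> - 2 * real r1 + 1 / s + 1 / 2)} \<union>
        {(\<mu> - 2 * real r1 + 1 / s + 5 / 2) / (\<mu> - 2 * real r1 + 1 / s + 1 / 2)<..<
         (\<mu> - 2 * real r1 + 1 / s + 1 / 2) / \<alpha>}"
    then have "\<gamma> \<in> {1<..<(\<alpha> + 2 + 2) / (\<alpha> + 2)} \<union> {(\<alpha> + 2 + 2) / (\<alpha> + 2)<..<(\<alpha> + 2) / \<alpha>}"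
      unfolding \<alpha>2 by blast
    \<comment> \<open>Places the second interval to the right of 1 as well.\<close>
    moreover have "1 < (\<alpha> + 2 + 2) / (\<alpha> + 2)" using \<alpha>_pos by simp
    ultimately have "1 < \<gamma> \<and> (\<gamma> < (\<alpha> + 2 + 2) / (\<alpha> + 2) \<or> \<gamma> < (\<alpha> + 2) / \<alpha>)" by auto
    then have "1 < \<gamma>" "\<gamma> * \<alpha> < \<alpha> + 2" using \<gamma>[of \<gamma> "\<alpha> + 2"] \<gamma>'[of \<gamma> "\<alpha> + 2"] by blast+
    \<comment> \<open>One derivative less in the second variable shifts the exponent by 2, so y =
      \<alpha> + 2 here.\<close>
    moreover have "\<alpha> + 2 = \<mu> - 2 * real r2 + 1 / s - 3 / 2" unfolding \<alpha>_def using r by simp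
    ultimately show "truncation_implements r1 (r1 - 1) s \<mu> p \<gamma> scale scale
        {\<lambda>N \<delta>. real N powr (- \<alpha>), \<lambda>N \<delta>. \<delta> powr (\<alpha> / D)}"
      using truncation_implements_gt[of \<gamma>] r by simp
  next
    fix c1 c2 :: real assume "r2 + 1 < r1" "0 < c1" "0 < c2"
    then show "\<exists>c>0. \<exists>C>0. \<forall>\<^sub>F \<delta> in at_right 0. \<forall>N::nat. comparable c1 c2 (real N) (scale \<delta>) \<longrightarrow>
        ecomparable c C (min_radius r1 r2 s \<mu> p N \<delta>) (real N powr (- \<alpha>)) \<and>
        comparable c C (real N powr (- \<alpha>)) (\<delta> powr (\<alpha> / D))"
      by (intro min_radius_gt) auto
  next
    fix \<gamma>
    define y where "y = \<mu> - 2 * real r2 + 1 / s - 3 / 2"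
    have \<alpha>2: "\<mu> - 2 * real r1 + 1 / s + 1 / 2 = \<alpha> + 2" and y2: "\<mu> - 2 * real r2 + 1 / s + 1 / 2 = y + 2"
      by (simp_all add: \<alpha>_def y_def)
    assume r: "r2 + 1 < r1" and "\<gamma> \<in> {1<..<(\<mu> - 2 * real r2 + 1 / s - 3 / 2) / (\<mu> - 2 * real r1 + 1 / s + 1 / 2)} \<union>
        {(\<mu> - 2 * real r2 + 1 / s - 3 / 2) / (\<mu> - 2 * real r1 + 1 / s + 1 / 2)<..<
         (\<mu> - 2 * real r2 + 1 / s + 1 / 2) / (\<mu> - 2 * real r1 + 1 / s + 1 / 2)} \<union>
        {(\<mu> - 2 * real r2 + 1 / s + 1 / 2) / (\<mu> - 2 * real r1 + 1 / s + 1 / 2)<..<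
         (\<mu> - 2 * real r2 + 1 / s - 3 / 2) / \<alpha>}"
    then have "\<gamma> \<in> {1<..<y / (\<alpha> + 2)} \<union> {y / (\<alpha> + 2)<..<(y + 2) / (\<alpha> + 2)} \<union> {(y + 2) / (\<alpha> + 2)<..<y / \<alpha>}"
      unfolding \<alpha>2 y2 y_def[symmetric] by blast
    \<comment> \<open>Since r1 \<ge> r2 + 2, y is at least \<alpha> + 4; hence all three intervals
      lie to the right of 1.\<close>
    moreover have "1 < y / (\<alpha> + 2)" "y / (\<alpha> + 2) \<le> (y + 2) / (\<alpha> + 2)"
      using r \<alpha>_pos by (auto simp: pos_less_divide_eq \<alpha>_def y_def divide_right_mono)
    ultimately have "1 < \<gamma> \<and> (\<gamma> < (y + 2) / (\<alpha> + 2) \<or> \<gamma> < y / \<alpha>)" by auto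
    then have "1 < \<gamma>" "\<gamma> * \<alpha> < y" using \<gamma>[of \<gamma> y] \<gamma>'[of \<gamma> y] by blast+
    then show "truncation_implements r1 r2 s \<mu> p \<gamma> scale scale
        {\<lambda>N \<delta>. real N powr (- \<alpha>), \<lambda>N \<delta>. \<delta> powr (\<alpha> / D)}"
      unfolding y_def by (rule truncation_implements_gt)
  qed
qed

end
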